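(* Let $\mu(\mathfrak g)$ denote the least $N$ such that the real Lie algebra $\mathfrak g$ has a faithful representation in $\mathfrak{gl}(N,\mathbb R)$. Among the eight-dimensional Lie algebras $L_{8.1},\dots,L_{8.22}$ defined in the context, one has $\mu=4$ for $L_{8.12}$ with $p=1$, $L_{8.13}$ with $\epsilon=-1$, $L_{8.14}$, $L_{8.16}$, $L_{8.17}$ and $L_{8.18}$ (for all permitted values of the parameters), and $\mu>4$ for all the others.
   Context: Each of the following is the real Lie algebra (under the commutator) of all matrices of the displayed form, where the letters $a,b,c,d,e,f,g,h$ run over all real numbers and $p,q,\lambda,\nu$ are fixed real parameters. (These are Turkowski's eight-dimensional Lie algebras with non-trivial Levi decomposition.) $L_{8.1}$ ($p\ne0$): $\begin{pmatrix}h&c&-b&0&d\\ -c&h&a&0&e\\ b&-a&h&0&f\\ 0&0&0&ph&pg\\ 0&0&0&0&0\end{pmatrix}$; $L_{8.2}$: $\begin{pmatrix}0&a&b&c&0&e\\ -a&0&-c&b&0&f\\ -b&c&0&-a&0&d\\ -c&-b&a&0&0&g\\ f&-e&g&-d&0&h\\ 0&0&0&0&0&0\end{pmatrix}$; $L_{8.3}$: $\begin{pmatrix}0&-\frac b2&-\frac c2&-\frac a2&d\\ \frac b2&0&-\frac a2&\frac c2&e\\ \frac c2&\frac a2&0&-\frac b2&f\\ \frac a2&-\frac c2&\frac b2&0&g\\ 0&0&0&0&h\end{pmatrix}$; $L_{8.4}$: $\begin{pmatrix}ph&b&c+h&a&d\\ -b&ph&a&h-c&e\\ -c-h&-a&ph&b&f\\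 -a&c-h&-b&ph&g\\ 0&0&0&0&0\end{pmatrix}$; $L_{8.5}$: $\begin{pmatrix}0&2c&4b&4a&0&d\\ -2c&0&-4a&4b&0&e\\ -b&a&0&c&-6a&f\\ -a&-b&-c&0&-6b&g\\ 0&0&2a&2b&0&h\\ 0&0&0&0&0&0\end{pmatrix}$; $L_{8.6}$: $\begin{pmatrix}a&b&0&0&0&d\\ c&-a&0&0&0&e\\ 0&0&0&0&0&f\\ 0&0&0&0&0&g\\ e&-d&g&-f&0&h\\ 0&0&0&0&0&0\end{pmatrix}$; $L_{8.7}$ ($pq\ne0$): $\begin{pmatrix}h+a&b&0&0&d\\ c&h-a&0&0&e\\ 0&0&ph&0&f\\ 0&0&0&qh&g\\ 0&0&0&0&0\end{pmatrix}$; $L_{8.8}$: $\begin{pmatrix}a+h&b&0&0&d\\ c&h-a&0&0&e\\ 0&0&ph&h&f\\ 0&0&0&ph&g\\ 0&0&0&0&0\end{pmatrix}$; $L_{8.9}$ ($q\neq0$): $\begin{pmatrix}a+h&b&0&0&d\\ c&h-a&0&0&e\\ 0&0&ph&qh&f\\ 0&0&-qh&ph&g\\ 0&0&0&0&0\end{pmatrix}$; $L_{8.10}$ ($p\ne0$): $\begin{pmatrix}a+h&b&0&0&d\\ c&h-a&0&0&e\\ -e&d&2h&0&f\\ 0&0&0&ph&pg\\ 0&0&0&0&0\end{pmatrix}$; $L_{8.11}$: $\begin{pmatrix}a+h&b&0&0&d\\ c&h-a&0&0&e\\ -e&d&2h&h&f\\ 0&0&0&2h&g\\ 0&0&0&0&0\end{pmatrix}$;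 $L_{8.12}$ ($p\neq0$): $\begin{pmatrix}h+2a&2b&0&0&d\\ c&h&b&0&e\\ 0&2c&h-2a&0&f\\ 0&0&0&ph&g\\ 0&0&0&0&0\end{pmatrix}$; $L_{8.13}$, $\epsilon=1$: $\begin{pmatrix}a&b&0&0&0&d\\ c&-a&0&0&0&e\\ 0&0&a&b&0&f\\ 0&0&c&-a&0&g\\ e&-d&g&-f&0&h\\ 0&0&0&0&0&0\end{pmatrix}$; $L_{8.13}$, $\epsilon=-1$: $\begin{pmatrix}a&b&0&d\\ c&-a&0&e\\ f&g&0&h\\ 0&0&0&0\end{pmatrix}$; $L_{8.14}$: $\begin{pmatrix}a&b&f&d\\ c&-a&g&e\\ 0&0&0&h\\ 0&0&0&0\end{pmatrix}$; $L_{8.15}$: $\begin{pmatrix}a&b&-h&0&d&e\\ c&-a&0&-h&f&g\\ 0&0&a&b&0&d\\ 0&0&c&-a&0&f\\ 0&0&f&-d&0&2h\\ 0&0&0&0&0&0\end{pmatrix}$; $L_{8.16}$: $\begin{pmatrix}a&b&d&e\\ c&-a&f&g\\ 0&0&h&h\\ 0&0&0&h\end{pmatrix}$; $L_{8.17}$: $\begin{pmatrix}\lambda h+a&b&d&e\\ c&\lambda h-a&f&g\\ 0&0&(1+\lambda)h&0\\ 0&0&0&(\lambda+p)h\end{pmatrix}$ (the isomorphism type does not depend on $\lambda$); $L_{8.18}$ (with parameter $p=\nu-\lambda$): $\begin{pmatrix}\lambda d+a&b&e&f\\ c&\lambda d-a&g&h\\ 0&0&\nu d&d\\ 0&0&-d&\nu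 d\end{pmatrix}$; $L_{8.19}$: $\begin{pmatrix}3a&3b&0&0&0&d\\ c&a&2b&0&0&e\\ 0&2c&-a&b&0&f\\ 0&0&3c&-3a&0&g\\ -g&3f&-3e&d&0&2h\\ 0&0&0&0&0&0\end{pmatrix}$; $L_{8.20}$: $\begin{pmatrix}h+3a&3b&0&0&d\\ c&h+a&2b&0&e\\ 0&2c&h-a&b&f\\ 0&0&3c&h-3a&g\\ 0&0&0&0&0\end{pmatrix}$; $L_{8.21}$: $\begin{pmatrix}4a&4b&0&0&0&d\\ c&2a&3b&0&0&e\\ 0&2c&0&2b&0&f\\ 0&0&3c&-2a&b&g\\ 0&0&0&4c&-4a&h\\ 0&0&0&0&0&0\end{pmatrix}$; $L_{8.22}$: $\begin{pmatrix}a&b&d&e&g\\ c&-a&f&-d&h\\ 0&0&a&b&0\\ 0&0&c&-a&0\\ 0&0&0&0&0\end{pmatrix}$. *)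

theory Defs
  imports Complex_Main "Jordan_Normal_Form.Matrix"
begin

definition commutator :: "real mat \<Rightarrow> real mat \<Rightarrow> real mat" where
  "commutator A B = A * B - B * A"

definition lie_representation :: "real mat set \<Rightarrow> nat \<Rightarrow> (real mat \<Rightarrow> real mat) \<Rightarrow> bool" where
  "lie_representation \<gg> N \<phi> \<longleftrightarrow>
     \<phi> \<in> \<gg> \<rightarrow> carrier_mat N N \<and>
     (\<forall>x\<in>\<gg>. \<forall>y\<in>\<gg>. \<phi> (x + y) = \<phi> x + \<phi> y) \<and>
     (\<forall>t. \<forall>x\<in>\<gg>. \<phi> (t \<cdot>\<^sub>m x) = t \<cdot>\<^sub>m \<phi> x) \<and>
     (\<forall>x\<in>\<gg>. \<forall>y\<in>\<gg>. \<phi> (commutator x y) = commutator (\<phi> x) (\<phi> y))"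

definition faithful_representation :: "real mat set \<Rightarrow> nat \<Rightarrow> (real mat \<Rightarrow> real mat) \<Rightarrow> bool" where
  "faithful_representation \<gg> N \<phi> \<longleftrightarrow> lie_representation \<gg> N \<phi> \<and> inj_on \<phi> \<gg>"

text \<open>Meaningful when the argument is a linear subspace of the $n \times n$ matrices, for some $n$,
  closed under the commutator; the identity map is then a faithful representation with $N = n$,
  so the minimum exists.\<close>

definition mu :: "real mat set \<Rightarrow> nat" where
  "mu \<gg> = (LEAST N. \<exists>\<phi>. faithful_representation \<gg> N \<phi>)"

text \<open>Turkowski's eight-dimensional real Lie algebras with non-trivial Levi decomposition. The
  restrictions on the parameters are not part of the definitions. The suffixes in \<open>L8_13_plus\<close>
  and \<open>L8_13_minus\<close> are the sign $\epsilon = \pm 1$.\<close>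

definition L8_1 :: "real \<Rightarrow> real mat set" where
  "L8_1 p = {mat_of_rows_list 5
    [[h , c , -b, 0    , d],
     [-c, h , a , 0    , e],
     [b , -a, h , 0    , f],
     [0 , 0 , 0 , p * h, p * g],
     [0 , 0 , 0 , 0    , 0]]
    | a b c d e f g h. True}"

definition L8_2 :: "real mat set" where
  "L8_2 = {mat_of_rows_list 6
    [[0 , a , b , c , 0, e],
     [-a, 0 , -c, b , 0, f],
     [-b, c , 0 , -a, 0, d],
     [-c, -b, a , 0 , 0, g],
     [f , -e, g , -d, 0, h],
     [0 , 0 , 0 , 0 , 0, 0]]
    | a b c d e f g h. True}"

definition L8_3 :: "real mat set" where
  "L8_3 = {mat_of_rows_list 5
    [[0    , -b / 2, -c / 2, -a / 2, d],
     [b / 2, 0     , -a / 2, c / 2 , e],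
     [c / 2, a / 2 , 0     , -b / 2, f],
     [a / 2, -c / 2, b / 2 , 0     , g],
     [0    , 0     , 0     , 0     , h]]
    | a b c d e f g h. True}"

definition L8_4 :: "real \<Rightarrow> real mat set" where
  "L8_4 p = {mat_of_rows_list 5
    [[p * h , b    , c + h, a    , d],
     [-b    , p * h, a    , h - c, e],
     [-c - h, -a   , p * h, b    , f],
     [-a    , c - h, -b   , p * h, g],
     [0     , 0    , 0    , 0    , 0]]
    | a b c d e f g h. True}"

definition L8_5 :: "real mat set" where
  "L8_5 = {mat_of_rows_list 6
    [[0     , 2 * c, 4 * b , 4 * a, 0     , d],
     [-2 * c, 0    , -4 * a, 4 * b, 0     , e],
     [-b    , a    , 0     , c    , -6 * a, f],
     [-a    , -b   , -c    , 0    , -6 * b, g],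
     [0     , 0    , 2 * a , 2 * b, 0     , h],
     [0     , 0    , 0     , 0    , 0     , 0]]
    | a b c d e f g h. True}"

definition L8_6 :: "real mat set" where
  "L8_6 = {mat_of_rows_list 6
    [[a, b , 0, 0 , 0, d],
     [c, -a, 0, 0 , 0, e],
     [0, 0 , 0, 0 , 0, f],
     [0, 0 , 0, 0 , 0, g],
     [e, -d, g, -f, 0, h],
     [0, 0 , 0, 0 , 0, 0]]
    | a b c d e f g h. True}"

definition L8_7 :: "real \<Rightarrow> real \<Rightarrow> real mat set" where
  "L8_7 p q = {mat_of_rows_list 5
    [[h + a, b    , 0    , 0    , d],
     [c    , h - a, 0    , 0    , e],
     [0    , 0    , p * h, 0    , f],
     [0    , 0    , 0    , q * h, g],
     [0    , 0    , 0    , 0    , 0]]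
    | a b c d e f g h. True}"

definition L8_8 :: "real \<Rightarrow> real mat set" where
  "L8_8 p = {mat_of_rows_list 5
    [[a + h, b    , 0    , 0    , d],
     [c    , h - a, 0    , 0    , e],
     [0    , 0    , p * h, h    , f],
     [0    , 0    , 0    , p * h, g],
     [0    , 0    , 0    , 0    , 0]]
    | a b c d e f g h. True}"

definition L8_9 :: "real \<Rightarrow> real \<Rightarrow> real mat set" where
  "L8_9 p q = {mat_of_rows_list 5
    [[a + h, b    , 0     , 0    , d],
     [c    , h - a, 0     , 0    , e],
     [0    , 0    , p * h , q * h, f],
     [0    , 0    , -q * h, p * h, g],
     [0    , 0    , 0     , 0    , 0]]
    | a b c d e f g h. True}"

definition L8_10 :: "real \<Rightarrow> real mat set" where
  "L8_10 p = {mat_of_rows_list 5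
    [[a + h, b    , 0    , 0    , d],
     [c    , h - a, 0    , 0    , e],
     [-e   , d    , 2 * h, 0    , f],
     [0    , 0    , 0    , p * h, p * g],
     [0    , 0    , 0    , 0    , 0]]
    | a b c d e f g h. True}"

definition L8_11 :: "real mat set" where
  "L8_11 = {mat_of_rows_list 5
    [[a + h, b    , 0    , 0    , d],
     [c    , h - a, 0    , 0    , e],
     [-e   , d    , 2 * h, h    , f],
     [0    , 0    , 0    , 2 * h, g],
     [0    , 0    , 0    , 0    , 0]]
    | a b c d e f g h. True}"

definition L8_12 :: "real \<Rightarrow> real mat set" where
  "L8_12 p = {mat_of_rows_list 5
    [[h + 2 * a, 2 * b, 0        , 0    , d],
     [c        , h    , b        , 0    , e],
     [0        , 2 * c, h - 2 * a, 0    , f],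
     [0        , 0    , 0        , p * h, g],
     [0        , 0    , 0        , 0    , 0]]
    | a b c d e f g h. True}"

definition L8_13_plus :: "real mat set" where
  "L8_13_plus = {mat_of_rows_list 6
    [[a, b , 0, 0 , 0, d],
     [c, -a, 0, 0 , 0, e],
     [0, 0 , a, b , 0, f],
     [0, 0 , c, -a, 0, g],
     [e, -d, g, -f, 0, h],
     [0, 0 , 0, 0 , 0, 0]]
    | a b c d e f g h. True}"

definition L8_13_minus :: "real mat set" where
  "L8_13_minus = {mat_of_rows_list 4
    [[a, b , 0, d],
     [c, -a, 0, e],
     [f, g , 0, h],
     [0, 0 , 0, 0]]
    | a b c d e f g h. True}"

definition L8_14 :: "real mat set" where
  "L8_14 = {mat_of_rows_list 4
    [[a, b , f, d],
     [c, -a, g, e],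
     [0, 0 , 0, h],
     [0, 0 , 0, 0]]
    | a b c d e f g h. True}"

definition L8_15 :: "real mat set" where
  "L8_15 = {mat_of_rows_list 6
    [[a, b , -h, 0 , d, e],
     [c, -a, 0 , -h, f, g],
     [0, 0 , a , b , 0, d],
     [0, 0 , c , -a, 0, f],
     [0, 0 , f , -d, 0, 2 * h],
     [0, 0 , 0 , 0 , 0, 0]]
    | a b c d e f g h. True}"

definition L8_16 :: "real mat set" where
  "L8_16 = {mat_of_rows_list 4
    [[a, b , d, e],
     [c, -a, f, g],
     [0, 0 , h, h],
     [0, 0 , 0, h]]
    | a b c d e f g h. True}"

definition L8_17 :: "real \<Rightarrow> real \<Rightarrow> real mat set" where
  "L8_17 lam p = {mat_of_rows_list 4
    [[lam * h + a, b          , d            , e],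
     [c          , lam * h - a, f            , g],
     [0          , 0          , (1 + lam) * h, 0],
     [0          , 0          , 0            , (lam + p) * h]]
    | a b c d e f g h. True}"

definition L8_18 :: "real \<Rightarrow> real \<Rightarrow> real mat set" where
  "L8_18 lam nu = {mat_of_rows_list 4
    [[lam * d + a, b          , e     , f],
     [c          , lam * d - a, g     , h],
     [0          , 0          , nu * d, d],
     [0          , 0          , -d    , nu * d]]
    | a b c d e f g h. True}"

definition L8_19 :: "real mat set" where
  "L8_19 = {mat_of_rows_list 6
    [[3 * a, 3 * b, 0     , 0     , 0, d],
     [c    , a    , 2 * b , 0     , 0, e],
     [0    , 2 * c, -a    , b     , 0, f],
     [0    , 0    , 3 * c , -3 * a, 0, g],
     [-g   , 3 * f, -3 * e, d     , 0, 2 * h],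
     [0    , 0    , 0     , 0     , 0, 0]]
    | a b c d e f g h. True}"

definition L8_20 :: "real mat set" where
  "L8_20 = {mat_of_rows_list 5
    [[h + 3 * a, 3 * b, 0    , 0        , d],
     [c        , h + a, 2 * b, 0        , e],
     [0        , 2 * c, h - a, b        , f],
     [0        , 0    , 3 * c, h - 3 * a, g],
     [0        , 0    , 0    , 0        , 0]]
    | a b c d e f g h. True}"

definition L8_21 :: "real mat set" where
  "L8_21 = {mat_of_rows_list 6
    [[4 * a, 4 * b, 0    , 0     , 0     , d],
     [c    , 2 * a, 3 * b, 0     , 0     , e],
     [0    , 2 * c, 0    , 2 * b , 0     , f],
     [0    , 0    , 3 * c, -2 * a, b     , g],
     [0    , 0    , 0    , 4 * c , -4 * a, h],
     [0    , 0    , 0    , 0     , 0     , 0]]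
    | a b c d e f g h. True}"

definition L8_22 :: "real mat set" where
  "L8_22 = {mat_of_rows_list 5
    [[a, b , d, e , g],
     [c, -a, f, -d, h],
     [0, 0 , a, b , 0],
     [0, 0 , c, -a, 0],
     [0, 0 , 0, 0 , 0]]
    | a b c d e f g h. True}"

end

theory Submission
  imports Defs "HOL-Analysis.Analysis"
begin

text \<open>
  A representation on \<open>\<real>\<^sup>N\<close> with \<open>N \<le> 4\<close> is padded by zeros to one on \<open>\<real>\<^sup>4\<close> and restricted to the Levi factor,
  which after complexification in the case of \<open>so\<^sub>3\<close> is spanned by an \<open>sl\<^sub>2\<close>-triple. If \<open>E\<^sup>r\<close> is the last
  non-zero power of \<open>E\<close>, then \<open>H\<close> acts as \<open>r\<close> on the image of \<open>E\<^sup>r\<close>; this yields highest weight vectors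
  and, case by case in \<open>r\<close>, one of the modules \<open>V\<^sub>3\<close>, \<open>V\<^sub>2 \<oplus> V\<^sub>0\<close>, \<open>V\<^sub>1 \<oplus> V\<^sub>1\<close>, \<open>V\<^sub>1 \<oplus> V\<^sub>0 \<oplus> V\<^sub>0\<close>.
  The radical consists of weight vectors in \<open>gl\<^sub>4\<close>. Odd weights occur only for \<open>V\<^sub>1 \<oplus> V\<^sub>0 \<oplus> V\<^sub>0\<close>, where the
  vectors of weight 1 are given by a row and a column of length two and the commutant by \<open>2 \<times> 2\<close> matrices, so
  that the brackets of the radical become contradictory equations. This module has no real form for
  \<open>so\<^sub>3\<close>: the generators of \<open>so\<^sub>3\<close> would give a quaternionic structure on a real plane.
\<close>

section \<open>Matrices of size four\<close>

text \<open>The even weights need obstructions of their own. A commuting V_4 has extreme vectors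
  proportional to E^2 and F^2, which do not commute. A V_2 scaled by an element commuting with the
  Levi factor lives only on V_1 + V_1, where everything reduces to brackets of 2x2 matrices and the
  parameter is forced to be 1. That exceptional value shapes the case of \<open>L8_1\<close>:
  \<open>L8_1 p\<close> and \<open>L8_12 p\<close> are real forms of the same complex algebra, which
  for \<open>p = 1\<close> does embed into gl_4, so complexification alone cannot exclude
  \<open>L8_1 1\<close>. The real form does: on V_1 + V_1 the algebra so_3 acts by quaternions on
  all of the real 4-space, and a nilpotent matrix commuting with them vanishes. The arguments run
  over a field that may be real or complex; the eigenvalues of H are read off from the nilpotency of
  E instead of from a characteristic polynomial. Padding would blur the difference between dimension
  4 and smaller dimensions; it survives as the fourth unit vector, which is killed from both sides
  when N < 4.\<close>

no_notation vec_index (infixl \<open>$\<close> 100)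

lemma distinct_4: "(1::4) \<noteq> 2" "(1::4) \<noteq> 3" "(1::4) \<noteq> 4" "(2::4) \<noteq> 3" "(2::4) \<noteq> 4" "(3::4) \<noteq> 4"
   "(2::4) \<noteq> 1" "(3::4) \<noteq> 1" "(4::4) \<noteq> 1" "(3::4) \<noteq> 2" "(4::4) \<noteq> 2" "(4::4) \<noteq> 3"
  by simp_all

lemma exhaust_4: "x = 1 \<or> x = 2 \<or> x = 3 \<or> x = (4::4)"
proof (induct x)
  case (of_int z)
  then have "z = 0 \<or> z = 1 \<or> z = 2 \<or> z = 3" by fastforce
  then show ?case by auto
qed

lemma UNIV_4: "UNIV = {1::4, 2, 3, 4}"
  using exhaust_4 by auto

lemma forall_4: "(\<forall>i::4. P i) \<longleftrightarrow> P 1 \<and> P 2 \<and> P 3 \<and> P 4"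
  by (metis exhaust_4)

lemma sum_4: "sum f (UNIV::4 set) = f 1 + f 2 + f 3 + f 4"
  unfolding UNIV_4 using distinct_4 by (simp add: ac_simps)

text \<open>Serves as a constructor: with rewrite rules for products, sums and equality, a matrix
  identity becomes a list of scalar equations in named entries.\<close>

definition m4 :: "'a \<Rightarrow> 'a \<Rightarrow> 'a \<Rightarrow> 'a \<Rightarrow> 'a \<Rightarrow> 'a \<Rightarrow> 'a \<Rightarrow> 'a \<Rightarrow> 'a \<Rightarrow> 'a \<Rightarrow> 'a \<Rightarrow> 'a \<Rightarrow> 'a \<Rightarrow> 'a \<Rightarrow> 'a \<Rightarrow> 'a \<Rightarrow> 'a^4^4" where
  "m4 a b c d e f g h i j k l m n p q = (\<chi> r s.
     if r = 1 then (if s = 1 then a else if s = 2 then b else if s = 3 then c else d)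
     else if r = 2 then (if s = 1 then e else if s = 2 then f else if s = 3 then g else h)
     else if r = 3 then (if s = 1 then i else if s = 2 then j else if s = 3 then k else l)
     else (if s = 1 then m else if s = 2 then n else if s = 3 then p else q))"

lemma m4_nth [simp]:
  "m4 a b c d e f g h i j k l m n p q $ 1 $ 1 = a" "m4 a b c d e f g h i j k l m n p q $ 1 $ 2 = b"
  "m4 a b c d e f g h i j k l m n p q $ 1 $ 3 = c" "m4 a b c d e f g h i j k l m n p q $ 1 $ 4 = d"
  "m4 a b c d e f g h i j k l m n p q $ 2 $ 1 = e" "m4 a b c d e f g h i j k l m n p q $ 2 $ 2 = f"
  "m4 a b c d e f g h i j k l m n p q $ 2 $ 3 = g" "m4 a b c d e f g h i j k l m n p q $ 2 $ 4 = h"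
  "m4 a b c d e f g h i j k l m n p q $ 3 $ 1 = i" "m4 a b c d e f g h i j k l m n p q $ 3 $ 2 = j"
  "m4 a b c d e f g h i j k l m n p q $ 3 $ 3 = k" "m4 a b c d e f g h i j k l m n p q $ 3 $ 4 = l"
  "m4 a b c d e f g h i j k l m n p q $ 4 $ 1 = m" "m4 a b c d e f g h i j k l m n p q $ 4 $ 2 = n"
  "m4 a b c d e f g h i j k l m n p q $ 4 $ 3 = p" "m4 a b c d e f g h i j k l m n p q $ 4 $ 4 = q"
  by (simp_all add: m4_def distinct_4)

lemma mat4_eq_iff: "(X::'a^4^4) = Y \<longleftrightarrow>
   (X$1$1 = Y$1$1 \<and> X$1$2 = Y$1$2 \<and> X$1$3 = Y$1$3 \<and> X$1$4 = Y$1$4) \<and>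
   (X$2$1 = Y$2$1 \<and> X$2$2 = Y$2$2 \<and> X$2$3 = Y$2$3 \<and> X$2$4 = Y$2$4) \<and>
   (X$3$1 = Y$3$1 \<and> X$3$2 = Y$3$2 \<and> X$3$3 = Y$3$3 \<and> X$3$4 = Y$3$4) \<and>
   (X$4$1 = Y$4$1 \<and> X$4$2 = Y$4$2 \<and> X$4$3 = Y$4$3 \<and> X$4$4 = Y$4$4)"
  by (simp add: vec_eq_iff forall_4)

lemma m4_eq_iff [simp]:
  "m4 a b c d e f g h i j k l m n p q = m4 a' b' c' d' e' f' g' h' i' j' k' l' m' n' p' q' \<longleftrightarrow>
   a = a' \<and> b = b' \<and> c = c' \<and> d = d' \<and> e = e' \<and> f = f' \<and> g = g' \<and> h = h' \<and>
   i = i' \<and> j = j' \<and> k = k' \<and> l = l' \<and> m = m' \<and> n = n' \<and> p = p' \<and> q = q'"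
  by (simp add: mat4_eq_iff)

lemma m4_mult [simp]:
  "m4 a b c d e f g h i j k l m n p q ** m4 a' b' c' d' e' f' g' h' i' j' k' l' m' n' p' q' =
   m4 (a*a' + b*e' + c*i' + d*m') (a*b' + b*f' + c*j' + d*n') (a*c' + b*g' + c*k' + d*p') (a*d' + b*h' + c*l' + d*q')
      (e*a' + f*e' + g*i' + h*m') (e*b' + f*f' + g*j' + h*n') (e*c' + f*g' + g*k' + h*p') (e*d' + f*h' + g*l' + h*q')
      (i*a' + j*e' + k*i' + l*m') (i*b' + j*f' + k*j' + l*n') (i*c' + j*g' + k*k' + l*p') (i*d' + j*h' + k*l' + l*q')
      (m*a' + n*e' + p*i' + q*m') (m*b' + n*f' + p*j' + q*n') (m*c' + n*g' + p*k' + q*p') (m*d' + n*h' + p*l' + q*q')"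
  by (simp add: mat4_eq_iff matrix_matrix_mult_def sum_4)

lemma m4_arith [simp]:
  "m4 a b c d e f g h i j k l m n p q + m4 a' b' c' d' e' f' g' h' i' j' k' l' m' n' p' q' =
   m4 (a + a') (b + b') (c + c') (d + d') (e + e') (f + f') (g + g') (h + h')
      (i + i') (j + j') (k + k') (l + l') (m + m') (n + n') (p + p') (q + q')"
  "m4 x1 x2 x3 x4 x5 x6 x7 x8 y1 y2 y3 y4 y5 y6 y7 y8 - m4 x1' x2' x3' x4' x5' x6' x7' x8' y1' y2' y3' y4' y5' y6' y7' y8' =
   m4 (x1 - x1') (x2 - x2') (x3 - x3') (x4 - x4') (x5 - x5') (x6 - x6') (x7 - x7') (x8 - x8')
      (y1 - y1') (y2 - y2') (y3 - y3') (y4 - y4') (y5 - y5') (y6 - y6') (y7 - y7') (y8 - y8')"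
  by (simp_all add: mat4_eq_iff)

lemma m4_scaleR [simp]:
  "r *\<^sub>R m4 z1 z2 z3 z4 z5 z6 z7 z8 w1 w2 w3 w4 w5 w6 w7 w8 =
   m4 (of_real r * z1) (of_real r * z2) (of_real r * z3) (of_real r * z4)
      (of_real r * z5) (of_real r * z6) (of_real r * z7) (of_real r * z8)
      (of_real r * w1) (of_real r * w2) (of_real r * w3) (of_real r * w4)
      (of_real r * w5) (of_real r * w6) (of_real r * w7) (of_real r * (w8::'a::real_algebra_1))"
  by (simp add: mat4_eq_iff) (simp add: scaleR_conv_of_real)

lemma m4_zero: "(0::'a::zero^4^4) = m4 0 0 0 0 0 0 0 0 0 0 0 0 0 0 0 0"
  by (simp add: mat4_eq_iff)

lemma m4_one: "(mat 1::'a::zero_neq_one^4^4) = m4 1 0 0 0 0 1 0 0 0 0 1 0 0 0 0 1"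
  by (simp add: mat4_eq_iff mat_def distinct_4)

lemma m4_eta: "X = m4 (X$1$1) (X$1$2) (X$1$3) (X$1$4) (X$2$1) (X$2$2) (X$2$3) (X$2$4)
   (X$3$1) (X$3$2) (X$3$3) (X$3$4) (X$4$1) (X$4$2) (X$4$3) (X$4$4)"
  by (simp add: mat4_eq_iff)

lemma m4_cases: obtains a b c d e f g h i j k l m n p q where "X = m4 a b c d e f g h i j k l m n p q"
  using m4_eta by blast

text \<open>The test on the indices matters because \<open>M $$ (i, j)\<close> carries no
  information outside the dimensions of \<open>M\<close>.\<close>

definition pad :: "nat \<Rightarrow> real mat \<Rightarrow> real^4^4" where
  "pad N M = (let z = (\<lambda>i j. if i < N \<and> j < N then M $$ (i, j) else 0) in
     m4 (z 0 0) (z 0 1) (z 0 2) (z 0 3) (z 1 0) (z 1 1) (z 1 2) (z 1 3)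
        (z 2 0) (z 2 1) (z 2 2) (z 2 3) (z 3 0) (z 3 1) (z 3 2) (z 3 3))"

lemma pad_mult:
  assumes "N \<le> 4" "X \<in> carrier_mat N N" "Y \<in> carrier_mat N N"
  shows "pad N (X * Y) = pad N X ** pad N Y"
proof -
  have "N = 0 \<or> N = 1 \<or> N = 2 \<or> N = 3 \<or> N = 4" using assms(1) by auto
  then show ?thesis using assms(2,3)
    by (elim disjE) (simp_all add: pad_def Let_def scalar_prod_def numeral_eq_Suc)
qed

lemma pad_linear:
  assumes "X \<in> carrier_mat N N" "Y \<in> carrier_mat N N"
  shows "pad N (X + Y) = pad N X + pad N Y" "pad N (X - Y) = pad N X - pad N Y" "pad N (t \<cdot>\<^sub>m X) = t *\<^sub>R pad N X"
  using assms by (auto simp: pad_def Let_def)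

lemma pad_inj:
  assumes "N \<le> 4" "X \<in> carrier_mat N N" "Y \<in> carrier_mat N N" "pad N X = pad N Y"
  shows "X = Y"
proof (rule eq_matI)
  fix i j assume "i < dim_row Y" "j < dim_col Y"
  then have ij: "i < N" "j < N" using assms by auto
  then have "i = 0 \<or> i = 1 \<or> i = 2 \<or> i = 3" "j = 0 \<or> j = 1 \<or> j = 2 \<or> j = 3" using assms(1) by auto
  then show "X $$ (i,j) = Y $$ (i,j)" using assms(4) ij
    by (elim disjE) (auto simp: pad_def Let_def)
qed (use assms in auto)

section \<open>Triples of type \<open>sl\<^sub>2\<close> and strings\<close>

definition cm :: "'a::ring_1^'n^'n \<Rightarrow> 'a^'n^'n \<Rightarrow> 'a^'n^'n" where
  "cm X Y = X ** Y - Y ** X"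

text \<open>The structure constants act by \<open>*\<^sub>R\<close>, so that the same notion serves
  real matrices and their complexifications.\<close>

definition sl2_triple :: "'a::real_algebra_1^'n^'n \<Rightarrow> 'a^'n^'n \<Rightarrow> 'a^'n^'n \<Rightarrow> bool" where
  "sl2_triple H E F \<longleftrightarrow> cm H E = 2 *\<^sub>R E \<and> cm H F = (-2) *\<^sub>R F \<and> cm E F = H"

lemma matrix_mult_scaleR:
  fixes X Y :: "'a::real_algebra_1^'n^'n"
  shows "(r *\<^sub>R X) ** Y = r *\<^sub>R (X ** Y)" "X ** (r *\<^sub>R Y) = r *\<^sub>R (X ** Y)"
  by (simp_all add: vec_eq_iff matrix_matrix_mult_def scaleR_sum_right)

lemma matrix_mult_zero [simp]:
  fixes X :: "'a::ring_1^'n^'n"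
  shows "0 ** X = 0" "X ** 0 = 0"
  by (simp_all add: vec_eq_iff matrix_matrix_mult_def)

lemma matrix_mult_distribs:
  fixes X Y Z :: "'a::ring_1^'n^'n"
  shows "X ** (Y + Z) = X ** Y + X ** Z" "(X + Y) ** Z = X ** Z + Y ** Z"
    "X ** (Y - Z) = X ** Y - X ** Z" "(X - Y) ** Z = X ** Z - Y ** Z"
    "X ** (- Z) = - (X ** Z)" "(- X) ** Z = - (X ** Z)"
  by (simp_all add: vec_eq_iff matrix_matrix_mult_def algebra_simps sum.distrib sum_subtractf sum_negf)

lemma matrix_vector_smult: "A *v (c *s x) = c *s (A *v (x::'a::field^'n))"
  by (simp add: vec_eq_iff matrix_vector_mult_def sum_distrib_left algebra_simps)

lemma matrix_scaleR_vector: "(r *\<^sub>R A) *v x = of_real r *s (A *v (x::'a::{real_algebra_1,field}^'n))"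
proof -
  have "(r *\<^sub>R A) $ i $ j * x $ j = of_real r * (A $ i $ j * x $ j)" for i j
    by (simp only: vector_scaleR_component scaleR_conv_of_real[of r "A $ i $ j"] mult.assoc)
  then show ?thesis
    by (simp only: vec_eq_iff matrix_vector_mult_def vec_lambda_beta vector_smult_component sum_distrib_left) simp
qed

lemma cm_mult_right: "cm H (X ** Y) = cm H X ** Y + X ** cm H Y"
  by (simp add: cm_def matrix_mult_distribs matrix_mul_assoc)

lemma cm_scaleR: "cm (r *\<^sub>R X) Y = r *\<^sub>R cm X Y" "cm X (r *\<^sub>R Y) = r *\<^sub>R cm X Y"
  for X :: "'a::real_algebra_1^'n^'n"
  by (simp_all add: cm_def matrix_mult_scaleR scaleR_diff_right)

lemma cm_add: "cm (X + Y) Z = cm X Z + cm Y Z" "cm X (Y + Z) = cm X Y + cm X Z"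
  "cm (X - Y) Z = cm X Z - cm Y Z" "cm X (Y - Z) = cm X Y - cm X Z"
  "cm (- X) Z = - cm X Z" "cm X (- Z) = - cm X Z"
  by (simp_all add: cm_def matrix_mult_distribs)

lemma cm_zero [simp]: "cm 0 X = 0" "cm X 0 = 0" "cm X X = 0"
  by (simp_all add: cm_def)

section \<open>Powers of E and highest weight strings\<close>

primrec mpow :: "'a::semiring_1^'n^'n \<Rightarrow> nat \<Rightarrow> 'a^'n^'n" where
  "mpow A 0 = mat 1"
| "mpow A (Suc n) = A ** mpow A n"

lemma cm_mpow:
  fixes H E :: "'a::real_algebra_1^'n^'n"
  assumes "cm H E = c *\<^sub>R E"
  shows "cm H (mpow E n) = (c * real n) *\<^sub>R mpow E n"
proof (induction n)
  case 0
  then show ?case by (simp add: cm_def)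
next
  case (Suc n)
  then show ?case using assms
    by (simp add: cm_mult_right matrix_mult_scaleR algebra_simps flip: scaleR_add_left)
qed

text \<open>The operator \<open>cm H\<close> is bounded, so the multiples \<open>c * n\<close> of \<open>c\<close> cannot all be eigenvalues of it.\<close>
lemma nilpotent_of_cm:
  fixes H E :: "'a::{real_normed_field,euclidean_space}^'n^'n"
  assumes "cm H E = c *\<^sub>R E" "c \<noteq> 0"
  obtains n where "mpow E n = 0"
proof -
  have "linear (cm H)"
    by (rule linearI) (simp_all add: cm_add cm_scaleR)
  then obtain B where B: "\<And>X. norm (cm H X) \<le> norm X * B"
    using linear_conv_bounded_linear bounded_linear.bounded by blast
  obtain n where n: "B < real n * \<bar>c\<bar>"
    using assms(2) ex_less_of_nat_mult[of "\<bar>c\<bar>" B] by auto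
  have "norm (mpow E n) * (real n * \<bar>c\<bar>) \<le> norm (mpow E n) * B"
    using B[of "mpow E n"] cm_mpow[OF assms(1), of n] by (simp add: abs_mult algebra_simps)
  then have "norm (mpow E n) * (real n * \<bar>c\<bar> - B) \<le> 0" by (simp add: algebra_simps)
  then have "norm (mpow E n) \<le> 0" using n by (simp add: mult_le_0_iff)
  then show ?thesis using that by simp
qed

lemma sl2_vector:
  fixes H E F :: "'a::{real_algebra_1,field}^'n^'n"
  assumes "sl2_triple H E F"
  shows "H *v (E *v x) = E *v (H *v x) + 2 *s (E *v x)"
    "H *v (F *v x) = F *v (H *v x) - 2 *s (F *v x)"
    "E *v (F *v x) = F *v (E *v x) + H *v x"
proof -
  have "cm H E *v x = (2 *\<^sub>R E) *v x" "cm H F *v x = ((-2) *\<^sub>R F) *v x" "cm E F *v x = H *v x"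
    using assms by (simp_all add: sl2_triple_def)
  then have 1: "H *v (E *v x) - E *v (H *v x) = 2 *s (E *v x)"
    "H *v (F *v x) - F *v (H *v x) = (-2) *s (F *v x)"
    "E *v (F *v x) - F *v (E *v x) = H *v x"
    unfolding cm_def matrix_vector_mult_diff_rdistrib matrix_scaleR_vector
    by (simp_all add: matrix_vector_mul_assoc)
  show "H *v (E *v x) = E *v (H *v x) + 2 *s (E *v x)" using 1(1) by (simp add: algebra_simps)
  show "E *v (F *v x) = F *v (E *v x) + H *v x" using 1(3) by (simp add: algebra_simps)
  have "H *v (F *v x) = F *v (H *v x) + (-2) *s (F *v x)" using 1(2) by (metis diff_eq_eq add.commute)
  also have "\<dots> = F *v (H *v x) - 2 *s (F *v x)" by (simp add: vec_eq_iff)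
  finally show "H *v (F *v x) = F *v (H *v x) - 2 *s (F *v x)" .
qed

text \<open>The identity [E^(n+1), F] = (n+1) E^n (H + n) of the enveloping algebra, applied to a
  vector. The induction moves one E past F and then H past a power of E.\<close>

lemma cm_mpow_lowering:
  fixes H E F :: "'a::{real_algebra_1,field}^'n^'n"
  assumes "sl2_triple H E F"
  shows "mpow E (Suc n) *v (F *v x) = F *v (mpow E (Suc n) *v x)
     + of_nat (Suc n) *s (mpow E n *v (H *v x) + of_nat n *s (mpow E n *v x))"
proof (induction n)
  case 0
  then show ?case using sl2_vector(3)[OF assms] by simp
next
  case (Suc n)
  let ?y = "mpow E (Suc n) *v x" and ?z = "mpow E (Suc n) *v (H *v x)"
  have "cm H (mpow E (Suc n)) *v x = ((2 * real (Suc n)) *\<^sub>R mpow E (Suc n)) *v x"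
    using cm_mpow[of H E 2 "Suc n"] assms by (simp only: sl2_triple_def)
  then have h: "H *v ?y = ?z + of_nat (2 * Suc n) *s ?y"
    unfolding cm_def matrix_vector_mult_diff_rdistrib matrix_scaleR_vector
    by (simp add: matrix_vector_mul_assoc algebra_simps del: mpow.simps)
  have e: "E *v (mpow E n *v w) = mpow E (Suc n) *v w" for w
    by (simp add: matrix_vector_mul_assoc)
  have "mpow E (Suc (Suc n)) *v (F *v x) = E *v (mpow E (Suc n) *v (F *v x))"
    by (simp add: matrix_vector_mul_assoc matrix_mul_assoc)
  also have "\<dots> = E *v (F *v ?y) + of_nat (Suc n) *s (?z + of_nat n *s ?y)"
    unfolding Suc.IH matrix_vector_right_distrib matrix_vector_smult e ..
  also have "E *v (F *v ?y) = F *v (mpow E (Suc (Suc n)) *v x) + H *v ?y"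
    using sl2_vector(3)[OF assms, of ?y] by (simp add: matrix_vector_mul_assoc matrix_mul_assoc)
  finally show ?case unfolding h
    by (simp add: vec_eq_iff algebra_simps del: mpow.simps)
qed

text \<open>If E^(r+1) = 0, both sides of the identity for [E^(r+1), F] collapse to E^r (H + r) x =
  0, while H E^r = E^r (H + 2 r). The eigenvalue thus comes out explicitly, over the reals as well
  as over the complex numbers.\<close>

lemma top_vector:
  fixes H E F :: "'a::{real_algebra_1,field_char_0}^'n^'n"
  assumes "sl2_triple H E F" "mpow E (Suc r) = 0" "mpow E r *v x = v"
  shows "E *v v = 0" "H *v v = of_nat r *s v"
proof -
  show "E *v v = 0" using assms(2) by (simp add: matrix_vector_mul_assoc flip: assms(3))
  have "of_nat (Suc r) *s (mpow E r *v (H *v x) + of_nat r *s v) = 0"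
    using cm_mpow_lowering[OF assms(1), of r x] assms(2,3) by (simp del: of_nat_Suc mpow.simps)
  then have 1: "mpow E r *v (H *v x) + of_nat r *s v = 0"
    using vec.scale_eq_0_iff[of "of_nat (Suc r) :: 'a"] of_nat_neq_0 by blast
  have "cm H (mpow E r) *v x = ((2 * real r) *\<^sub>R mpow E r) *v x"
    using cm_mpow[of H E 2 r] assms(1) by (simp only: sl2_triple_def)
  then have "H *v v = mpow E r *v (H *v x) + of_nat (2 * r) *s v"
    unfolding cm_def matrix_vector_mult_diff_rdistrib matrix_scaleR_vector
    by (simp add: matrix_vector_mul_assoc algebra_simps flip: assms(3))
  with 1 show "H *v v = of_nat r *s v"
    by (simp add: vec_eq_iff algebra_simps)
qed

lemma sl2_string:
  fixes H E F :: "'a::{real_algebra_1,field_char_0}^'n^'n"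
  assumes "sl2_triple H E F" "E *v v = 0" "H *v v = of_nat r *s v"
  shows "H *v (mpow F j *v v) = (of_nat r - 2 * of_nat j) *s (mpow F j *v v)"
    "E *v (mpow F (Suc j) *v v) = (of_nat (Suc j) * (of_nat r - of_nat j)) *s (mpow F j *v v)"
proof -
  have F: "mpow F (Suc j) *v v = F *v (mpow F j *v v)" for j
    by (simp add: matrix_vector_mul_assoc)
  show 1: "H *v (mpow F j *v v) = (of_nat r - 2 * of_nat j) *s (mpow F j *v v)" for j
  proof (induction j)
    case 0
    then show ?case using assms(3) by simp
  next
    case (Suc j)
    show ?case unfolding F sl2_vector(2)[OF assms(1)] Suc matrix_vector_smult
      by (simp add: vec_eq_iff algebra_simps)
  qed
  show "E *v (mpow F (Suc j) *v v) = (of_nat (Suc j) * (of_nat r - of_nat j)) *s (mpow F j *v v)"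
  proof (induction j)
    case 0
    then show ?case unfolding F sl2_vector(3)[OF assms(1)] using assms(2,3) by simp
  next
    case (Suc j)
    show ?case
      unfolding F[of "Suc j"] sl2_vector(3)[OF assms(1), of "mpow F (Suc j) *v v"] Suc 1 matrix_vector_smult
      unfolding F[symmetric]
      by (simp add: vec_eq_iff algebra_simps del: mpow.simps)
  qed
qed

text \<open>E maps F^(j+1) v to a multiple of F^j v whose factor vanishes only for j = r. So
  non-vanishing propagates from v up to F^r v, and a non-zero F^(r+1) v would propagate forever,
  against the nilpotency of F.\<close>

lemma sl2_string_ends:
  fixes H E F :: "'a::{real_algebra_1,field_char_0}^'n^'n"
  assumes "sl2_triple H E F" "E *v v = 0" "H *v v = of_nat r *s v" "v \<noteq> 0" "mpow F n = 0"
  shows "mpow F (Suc r) *v v = 0" "j \<le> r \<Longrightarrow> mpow F j *v v \<noteq> 0"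
proof -
  note str = sl2_string(2)[OF assms(1-3)]
  show "mpow F j *v v \<noteq> 0" if "j \<le> r" using that
  proof (induction j)
    case 0
    then show ?case using assms(4) by simp
  next
    case (Suc j)
    then have "(of_nat (Suc j) * (of_nat r - of_nat j) :: 'a) \<noteq> 0"
      by (simp del: of_nat_Suc)
    with Suc str[of j] show ?case by (metis Suc_leD matrix_vector_mult_0_right vec.scale_eq_0_iff)
  qed
  show "mpow F (Suc r) *v v = 0"
  proof (rule ccontr)
    assume nz: "mpow F (Suc r) *v v \<noteq> 0"
    have "mpow F (Suc r + k) *v v \<noteq> 0" for k
    proof (induction k)
      case 0
      then show ?case using nz by simp
    next
      case (Suc k)
      have "(of_nat (Suc (Suc r + k)) * (of_nat r - of_nat (Suc r + k)) :: 'a) \<noteq> 0"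
        by (metis Suc_n_not_le_n add_Suc eq_iff_diff_eq_0 le_add1 mult_eq_0_iff nat.distinct(1) of_nat_eq_0_iff of_nat_eq_iff)
      with Suc str[of "Suc r + k"] show ?case
        by (metis add_Suc_right matrix_vector_mult_0_right vec.scale_eq_0_iff)
    qed
    moreover have "mpow F (k + n) = 0" for k
      by (induction k) (simp_all add: assms(5))
    ultimately show False by (metis matrix_vector_mult_0)
  qed
qed

lemma eigenvectors_independent:
  fixes v :: "nat \<Rightarrow> 'a::field^'n"
  assumes "\<And>j. j < n \<Longrightarrow> H *v v j = l j *s v j" "\<And>j. j < n \<Longrightarrow> v j \<noteq> 0" "inj_on l {..<n}"
    and "(\<Sum>j<n. c j *s v j) = 0" "j < n"
  shows "c j = 0"
  using assms
proof (induction n arbitrary: c j)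
  case 0
  then show ?case by simp
next
  case (Suc n)
  have s: "(\<Sum>j<n. c j *s v j) + c n *s v n = 0" using Suc.prems(4) by simp
  have "H *v (\<Sum>j<m. c j *s v j) = (\<Sum>j<m. (c j * l j) *s v j)" if "m \<le> Suc n" for m
    using that by (induction m) (simp_all add: matrix_vector_right_distrib matrix_vector_smult Suc.prems(1))
  from this[of "Suc n"] have "(\<Sum>j<Suc n. (c j * l j) *s v j) = 0"
    using Suc.prems(4) by simp
  \<comment> \<open>Subtracting \<open>l n\<close> times the relation from its image under
    \<open>H\<close> removes the last term and leaves a relation to which the induction hypothesis
    applies.\<close>
  then have "(\<Sum>j<n. (c j * l j) *s v j) + (c n * l n) *s v n - l n *s ((\<Sum>j<n. c j *s v j) + c n *s v n) = 0"
    using s by simp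
  then have "(\<Sum>j<n. (c j * (l j - l n)) *s v j) = 0"
    by (simp add: vec.scale_sum_right vec.scale_right_distrib sum_subtractf[symmetric] algebra_simps vec.scale_left_diff_distrib)
  then have "c j * (l j - l n) = 0" if "j < n" for j
    using Suc.IH[of "\<lambda>j. c j * (l j - l n)" j] Suc.prems that by (auto simp: inj_on_def)
  then have c: "c j = 0" if "j < n" for j
    using Suc.prems(3) that by (force simp: inj_on_def)
  then have "c n *s v n = 0" using s by simp
  then have "c n = 0" using Suc.prems(2) by simp
  with c show ?case using Suc.prems(5) less_Suc_eq by blast
qed

section \<open>Normal forms of \<open>sl\<^sub>2\<close>-triples in dimension four\<close>

text \<open>Change of basis. The inverse \<open>Q\<close> of \<open>P\<close> is a separate
  argument, so that each rule below states which of the two inverse relations it uses.\<close>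

definition cj :: "'a::ring_1^'n^'n \<Rightarrow> 'a^'n^'n \<Rightarrow> 'a^'n^'n \<Rightarrow> 'a^'n^'n" where
  "cj P Q X = Q ** X ** P"

lemma cj_simps:
  fixes P Q :: "'a::real_algebra_1^'n^'n"
  shows "cj P Q (X + Y) = cj P Q X + cj P Q Y" "cj P Q (X - Y) = cj P Q X - cj P Q Y"
    "cj P Q (- X) = - cj P Q X" "cj P Q (r *\<^sub>R X) = r *\<^sub>R cj P Q X" "cj P Q 0 = 0"
  by (simp_all add: cj_def matrix_mult_distribs matrix_mult_scaleR)

lemma cj_mult: "P ** Q = mat 1 \<Longrightarrow> cj P Q (X ** Y) = cj P Q X ** cj P Q Y"
  unfolding cj_def by (metis matrix_mul_assoc matrix_mul_lid)

lemma cj_cm: "P ** Q = mat 1 \<Longrightarrow> cj P Q (cm X Y) = cm (cj P Q X) (cj P Q Y)"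
  by (simp add: cm_def cj_mult flip: cj_mult) (simp add: cj_def matrix_mult_distribs)

lemma cj_inverse: "P ** Q = mat 1 \<Longrightarrow> cj Q P (cj P Q X) = X"
  unfolding cj_def by (metis matrix_mul_assoc matrix_mul_lid matrix_mul_rid)

lemma cj_one: "Q ** P = mat 1 \<Longrightarrow> cj P Q (mat 1) = mat 1"
  by (simp add: cj_def)

lemma sl2_triple_cj:
  fixes P Q :: "'a::real_algebra_1^'n^'n"
  assumes "P ** Q = mat 1" "sl2_triple H E F"
  shows "sl2_triple (cj P Q H) (cj P Q E) (cj P Q F)"
  using assms(2) unfolding sl2_triple_def
  by (simp add: cj_simps flip: cj_cm[OF assms(1)])

lemma injective_imp_invertible:
  fixes P :: "'a::field^'n^'n"
  assumes "\<And>x. P *v x = 0 \<Longrightarrow> x = 0"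
  obtains Q where "P ** Q = mat 1" "Q ** P = mat 1"
proof -
  have "inj ((*v) P)"
    by (rule injI) (metis assms eq_iff_diff_eq_0 matrix_vector_mult_diff_distrib)
  then show ?thesis
    using that by (metis matrix_left_invertible_injective matrix_left_right_inverse)
qed

definition col4 :: "'a^4 \<Rightarrow> 'a^4 \<Rightarrow> 'a^4 \<Rightarrow> 'a^4 \<Rightarrow> 'a^4^4" where
  "col4 a b c d = m4 (a$1) (b$1) (c$1) (d$1) (a$2) (b$2) (c$2) (d$2) (a$3) (b$3) (c$3) (d$3) (a$4) (b$4) (c$4) (d$4)"

lemma col4_vector: "col4 a b c d *v x = x$1 *s a + x$2 *s b + x$3 *s c + x$4 *s (d::'a::comm_ring_1^4)"
  by (simp add: vec_eq_iff forall_4 matrix_vector_mult_def sum_4 col4_def algebra_simps)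

lemma mult_col4: "A ** col4 a b c d = col4 (A *v a) (A *v b) (A *v c) (A *v d)"
  by (simp add: mat4_eq_iff matrix_matrix_mult_def matrix_vector_mult_def sum_4 col4_def)

lemma col4_m4: "col4 x y z w ** m4 a b c d e f g h i j k l m n p q =
  col4 (a *s x + e *s y + i *s z + m *s w) (b *s x + f *s y + j *s z + n *s w)
       (c *s x + g *s y + k *s z + p *s w) (d *s x + h *s y + l *s z + q *s (w::'a::comm_ring_1^4))"
  unfolding col4_def m4_mult by (simp add: mult.commute)

lemma col4_invertible:
  fixes a b c d :: "'a::field^4"
  assumes "\<And>x y z w. x *s a + y *s b + z *s c + w *s d = 0 \<Longrightarrow> x = 0 \<and> y = 0 \<and> z = 0 \<and> w = 0"
  obtains Q where "col4 a b c d ** Q = mat 1" "Q ** col4 a b c d = mat 1"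
    "\<forall>v. \<exists>x y z w. v = x *s a + y *s b + z *s c + w *s d"
proof -
  have inj: "x = 0" if "col4 a b c d *v x = 0" for x
    using assms[of "x$1" "x$2" "x$3" "x$4"] that by (simp add: col4_vector vec_eq_iff forall_4)
  obtain Q where Q: "col4 a b c d ** Q = mat 1" "Q ** col4 a b c d = mat 1"
    by (rule injective_imp_invertible[OF inj])
  have "\<exists>x y z w. v = x *s a + y *s b + z *s c + w *s d" for v
    using col4_vector[of a b c d "Q *v v"] Q(1) by (metis matrix_vector_mul_assoc matrix_vector_mul_lid)
  with Q show ?thesis using that by blast
qed

text \<open>A square matrix with columns \<open>a\<close>, \<open>b\<close>, \<open>c\<close> and 0
  kills the fourth unit vector, hence has no left inverse and cannot be surjective.\<close>

lemma ex_not_in_span3: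
  fixes a b c :: "'a::field^4"
  obtains u where "\<And>x y z. u \<noteq> x *s a + y *s b + z *s c"
proof -
  let ?P = "col4 a b c 0" and ?e = "(\<chi> i. if i = 4 then 1 else 0) :: 'a^4"
  have e: "?P *v ?e = 0" "?e \<noteq> 0"
    by (simp_all add: col4_vector vec_eq_iff forall_4 distinct_4)
  have "\<not> surj ((*v) ?P)"
  proof
    assume "surj ((*v) ?P)"
    then obtain Q where "?P ** Q = mat 1"
      using matrix_right_invertible_surjective by blast
    then have "Q ** ?P = mat 1" by (rule matrix_left_right_inverse[THEN iffD1])
    then have "?e = Q *v (?P *v ?e)" by (simp add: matrix_vector_mul_assoc)
    with e show False by simp
  qed
  then obtain u where u: "u \<notin> range ((*v) ?P)" by auto
  have "u \<noteq> x *s a + y *s b + z *s c" for x y z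
  proof
    assume "u = x *s a + y *s b + z *s c"
    also have "\<dots> = ?P *v (\<chi> i. if i = 1 then x else if i = 2 then y else if i = 3 then z else 0)"
      by (simp add: col4_vector distinct_4)
    finally show False using u by blast
  qed
  then show ?thesis using that by blast
qed

text \<open>The equation \<open>X ** P = P ** N\<close> can be checked column by column, so a normal
  form follows from the action on the chosen basis vectors.\<close>

lemma cj_eqI:
  assumes "Q ** P = mat 1" "X ** P = P ** N"
  shows "cj P Q X = N"
  unfolding cj_def using assms by (metis matrix_mul_assoc matrix_mul_lid)

text \<open>Matrices of \<open>(H, E, F)\<close> on \<open>V\<^sub>3\<close>, \<open>V\<^sub>2 \<oplus> V\<^sub>0\<close>, \<open>V\<^sub>1 \<oplus> V\<^sub>1\<close> and \<open>V\<^sub>1 \<oplus> V\<^sub>0 \<oplus> V\<^sub>0\<close>, where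
  \<open>V\<^sub>r\<close> is the irreducible module of highest weight \<open>r\<close> with basis \<open>v, F v, F\<^sup>2 v, \<dots>\<close>\<close>

definition nf3 :: "'a::ring_1^4^4 \<Rightarrow> 'a^4^4 \<Rightarrow> 'a^4^4 \<Rightarrow> bool" where
  "nf3 H E F \<longleftrightarrow> H = m4 3 0 0 0 0 1 0 0 0 0 (-1) 0 0 0 0 (-3) \<and>
     E = m4 0 3 0 0 0 0 4 0 0 0 0 3 0 0 0 0 \<and> F = m4 0 0 0 0 1 0 0 0 0 1 0 0 0 0 1 0"

definition nf2 :: "'a::ring_1^4^4 \<Rightarrow> 'a^4^4 \<Rightarrow> 'a^4^4 \<Rightarrow> bool" where
  "nf2 H E F \<longleftrightarrow> H = m4 2 0 0 0 0 0 0 0 0 0 (-2) 0 0 0 0 0 \<and>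
     E = m4 0 2 0 0 0 0 2 0 0 0 0 0 0 0 0 0 \<and> F = m4 0 0 0 0 1 0 0 0 0 1 0 0 0 0 0 0"

definition nf11 :: "'a::ring_1^4^4 \<Rightarrow> 'a^4^4 \<Rightarrow> 'a^4^4 \<Rightarrow> bool" where
  "nf11 H E F \<longleftrightarrow> H = m4 1 0 0 0 0 (-1) 0 0 0 0 1 0 0 0 0 (-1) \<and>
     E = m4 0 1 0 0 0 0 0 0 0 0 0 1 0 0 0 0 \<and> F = m4 0 0 0 0 1 0 0 0 0 0 0 0 0 0 1 0"

definition nf1 :: "'a::ring_1^4^4 \<Rightarrow> 'a^4^4 \<Rightarrow> 'a^4^4 \<Rightarrow> bool" where
  "nf1 H E F \<longleftrightarrow> H = m4 1 0 0 0 0 (-1) 0 0 0 0 0 0 0 0 0 0 \<and>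
     E = m4 0 1 0 0 0 0 0 0 0 0 0 0 0 0 0 0 \<and> F = m4 0 0 0 0 1 0 0 0 0 0 0 0 0 0 0 0"

text \<open>The sort covers both \<open>real\<close> and \<open>complex\<close>; its norm and finite
  dimension give the nilpotency of E and F.\<close>

context
  fixes H E F :: "'a::{real_normed_field,euclidean_space}^4^4"
  assumes sl2: "sl2_triple H E F"
begin

lemma nilpotent_lowering: obtains n where "mpow F n = 0"
  using nilpotent_of_cm[of H F "-2"] sl2 unfolding sl2_triple_def by auto

lemma nilpotent_raising: obtains n where "mpow E n = 0"
  using nilpotent_of_cm[of H E "2"] sl2 unfolding sl2_triple_def by auto

lemma sl2_string_independent:
  assumes "E *v v = 0" "H *v v = of_nat r *s v" "v \<noteq> 0" "n \<le> Suc r" "(\<Sum>j<n. c j *s (mpow F j *v v)) = 0" "j < n"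
  shows "c j = 0"
proof (rule eigenvectors_independent[where l = "\<lambda>j. of_nat r - 2 * of_nat j"])
  obtain k where k: "mpow F k = 0" by (rule nilpotent_lowering)
  show "H *v (mpow F j *v v) = (of_nat r - 2 * of_nat j) *s (mpow F j *v v)" for j
    by (rule sl2_string(1)[OF sl2 assms(1,2)])
  show "mpow F j *v v \<noteq> 0" if "j < n" for j
    using sl2_string_ends(2)[OF sl2 assms(1-3) k] that assms(4) by simp
  show "inj_on (\<lambda>j. of_nat r - 2 * of_nat j :: 'a) {..<n}"
    by (auto simp: inj_on_def)
  show "(\<Sum>j<n. c j *s (mpow F j *v v)) = 0" "j < n" by fact+
qed

text \<open>The vectors v, F v, F^2 v, F^3 v have distinct weights and already fill the space. For
  larger r the next vector of the string would be a fifth independent one, so r = 3.\<close>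

lemma normal_form_3:
  assumes v: "E *v v = 0" "H *v v = of_nat r *s v" "v \<noteq> 0" and r: "3 \<le> r"
  obtains P Q where "P ** Q = mat 1" "Q ** P = mat 1" "nf3 (cj P Q H) (cj P Q E) (cj P Q F)"
proof -
  define w where "w j = mpow F j *v v" for j
  have Fw: "F *v w j = w (Suc j)" for j by (simp add: w_def matrix_vector_mul_assoc)
  note str = sl2_string[OF sl2 v(1,2), folded w_def]
  note ind = sl2_string_independent[OF v, folded w_def]
  have "x = 0 \<and> y = 0 \<and> z = 0 \<and> t = 0" if "x *s w 0 + y *s w 1 + z *s w 2 + t *s w 3 = 0" for x y z t
  proof -
    let ?c = "(\<lambda>j::nat. 0)(0 := x, 1 := y, 2 := z, 3 := t)"
    have "(\<Sum>j<4. ?c j *s w j) = 0" using that by (simp add: eval_nat_numeral)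
    then have "?c j = 0" if "j < 4" for j using ind[of 4 ?c j] that r by simp
    from this[of 0] this[of 1] this[of 2] this[of 3] show ?thesis by simp
  qed
  from col4_invertible[OF this] obtain Q where Q: "col4 (w 0) (w 1) (w 2) (w 3) ** Q = mat 1"
    "Q ** col4 (w 0) (w 1) (w 2) (w 3) = mat 1"
    and sp: "\<And>u. \<exists>x y z t. u = x *s w 0 + y *s w 1 + z *s w 2 + t *s w 3" by blast
  have "r = 3"
  proof (rule ccontr)
    assume "r \<noteq> 3"
    then have r4: "5 \<le> Suc r" using r by simp
    obtain x y z t where "w 4 = x *s w 0 + y *s w 1 + z *s w 2 + t *s w 3" using sp by blast
    then show False using ind[OF r4, of "(\<lambda>j::nat. 0)(0 := x, 1 := y, 2 := z, 3 := t, 4 := -1)" 4]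
      by (simp add: eval_nat_numeral)
  qed
  obtain k where k: "mpow F k = 0" by (rule nilpotent_lowering)
  have w4: "w 4 = 0" using sl2_string_ends(1)[OF sl2 v k] \<open>r = 3\<close> by (simp add: w_def eval_nat_numeral)
  have Ew: "E *v w 0 = 0" "E *v w 1 = 3 *s w 0" "E *v w 2 = 4 *s w 1" "E *v w 3 = 3 *s w 2"
    using v(1) str(2)[of 0] str(2)[of 1] str(2)[of 2] \<open>r = 3\<close> by (simp_all add: eval_nat_numeral w_def)
  have Hw: "H *v w 0 = 3 *s w 0" "H *v w 1 = 1 *s w 1" "H *v w 2 = (-1) *s w 2" "H *v w 3 = (-3) *s w 3"
    using str(1)[of 0] str(1)[of 1] str(1)[of 2] str(1)[of 3] \<open>r = 3\<close> by simp_all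
  have F: "F *v w 0 = w 1" "F *v w 1 = w 2" "F *v w 2 = w 3" "F *v w 3 = 0"
    using Fw[of 0] Fw[of 1] Fw[of 2] Fw[of 3] w4 by (simp_all add: eval_nat_numeral)
  show ?thesis
  proof (rule that[OF Q])
    show "nf3 (cj (col4 (w 0) (w 1) (w 2) (w 3)) Q H) (cj (col4 (w 0) (w 1) (w 2) (w 3)) Q E)
      (cj (col4 (w 0) (w 1) (w 2) (w 3)) Q F)"
      unfolding nf3_def
      by (intro conjI cj_eqI[OF Q(2)]) (simp_all add: mult_col4 col4_m4 Ew Hw F del: One_nat_def)
  qed
qed

text \<open>Complete reducibility by hand: the string of length three is completed by an arbitrary
  fourth vector, the relations of the triple determine most of its images, and a shift by the string
  turns it into an invariant vector.\<close>

lemma normal_form_2: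
  assumes v: "E *v v = 0" "H *v v = 2 *s v" "v \<noteq> 0"
  obtains P Q where "P ** Q = mat 1" "Q ** P = mat 1" "nf2 (cj P Q H) (cj P Q E) (cj P Q F)"
proof -
  define w where "w j = mpow F j *v v" for j
  have Fw: "F *v w j = w (Suc j)" for j by (simp add: w_def matrix_vector_mul_assoc)
  have v2: "H *v v = of_nat 2 *s v" using v(2) by simp
  note str = sl2_string[OF sl2 v(1) v2, folded w_def]
  note ind = sl2_string_independent[OF v(1) v2 v(3), folded w_def]
  have ind3: "x = 0 \<and> y = 0 \<and> z = 0" if "x *s w 0 + y *s w 1 + z *s w 2 = 0" for x y z
  proof -
    let ?c = "(\<lambda>j::nat. 0)(0 := x, 1 := y, 2 := z)"
    have "(\<Sum>j<3. ?c j *s w j) = 0" using that by (simp add: eval_nat_numeral)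
    then have "?c j = 0" if "j < 3" for j using ind[of 3 ?c j] that by simp
    from this[of 0] this[of 1] this[of 2] show ?thesis by simp
  qed
  obtain u where u: "\<And>x y z. u \<noteq> x *s w 0 + y *s w 1 + z *s w 2"
    using ex_not_in_span3 by blast
  \<comment> \<open>Stated for every translate of \<open>u\<close> by the string, because it serves
    both for \<open>u\<close> itself and for the corrected vector \<open>u'\<close>.\<close>
  have ind4: "x = 0 \<and> y = 0 \<and> z = 0 \<and> t = 0"
    if "x *s w 0 + y *s w 1 + z *s w 2 + t *s (u + (a *s w 0 + b *s w 1 + c *s w 2)) = 0" for x y z t a b c
  proof -
    have "t = 0"
    proof (rule ccontr)
      assume "t \<noteq> 0"
      have "u $ i = (- x / t - a) * w 0 $ i + (- y / t - b) * w 1 $ i + (- z / t - c) * w 2 $ i" for i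
      proof -
        have "t * u $ i - ((- x - t * a) * w 0 $ i + (- y - t * b) * w 1 $ i + (- z - t * c) * w 2 $ i) = 0"
          using arg_cong[OF that, of "\<lambda>v. v $ i"] by (simp add: algebra_simps)
        then have "t * u $ i = (- x - t * a) * w 0 $ i + (- y - t * b) * w 1 $ i + (- z - t * c) * w 2 $ i"
          by simp
        then have "u $ i = ((- x - t * a) * w 0 $ i + (- y - t * b) * w 1 $ i + (- z - t * c) * w 2 $ i) / t"
          using \<open>t \<noteq> 0\<close> by (metis nonzero_mult_div_cancel_left)
        also have "\<dots> = (- x / t - a) * w 0 $ i + (- y / t - b) * w 1 $ i + (- z / t - c) * w 2 $ i"
        proof -
          have "(- x' - t * a') * p / t = (- x' / t - a') * p" for x' a' p
            using \<open>t \<noteq> 0\<close> by (simp add: field_simps)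
          then show ?thesis by (simp only: add_divide_distrib)
        qed
        finally show ?thesis .
      qed
      then have "u = (- x / t - a) *s w 0 + (- y / t - b) *s w 1 + (- z / t - c) *s w 2"
        by (simp only: vec_eq_iff vector_add_component vector_smult_component simp_thms)
      with u show False by blast
    qed
    with that ind3 show ?thesis by simp
  qed
 have ind4u: "x = 0 \<and> y = 0 \<and> z = 0 \<and> t = 0"
    if "x *s w 0 + y *s w 1 + z *s w 2 + t *s u = 0" for x y z t
    using ind4[of x y z t 0 0 0] that by simp
  obtain Q where Q: "col4 (w 0) (w 1) (w 2) u ** Q = mat 1" "Q ** col4 (w 0) (w 1) (w 2) u = mat 1"
    and sp: "\<forall>y. \<exists>x1 x2 x3 x4. y = x1 *s w 0 + x2 *s w 1 + x3 *s w 2 + x4 *s u"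
    by (rule col4_invertible[OF ind4u])
  obtain k where k: "mpow F k = 0" by (rule nilpotent_lowering)
  have w3: "w 3 = 0" using sl2_string_ends(1)[OF sl2 v(1) v2 v(3) k] by (simp add: w_def eval_nat_numeral)
  have Ew: "E *v w 0 = 0" "E *v w 1 = 2 *s w 0" "E *v w 2 = 2 *s w 1"
    using v(1) str(2)[of 0] str(2)[of 1] by (simp_all add: eval_nat_numeral w_def)
  have Hw: "H *v w 0 = 2 *s w 0" "H *v w 1 = 0" "H *v w 2 = (-2) *s w 2"
    using str(1)[of 0] str(1)[of 1] str(1)[of 2] by simp_all
  have F: "F *v w 0 = w 1" "F *v w 1 = w 2" "F *v w 2 = 0"
    using Fw[of 0] Fw[of 1] Fw[of 2] w3 by (simp_all add: eval_nat_numeral)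
  obtain h1 h2 h3 h4 where Hu: "H *v u = h1 *s w 0 + h2 *s w 1 + h3 *s w 2 + h4 *s u" using sp by blast
  obtain e1 e2 e3 e4 where Eu: "E *v u = e1 *s w 0 + e2 *s w 1 + e3 *s w 2 + e4 *s u" using sp by blast
  obtain f1 f2 f3 f4 where Fu: "F *v u = f1 *s w 0 + f2 *s w 1 + f3 *s w 2 + f4 *s u" using sp by blast
  have "cj (col4 (w 0) (w 1) (w 2) u) Q H = m4 2 0 0 h1 0 0 0 h2 0 0 (-2) h3 0 0 0 h4"
    "cj (col4 (w 0) (w 1) (w 2) u) Q E = m4 0 2 0 e1 0 0 2 e2 0 0 0 e3 0 0 0 e4"
    "cj (col4 (w 0) (w 1) (w 2) u) Q F = m4 0 0 0 f1 1 0 0 f2 0 1 0 f3 0 0 0 f4"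
    by (intro cj_eqI[OF Q(2)]; simp add: mult_col4 col4_m4 Ew Hw F Hu Eu Fu del: One_nat_def)+
  with sl2_triple_cj[OF Q(1) sl2] have "sl2_triple (m4 2 0 0 h1 0 0 0 h2 0 0 (-2) h3 0 0 0 h4)
     (m4 0 2 0 e1 0 0 2 e2 0 0 0 e3 0 0 0 e4) (m4 0 0 0 f1 1 0 0 f2 0 1 0 f3 0 0 0 f4)" by simp
  then have eqs: "cm (m4 2 0 0 h1 0 0 0 h2 0 0 (-2) h3 0 0 0 h4) (m4 0 2 0 e1 0 0 2 e2 0 0 0 e3 0 0 0 e4)
      = 2 *\<^sub>R m4 0 2 0 e1 0 0 2 e2 0 0 0 e3 0 0 0 e4"
    "cm (m4 2 0 0 h1 0 0 0 h2 0 0 (-2) h3 0 0 0 h4) (m4 0 0 0 f1 1 0 0 f2 0 1 0 f3 0 0 0 f4)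
      = (-2) *\<^sub>R m4 0 0 0 f1 1 0 0 f2 0 1 0 f3 0 0 0 f4"
    "cm (m4 0 2 0 e1 0 0 2 e2 0 0 0 e3 0 0 0 e4) (m4 0 0 0 f1 1 0 0 f2 0 1 0 f3 0 0 0 f4)
      = m4 2 0 0 h1 0 0 0 h2 0 0 (-2) h3 0 0 0 h4"
    by (simp_all add: sl2_triple_def)
  \<comment> \<open>These are the actions on the one-dimensional quotient by the string, where all
    commutators vanish.\<close>
  have 0: "e4 = 0" "f4 = 0" "h4 = 0"
    using eqs by (simp_all add: cm_def)
  have 1: "h2 = 0" "e3 = 0" "f1 = 0"
    using eqs(1,2) unfolding 0 by (simp_all add: cm_def)
  have 2: "e2 = - h3" "h1 = 2 * f2" "e1 = 2 * f3"
    using eqs unfolding 0 1 by (simp_all add: cm_def)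
  note * = 0 1 2
  \<comment> \<open>The coefficients of \<open>w 0\<close> and \<open>w 1\<close> cancel
    \<open>F *v u\<close>, that of \<open>w 2\<close> cancels the \<open>w 1\<close> part of
    \<open>E *v u\<close>; by the relations just found, everything else then cancels too.\<close>
  define u' where "u' = u + ((- f2) *s w 0 + (- f3) *s w 1 + (h3 / 2) *s w 2)"
  have u': "H *v u' = 0" "E *v u' = 0" "F *v u' = 0"
    unfolding u'_def matrix_vector_right_distrib matrix_vector_smult Ew Hw F Hu Eu Fu *
    by (simp_all add: vec_eq_iff)
  obtain Q' where Q': "col4 (w 0) (w 1) (w 2) u' ** Q' = mat 1" "Q' ** col4 (w 0) (w 1) (w 2) u' = mat 1"
    using col4_invertible[OF ind4[of _ _ _ _ "- f2" "- f3" "h3 / 2", folded u'_def]] by blast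
  show ?thesis
  proof (rule that[OF Q'])
    show "nf2 (cj (col4 (w 0) (w 1) (w 2) u') Q' H) (cj (col4 (w 0) (w 1) (w 2) u') Q' E)
      (cj (col4 (w 0) (w 1) (w 2) u') Q' F)"
      unfolding nf2_def
      by (intro conjI cj_eqI[OF Q'(2)]) (simp_all add: mult_col4 col4_m4 Ew Hw F u' del: One_nat_def)
  qed
qed

end

text \<open>The symmetry exchanging raising and lowering: it transfers to F what is proved about
  E.\<close>

lemma sl2_triple_swap: "sl2_triple H E F \<Longrightarrow> sl2_triple (- H) F E"
  by (simp add: sl2_triple_def cm_add) (metis cm_def minus_diff_eq)

context
  fixes H E F :: "'a::{real_normed_field,euclidean_space}^4^4"
  assumes sl2: "sl2_triple H E F" and E2: "mpow E 2 = 0"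
begin

text \<open>If the last non-zero power of F were F^s with s \<ge> 2, its image would hold a highest
  weight vector of weight s for the swapped triple, and the string under E would give E^s \<noteq>
  0.\<close>

lemma lowering_square_zero: "mpow F 2 = 0"
proof -
  define n where "n = (LEAST n. mpow F n = 0)"
  have n: "mpow F n = 0" "\<And>k. k < n \<Longrightarrow> mpow F k \<noteq> 0"
    unfolding n_def
    by (rule nilpotent_lowering[OF sl2], erule LeastI) (rule not_less_Least)
  have "n \<le> 2"
  proof (rule ccontr)
    assume "\<not> n \<le> 2"
    then obtain s where s: "n = Suc s" "2 \<le> s" by (cases n) auto
    then have "mpow F s \<noteq> 0" using n by simp
    then obtain x where x: "mpow F s *v x \<noteq> 0"
      by (metis matrix_eq matrix_vector_mult_0)
    note sl2' = sl2_triple_swap[OF sl2]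
    note t = top_vector[OF sl2' n(1)[unfolded s(1)] refl, of x]
    have "mpow E s *v (mpow F s *v x) \<noteq> 0"
      by (rule sl2_string_ends(2)[OF sl2' t x E2]) simp
    moreover have "mpow E (k + 2) = 0" for k
      by (induction k) (use E2 in \<open>simp_all add: numeral_2_eq_2\<close>)
    ultimately show False using s(2) by (metis le_add_diff_inverse2 matrix_vector_mult_0)
  qed
  moreover have "mpow F (n + k) = 0" for k
    using n(1) by (induction k) simp_all
  ultimately show ?thesis by (metis le_add_diff_inverse)
qed

text \<open>The case r = 1 for the triple and its swap: H is 1 on the image of E and -1 on the image
  of F. The cubic relations follow by inserting this into E F - F E = H.\<close>

lemma square_zero_actions:
  "E *v (E *v x) = 0" "F *v (F *v x) = 0" "H *v (E *v x) = E *v x" "H *v (F *v x) = - (F *v x)"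
  "E *v (F *v (E *v x)) = E *v x" "F *v (E *v (F *v x)) = F *v x"
proof -
  have E2': "mpow E (Suc 1) = 0" and F2: "mpow F (Suc 1) = 0"
    using E2 lowering_square_zero by (simp_all add: numeral_2_eq_2)
  show 1: "E *v (E *v x) = 0" "H *v (E *v x) = E *v x"
    using top_vector[OF sl2 E2', of x] by simp_all
  have "(- H) *v (F *v x) = F *v x" and 2: "F *v (F *v x) = 0"
    using top_vector[OF sl2_triple_swap[OF sl2] F2, of x] by simp_all
  moreover have "(- H) *v (F *v x) = - (H *v (F *v x))"
    by (simp add: vec_eq_iff matrix_vector_mult_def sum_negf)
  ultimately show 3: "H *v (F *v x) = - (F *v x)" "F *v (F *v x) = 0"
    by (metis minus_minus)+
  show "E *v (F *v (E *v x)) = E *v x"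
    using sl2_vector(3)[OF sl2, of "E *v x"] 1 by simp
  show "F *v (E *v (F *v x)) = F *v x"
    using sl2_vector(3)[OF sl2, of "F *v x"] 2 3 by (simp add: algebra_simps)
qed

text \<open>The cases distinguish whether the rank of E exceeds one. Two independent vectors in the
  image of E and their images under F form a basis. If the rank is one, E F + F E projects onto a
  plane, and the complementary projection supplies two invariant vectors.\<close>

lemma normal_form_1_or_11:
  assumes "E \<noteq> 0"
  obtains P Q where "P ** Q = mat 1" "Q ** P = mat 1"
    "nf11 (cj P Q H) (cj P Q E) (cj P Q F) \<or> nf1 (cj P Q H) (cj P Q E) (cj P Q F)"
proof -
  note act = square_zero_actions
  obtain x0 where x0: "E *v x0 \<noteq> 0"
    using assms by (metis matrix_eq matrix_vector_mult_0)
  define a where "a = E *v x0"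
  define b where "b = F *v a"
  have ab: "E *v a = 0" "E *v b = a" "F *v a = b" "F *v b = 0" "H *v a = a" "H *v b = - b" "a \<noteq> 0"
    using act x0 by (simp_all add: a_def b_def)
  show ?thesis
  proof (cases "\<exists>y. \<forall>s t. s *s a + t *s (E *v y) = 0 \<longrightarrow> s = 0 \<and> t = 0")
    case True
    then obtain y where y: "\<And>s t. s *s a + t *s (E *v y) = 0 \<Longrightarrow> s = 0 \<and> t = 0" by blast
    define a' where "a' = E *v y"
    define b' where "b' = F *v a'"
    have ab': "E *v a' = 0" "E *v b' = a'" "F *v a' = b'" "F *v b' = 0" "H *v a' = a'" "H *v b' = - b'"
      using act by (simp_all add: a'_def b'_def)
    have ind: "x1 = 0 \<and> x2 = 0 \<and> x3 = 0 \<and> x4 = 0" if s: "x1 *s a + x2 *s b + x3 *s a' + x4 *s b' = 0" for x1 x2 x3 x4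
    proof -
      have "E *v (x1 *s a + x2 *s b + x3 *s a' + x4 *s b') = 0" using s by simp
      then have "x2 *s a + x4 *s a' = 0"
        by (simp add: matrix_vector_right_distrib matrix_vector_smult ab ab')
      then have "x2 = 0 \<and> x4 = 0" using y unfolding a'_def by blast
      moreover from this have "x1 *s a + x3 *s a' = 0" using s by simp
      then have "x1 = 0 \<and> x3 = 0" using y unfolding a'_def by blast
      ultimately show ?thesis by simp
    qed
    obtain Q where Q: "col4 a b a' b' ** Q = mat 1" "Q ** col4 a b a' b' = mat 1"
      using col4_invertible[OF ind] by blast
    have "nf11 (cj (col4 a b a' b') Q H) (cj (col4 a b a' b') Q E) (cj (col4 a b a' b') Q F)"
      unfolding nf11_def by (intro conjI cj_eqI[OF Q(2)]) (simp_all add: mult_col4 col4_m4 ab ab')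
    with that Q show ?thesis by blast
  next
    case False
    have Ea: "\<exists>s. E *v y = s *s a" for y
    proof -
      obtain s t where st: "s *s a + t *s (E *v y) = 0" "\<not> (s = 0 \<and> t = 0)" using False by blast
      have t: "t \<noteq> 0" using st ab(7) by auto
      have "E *v y = (- s / t) *s a"
      proof -
        have "s * a $ i + t * (E *v y) $ i = 0" for i using arg_cong[OF st(1), of "\<lambda>v. v $ i"] by simp
        then have "t * (E *v y) $ i = - s * a $ i" for i by (simp add: eq_neg_iff_add_eq_0 add.commute)
        then show ?thesis using t by (simp add: vec_eq_iff field_simps)
      qed
      then show ?thesis by blast
    qed
    have Fb: "\<exists>s. F *v y = s *s b" for y
    proof -
      obtain s where "E *v (F *v y) = s *s a" using Ea by blast
      then have "F *v (E *v (F *v y)) = s *s b" by (simp add: matrix_vector_smult ab)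
      with act(6) show ?thesis by metis
    qed
    \<comment> \<open>By the cubic relations E F + F E is idempotent; \<open>q\<close> is the
      complementary projection, and its image is killed by E and F.\<close>
    define q where "q u = u - (E *v (F *v u) + F *v (E *v u))" for u
    have q: "E *v q u = 0" "F *v q u = 0" "H *v q u = 0" for u
    proof -
      show 1: "E *v q u = 0" "F *v q u = 0"
        by (simp_all add: q_def matrix_vector_right_distrib matrix_vector_mult_diff_distrib act)
      show "H *v q u = 0" using sl2_vector(3)[OF sl2, of "q u"] 1 by simp
    qed
    have qd: "\<exists>s t. u = q u + (s *s a + t *s b)" for u
    proof -
      obtain s t where "E *v (F *v u) = s *s a" "F *v (E *v u) = t *s b" using Ea Fb by blast
      then have "u = q u + (s *s a + t *s b)" by (simp add: q_def)
      then show ?thesis by blast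
    qed
    obtain u1 where u1: "\<And>x y z. u1 \<noteq> x *s a + y *s b + z *s 0" using ex_not_in_span3 by blast
    define c where "c = q u1"
    have c: "c \<noteq> x *s a + y *s b" for x y
    proof
      assume cc: "c = x *s a + y *s b"
      obtain s t where "u1 = c + (s *s a + t *s b)" using qd c_def by blast
      then have "u1 = (x + s) *s a + (y + t) *s b + 0 *s 0" unfolding cc by (simp add: vec_eq_iff algebra_simps)
      with u1 show False by blast
    qed
    obtain u2 where u2: "\<And>x y z. u2 \<noteq> x *s a + y *s b + z *s c" using ex_not_in_span3 by blast
    define d where "d = q u2"
    have d: "d \<noteq> x *s a + y *s b + z *s c" for x y z
    proof
      assume cc: "d = x *s a + y *s b + z *s c"
      obtain s t where "u2 = d + (s *s a + t *s b)" using qd d_def by blast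
      then have "u2 = (x + s) *s a + (y + t) *s b + z *s c" unfolding cc by (simp add: vec_eq_iff algebra_simps)
      with u2 show False by blast
    qed
    have cd: "E *v c = 0" "F *v c = 0" "H *v c = 0" "E *v d = 0" "F *v d = 0" "H *v d = 0"
      by (simp_all add: c_def d_def q)
    have ind: "x1 = 0 \<and> x2 = 0 \<and> x3 = 0 \<and> x4 = 0" if s: "x1 *s a + x2 *s b + x3 *s c + x4 *s d = 0" for x1 x2 x3 x4
    proof -
      have i: "x1 * a $ i + x2 * b $ i + x3 * c $ i + x4 * d $ i = 0" for i
        using arg_cong[OF s, of "\<lambda>v. v $ i"] by simp
      have "x4 = 0"
      proof (rule ccontr)
        assume x: "x4 \<noteq> 0"
        have "x4 * d $ i = (- x1) * a $ i + (- x2) * b $ i + (- x3) * c $ i" for i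
          using i[of i] by (metis (no_types, opaque_lifting) add.commute add_eq_0_iff minus_add_distrib mult_minus_left)
        then have "d = (- x1 / x4) *s a + (- x2 / x4) *s b + (- x3 / x4) *s c"
          using x by (simp add: vec_eq_iff field_simps)
        with d show False by blast
      qed
      have "x3 = 0"
      proof (rule ccontr)
        assume x: "x3 \<noteq> 0"
        have "x3 * c $ i = (- x1) * a $ i + (- x2) * b $ i" for i
          using i[of i] \<open>x4 = 0\<close>
          by (simp add: add_eq_0_iff2) (metis add_uminus_conv_diff minus_add_distrib minus_minus)
        then have "c = (- x1 / x3) *s a + (- x2 / x3) *s b"
          using x by (simp add: vec_eq_iff field_simps)
        with c show False by blast
      qed
      have "E *v (x1 *s a + x2 *s b + x3 *s c + x4 *s d) = 0" using s by simp
      then have "x2 *s a = 0"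
        by (simp add: matrix_vector_right_distrib matrix_vector_smult ab cd)
      then have "x2 = 0" using ab(7) by simp
      then have "x1 *s a = 0" using s \<open>x3 = 0\<close> \<open>x4 = 0\<close> by simp
      then show ?thesis using ab(7) \<open>x2 = 0\<close> \<open>x3 = 0\<close> \<open>x4 = 0\<close> by simp
    qed
    obtain Q where Q: "col4 a b c d ** Q = mat 1" "Q ** col4 a b c d = mat 1"
      using col4_invertible[OF ind] by blast
    have "nf1 (cj (col4 a b c d) Q H) (cj (col4 a b c d) Q E) (cj (col4 a b c d) Q F)"
      unfolding nf1_def by (intro conjI cj_eqI[OF Q(2)]) (simp_all add: mult_col4 col4_m4 ab cd)
    with that Q show ?thesis by blast
  qed
qed

end

theorem sl2_normal_form:
  fixes H E F :: "'a::{real_normed_field,euclidean_space}^4^4"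
  assumes sl2: "sl2_triple H E F" and E: "E \<noteq> 0"
  obtains P Q where "P ** Q = mat 1" "Q ** P = mat 1"
    "nf3 (cj P Q H) (cj P Q E) (cj P Q F) \<or> nf2 (cj P Q H) (cj P Q E) (cj P Q F) \<or>
     nf11 (cj P Q H) (cj P Q E) (cj P Q F) \<or> nf1 (cj P Q H) (cj P Q E) (cj P Q F)"
proof -
  define n where "n = (LEAST n. mpow E n = 0)"
  have n: "mpow E n = 0" "\<And>k. k < n \<Longrightarrow> mpow E k \<noteq> 0"
    unfolding n_def
    by (rule nilpotent_raising[OF sl2], erule LeastI) (rule not_less_Least)
  have "n \<noteq> 0" using n(1) by (metis m4_eq_iff m4_one m4_zero mpow.simps(1) zero_neq_one)
  moreover have "n \<noteq> 1" using n(1) E by auto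
  ultimately obtain r where r: "n = Suc r" "1 \<le> r" by (cases n) auto
  show ?thesis
  proof (cases "r = 1")
    case True
    then have "mpow E 2 = 0" using n(1) r by (simp add: numeral_2_eq_2)
    then show ?thesis using normal_form_1_or_11[OF sl2 _ E] that by metis
  next
    case False
    have "mpow E r \<noteq> 0" using n(2) r by simp
    then obtain x where x: "mpow E r *v x \<noteq> 0"
      by (metis matrix_eq matrix_vector_mult_0)
    note t = top_vector[OF sl2 n(1)[unfolded r(1)] refl, of x]
    show ?thesis
    proof (cases "r = 2")
      case True
      then have "H *v (mpow E r *v x) = 2 *s (mpow E r *v x)" using t(2) by simp
      then show ?thesis using normal_form_2[OF sl2 t(1) _ x] that by metis
    next
      case False
      with \<open>r \<noteq> 1\<close> r have "3 \<le> r" by simp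
      then show ?thesis using normal_form_3[OF sl2 t x] that by metis
    qed
  qed
qed

section \<open>Weight vectors and commutants\<close>

text \<open>Bracketing with a diagonal matrix multiplies each entry by the difference of two
  diagonal entries, so an entry survives only where this difference equals the weight.\<close>

lemma weight_entries:
  fixes X :: "'a::real_field^4^4"
  assumes "cm (m4 a 0 0 0 0 b 0 0 0 0 c 0 0 0 0 d) X = r *\<^sub>R X"
  shows "X$1$1 = 0 \<or> of_real r = (0::'a)" "X$1$2 = 0 \<or> a - b = of_real r" "X$1$3 = 0 \<or> a - c = of_real r" "X$1$4 = 0 \<or> a - d = of_real r"
    "X$2$1 = 0 \<or> b - a = of_real r" "X$2$2 = 0 \<or> of_real r = (0::'a)" "X$2$3 = 0 \<or> b - c = of_real r" "X$2$4 = 0 \<or> b - d = of_real r"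
    "X$3$1 = 0 \<or> c - a = of_real r" "X$3$2 = 0 \<or> c - b = of_real r" "X$3$3 = 0 \<or> of_real r = (0::'a)" "X$3$4 = 0 \<or> c - d = of_real r"
    "X$4$1 = 0 \<or> d - a = of_real r" "X$4$2 = 0 \<or> d - b = of_real r" "X$4$3 = 0 \<or> d - c = of_real r" "X$4$4 = 0 \<or> of_real r = (0::'a)"
proof -
  have w: "u * x - x * v = of_real r * x \<longleftrightarrow> x = 0 \<or> u - v = of_real r" for u v x :: 'a
    by (metis (no_types, lifting) left_diff_distrib mult.commute mult_cancel_right)
  obtain x11 x12 x13 x14 x21 x22 x23 x24 x31 x32 x33 x34 x41 x42 x43 x44 where
    X: "X = m4 x11 x12 x13 x14 x21 x22 x23 x24 x31 x32 x33 x34 x41 x42 x43 x44" using m4_cases by blast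
  have "a * x11 - x11 * a = of_real r * x11 \<and> a * x12 - x12 * b = of_real r * x12 \<and>
    a * x13 - x13 * c = of_real r * x13 \<and> a * x14 - x14 * d = of_real r * x14 \<and>
    b * x21 - x21 * a = of_real r * x21 \<and> b * x22 - x22 * b = of_real r * x22 \<and>
    b * x23 - x23 * c = of_real r * x23 \<and> b * x24 - x24 * d = of_real r * x24 \<and>
    c * x31 - x31 * a = of_real r * x31 \<and> c * x32 - x32 * b = of_real r * x32 \<and>
    c * x33 - x33 * c = of_real r * x33 \<and> c * x34 - x34 * d = of_real r * x34 \<and>
    d * x41 - x41 * a = of_real r * x41 \<and> d * x42 - x42 * b = of_real r * x42 \<and>
    d * x43 - x43 * c = of_real r * x43 \<and> d * x44 - x44 * d = of_real r * x44"
    using assms unfolding X cm_def by (simp only: m4_mult m4_arith m4_scaleR m4_eq_iff mult_zero_left mult_zero_right add_0_left add_0_right)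
  then show "X$1$1 = 0 \<or> of_real r = (0::'a)" "X$1$2 = 0 \<or> a - b = of_real r" "X$1$3 = 0 \<or> a - c = of_real r" "X$1$4 = 0 \<or> a - d = of_real r"
    "X$2$1 = 0 \<or> b - a = of_real r" "X$2$2 = 0 \<or> of_real r = (0::'a)" "X$2$3 = 0 \<or> b - c = of_real r" "X$2$4 = 0 \<or> b - d = of_real r"
    "X$3$1 = 0 \<or> c - a = of_real r" "X$3$2 = 0 \<or> c - b = of_real r" "X$3$3 = 0 \<or> of_real r = (0::'a)" "X$3$4 = 0 \<or> c - d = of_real r"
    "X$4$1 = 0 \<or> d - a = of_real r" "X$4$2 = 0 \<or> d - b = of_real r" "X$4$3 = 0 \<or> d - c = of_real r" "X$4$4 = 0 \<or> of_real r = (0::'a)"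
    unfolding X w m4_nth by auto
qed

text \<open>In each of these three modules all eigenvalues of H have the same parity, so their
  differences are even.\<close>

lemma nf_odd_weight:
  fixes H E F :: "'a::real_field^4^4"
  assumes "nf3 H E F \<or> nf2 H E F \<or> nf11 H E F" "cm H X = r *\<^sub>R X" "r = 1 \<or> r = 3"
  shows "X = 0"
proof -
  from assms(1) consider "H = m4 3 0 0 0 0 1 0 0 0 0 (-1) 0 0 0 0 (-3)" | "H = m4 2 0 0 0 0 0 0 0 0 0 (-2) 0 0 0 0 0"
    | "H = m4 1 0 0 0 0 (-1) 0 0 0 0 1 0 0 0 0 (-1)"
    unfolding nf3_def nf2_def nf11_def by blast
  moreover have r: "of_real r \<noteq> (0::'a)" "2 \<noteq> (of_real r::'a)" "-2 \<noteq> (of_real r::'a)" "4 \<noteq> (of_real r::'a)"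
    "-4 \<noteq> (of_real r::'a)" "6 \<noteq> (of_real r::'a)" "-6 \<noteq> (of_real r::'a)"
    using assms(3) by auto
  ultimately show ?thesis
  proof cases
    case 1
    from weight_entries[OF assms(2)[unfolded 1]] r show ?thesis by (simp add: mat4_eq_iff)
  next
    case 2
    from weight_entries[OF assms(2)[unfolded 2]] r show ?thesis by (simp add: mat4_eq_iff)
  next
    case 3
    from weight_entries[OF assms(2)[unfolded 3]] r show ?thesis by (simp add: mat4_eq_iff)
  qed
qed

text \<open>The row \<open>u\<close> is the part in Hom(V_0 + V_0, V_1), the column \<open>w\<close>
  the part in Hom(V_1, V_0 + V_0).\<close>

lemma nf1_weight1:
  fixes H E F :: "'a::real_field^4^4"
  assumes "nf1 H E F" "cm H X = X"
  obtains u1 u2 w1 w2 where "X = m4 0 0 u1 u2 0 0 0 0 0 w1 0 0 0 w2 0 0"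
proof -
  have "cm (m4 1 0 0 0 0 (-1) 0 0 0 0 0 0 0 0 0 0) X = 1 *\<^sub>R X"
    using assms by (simp add: nf1_def)
  from weight_entries[OF this] have "X = m4 0 0 (X$1$3) (X$1$4) 0 0 0 0 0 (X$3$2) 0 0 0 (X$4$2) 0 0"
    by (simp add: mat4_eq_iff)
  with that show ?thesis by blast
qed

lemma nf1_weight2:
  fixes H E F :: "'a::real_field^4^4"
  assumes "nf1 H E F" "cm H X = 2 *\<^sub>R X"
  obtains x where "X = m4 0 x 0 0 0 0 0 0 0 0 0 0 0 0 0 0"
proof -
  have "cm (m4 1 0 0 0 0 (-1) 0 0 0 0 0 0 0 0 0 0) X = 2 *\<^sub>R X"
    using assms by (simp add: nf1_def)
  from weight_entries[OF this] have "X = m4 0 (X$1$2) 0 0 0 0 0 0 0 0 0 0 0 0 0 0"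
    by (simp add: mat4_eq_iff)
  with that show ?thesis by blast
qed

lemma nf1_weight3:
  fixes H E F :: "'a::real_field^4^4"
  assumes "nf1 H E F" "cm H X = 3 *\<^sub>R X"
  shows "X = 0"
proof -
  have "cm (m4 1 0 0 0 0 (-1) 0 0 0 0 0 0 0 0 0 0) X = 3 *\<^sub>R X"
    using assms by (simp add: nf1_def)
  from weight_entries[OF this] show ?thesis by (simp add: mat4_eq_iff)
qed

lemma nf1_commutant:
  fixes H E F :: "'a::real_field^4^4"
  assumes "nf1 H E F" "cm H X = 0" "cm E X = 0"
  obtains r a b c d where "X = m4 r 0 0 0 0 r 0 0 0 0 a b 0 0 c d"
proof -
  have "cm (m4 1 0 0 0 0 (-1) 0 0 0 0 0 0 0 0 0 0) X = 0 *\<^sub>R X"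
    using assms by (simp add: nf1_def)
  from weight_entries[OF this]
  have X: "X = m4 (X$1$1) 0 0 0 0 (X$2$2) 0 0 0 0 (X$3$3) (X$3$4) 0 0 (X$4$3) (X$4$4)"
    by (simp add: mat4_eq_iff)
  have "X$1$1 = X$2$2"
    using assms(1,3) by (subst (asm) X) (simp add: nf1_def cm_def m4_zero)
  with X that show ?thesis by metis
qed

text \<open>On V_1 + V_1, the tensor product of a plane with V_1, the vectors of weight 2 are M
  tensor E and the commutant consists of M tensor 1, with M an arbitrary 2x2 matrix. Brackets
  between the two are therefore commutators of 2x2 matrices.\<close>

lemma nf11_weight2:
  fixes H E F :: "'a::real_field^4^4"
  assumes "nf11 H E F" "cm H X = 2 *\<^sub>R X"
  obtains a b c d where "X = m4 0 a 0 b 0 0 0 0 0 c 0 d 0 0 0 0"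
proof -
  have "cm (m4 1 0 0 0 0 (-1) 0 0 0 0 1 0 0 0 0 (-1)) X = 2 *\<^sub>R X"
    using assms by (simp add: nf11_def)
  from weight_entries[OF this]
  have X: "X = m4 0 (X$1$2) 0 (X$1$4) 0 0 0 0 0 (X$3$2) 0 (X$3$4) 0 0 0 0"
    by (simp add: mat4_eq_iff)
  with that show ?thesis by blast
qed

lemma nf11_commutant:
  fixes H E F :: "'a::real_field^4^4"
  assumes "nf11 H E F" "cm H X = 0" "cm E X = 0"
  obtains a b c d where "X = m4 a 0 b 0 0 a 0 b c 0 d 0 0 c 0 d"
proof -
  have "cm (m4 1 0 0 0 0 (-1) 0 0 0 0 1 0 0 0 0 (-1)) X = 0 *\<^sub>R X"
    using assms by (simp add: nf11_def)
  from weight_entries[OF this]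
  have X: "X = m4 (X$1$1) 0 (X$1$3) 0 0 (X$2$2) 0 (X$2$4) (X$3$1) 0 (X$3$3) 0 0 (X$4$2) 0 (X$4$4)"
    by (simp add: mat4_eq_iff)
  have "X$1$1 = X$2$2 \<and> X$1$3 = X$2$4 \<and> X$3$1 = X$4$2 \<and> X$3$3 = X$4$4"
    using assms(1,3) by (subst (asm) X) (simp add: nf11_def cm_def m4_zero)
  with X that show ?thesis by metis
qed

lemma nf2_commutant:
  fixes H E F :: "'a::real_field^4^4"
  assumes "nf2 H E F" "cm H X = 0" "cm E X = 0" "cm F X = 0"
  obtains a b where "X = m4 a 0 0 0 0 a 0 0 0 0 a 0 0 0 0 b"
proof -
  have "cm (m4 2 0 0 0 0 0 0 0 0 0 (-2) 0 0 0 0 0) X = 0 *\<^sub>R X"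
    using assms by (simp add: nf2_def)
  from weight_entries[OF this]
  have X: "X = m4 (X$1$1) 0 0 0 0 (X$2$2) 0 (X$2$4) 0 0 (X$3$3) 0 0 (X$4$2) 0 (X$4$4)"
    by (simp add: mat4_eq_iff)
  have "X$1$1 = X$2$2 \<and> X$2$2 = X$3$3 \<and> X$2$4 = 0 \<and> X$4$2 = 0"
    using assms(1,3,4) by (subst (asm) X, subst (asm) (2) X) (simp add: nf2_def cm_def m4_zero)
  with X that show ?thesis by metis
qed

lemma nf3_commutant:
  fixes H E F :: "'a::real_field^4^4"
  assumes "nf3 H E F" "cm H X = 0" "cm E X = 0"
  obtains a where "X = m4 a 0 0 0 0 a 0 0 0 0 a 0 0 0 0 a"
proof -
  have "cm (m4 3 0 0 0 0 1 0 0 0 0 (-1) 0 0 0 0 (-3)) X = 0 *\<^sub>R X"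
    using assms by (simp add: nf3_def)
  from weight_entries[OF this]
  have X: "X = m4 (X$1$1) 0 0 0 0 (X$2$2) 0 0 0 0 (X$3$3) 0 0 0 0 (X$4$4)"
    by (simp add: mat4_eq_iff)
  have "X$1$1 = X$2$2 \<and> X$2$2 = X$3$3 \<and> X$3$3 = X$4$4"
    using assms(1,3) by (subst (asm) X) (simp add: nf3_def cm_def m4_zero)
  with X that show ?thesis by metis
qed

section \<open>Modules forced by odd weights\<close>

lemma sl2_raising_nonzero:
  fixes H E F :: "'a::real_algebra_1^'n^'n"
  assumes "sl2_triple H E F" "cm H X = r *\<^sub>R X" "X \<noteq> 0" "r \<noteq> 0"
  shows "E \<noteq> 0"
proof
  assume "E = 0"
  then have "H = 0" using assms(1) unfolding sl2_triple_def by (metis cm_zero(1))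
  then show False using assms(2-4) by simp
qed

lemma cj_eq_zero: "P ** Q = mat 1 \<Longrightarrow> cj P Q X = 0 \<longleftrightarrow> X = 0"
  for P :: "'a::real_algebra_1^'n^'n"
  by (metis cj_inverse cj_simps(5))

theorem weight1_normal_form:
  fixes H E F :: "'a::{real_normed_field,euclidean_space}^4^4"
  assumes sl2: "sl2_triple H E F" and X: "cm H X = X" "X \<noteq> 0"
  obtains P Q where "P ** Q = mat 1" "Q ** P = mat 1" "nf1 (cj P Q H) (cj P Q E) (cj P Q F)"
proof -
  have "cm H X = 1 *\<^sub>R X" using X by simp
  then have "E \<noteq> 0" using sl2_raising_nonzero[OF sl2 _ X(2)] by (metis zero_neq_one)
  from sl2_normal_form[OF sl2 this] obtain P Q where PQ: "P ** Q = mat 1" "Q ** P = mat 1" and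
    nf: "nf3 (cj P Q H) (cj P Q E) (cj P Q F) \<or> nf2 (cj P Q H) (cj P Q E) (cj P Q F) \<or>
     nf11 (cj P Q H) (cj P Q E) (cj P Q F) \<or> nf1 (cj P Q H) (cj P Q E) (cj P Q F)" by blast
  have "cm (cj P Q H) (cj P Q X) = 1 *\<^sub>R cj P Q X" using X(1) by (simp flip: cj_cm[OF PQ(1)])
  then have "nf1 (cj P Q H) (cj P Q E) (cj P Q F)"
    using nf nf_odd_weight X(2) cj_eq_zero[OF PQ(1)] by metis
  with that PQ show ?thesis by blast
qed

text \<open>An odd weight leaves only V_1 + V_0 + V_0, whose weights 1, -1, 0, 0 differ by at most
  2.\<close>

lemma no_weight3:
  fixes H E F :: "'a::{real_normed_field,euclidean_space}^4^4"
  assumes sl2: "sl2_triple H E F" and X: "cm H X = 3 *\<^sub>R X"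
  shows "X = 0"
proof (rule ccontr)
  assume "X \<noteq> 0"
  then have "E \<noteq> 0" using sl2_raising_nonzero[OF sl2 X] by simp
  from sl2_normal_form[OF sl2 this] obtain P Q where PQ: "P ** Q = mat 1" "Q ** P = mat 1" and
    nf: "nf3 (cj P Q H) (cj P Q E) (cj P Q F) \<or> nf2 (cj P Q H) (cj P Q E) (cj P Q F) \<or>
     nf11 (cj P Q H) (cj P Q E) (cj P Q F) \<or> nf1 (cj P Q H) (cj P Q E) (cj P Q F)" by blast
  have "cm (cj P Q H) (cj P Q X) = 3 *\<^sub>R cj P Q X" using X(1) by (simp add: cj_simps flip: cj_cm[OF PQ(1)])
  then have "cj P Q X = 0" using nf nf_odd_weight nf1_weight3 by blast
  with \<open>X \<noteq> 0\<close> show False by (simp add: cj_eq_zero[OF PQ(1)])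
qed

section \<open>Obstructions from brackets in the radical\<close>

lemma orthogonal_pair:
  fixes u1 u2 x y :: "'a::field"
  assumes "u1 * x + u2 * y = 0" "u1 \<noteq> 0 \<or> u2 \<noteq> 0"
  obtains k where "x = - k * u2" "y = k * u1"
proof (cases "u1 = 0")
  case True
  then show ?thesis using assms that[of "- x / u2"] by auto
next
  case False
  then have "x = - (y / u1) * u2" using assms(1)
    by (simp add: field_simps eq_neg_iff_add_eq_0)
  with False show ?thesis using that[of "y / u1"] by simp
qed

lemma parallel_triple:
  fixes x y z x' y' z' :: "'a::field"
  assumes "y * z' = y' * z" "x * y' = x' * y" "x * z' = x' * z" "x \<noteq> 0 \<or> y \<noteq> 0 \<or> z \<noteq> 0"
  obtains k where "x' = k * x" "y' = k * y" "z' = k * z"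
proof -
  consider "x \<noteq> 0" | "y \<noteq> 0" | "z \<noteq> 0" using assms(4) by blast
  then show ?thesis
  proof cases
    case 1
    then show ?thesis using assms(1-3) that[of "x' / x"] by (simp add: field_simps)
  next
    case 2
    then show ?thesis using assms(1-3) that[of "y' / y"] by (simp add: field_simps)
  next
    case 3
    then show ?thesis using assms(1-3) that[of "z' / z"] by (simp add: field_simps)
  qed
qed

text \<open>Here X and Y play the extreme weight vectors of a commuting V_4. Only V_3 and V_2 + V_0
  have weights differing by 4. There X and Y are multiples of E^2 and F^2, and the product of the
  two factors appears on the diagonal of their commutator.\<close>

lemma abelian_weight4_impossible:
  fixes H E F :: "'a::{real_normed_field,euclidean_space}^4^4"
  assumes sl2: "sl2_triple H E F"
    and X: "cm H X = 4 *\<^sub>R X" "cm E X = 0" "X \<noteq> 0"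
    and Y: "cm H Y = (-4) *\<^sub>R Y" "cm F Y = 0" "Y \<noteq> 0" and XY: "cm X Y = 0"
  shows False
proof -
  have "E \<noteq> 0" using sl2_raising_nonzero[OF sl2 X(1,3)] by simp
  from sl2_normal_form[OF sl2 this] obtain P Q where PQ: "P ** Q = mat 1" "Q ** P = mat 1" and
    nf: "nf3 (cj P Q H) (cj P Q E) (cj P Q F) \<or> nf2 (cj P Q H) (cj P Q E) (cj P Q F) \<or>
     nf11 (cj P Q H) (cj P Q E) (cj P Q F) \<or> nf1 (cj P Q H) (cj P Q E) (cj P Q F)" by blast
  define H' E' F' X' Y' where "H' = cj P Q H" and "E' = cj P Q E" and "F' = cj P Q F"
    and "X' = cj P Q X" and "Y' = cj P Q Y"
  note defs = this
  have X': "cm H' X' = 4 *\<^sub>R X'" "cm E' X' = 0" "X' \<noteq> 0"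
    and Y': "cm H' Y' = (-4) *\<^sub>R Y'" "cm F' Y' = 0" "Y' \<noteq> 0" and XY': "cm X' Y' = 0"
    using X Y XY unfolding defs by (simp_all add: cj_simps cj_eq_zero[OF PQ(1)] flip: cj_cm[OF PQ(1)])
  from nf[folded defs] show False
  proof (elim disjE)
    assume nf: "nf3 H' E' F'"
    have "cm (m4 3 0 0 0 0 1 0 0 0 0 (-1) 0 0 0 0 (-3)) X' = 4 *\<^sub>R X'"
      "cm (m4 3 0 0 0 0 1 0 0 0 0 (-1) 0 0 0 0 (-3)) Y' = (-4) *\<^sub>R Y'"
      using nf X' Y' unfolding nf3_def by simp_all
    \<comment> \<open>\<open>this\<close> contains one equation for \<open>X'\<close> and one for
      \<open>Y'\<close>; each \<open>THEN\<close> extracts an entry condition for both at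
      once.\<close>
    from this[THEN weight_entries(1)] this[THEN weight_entries(2)] this[THEN weight_entries(3)]
      this[THEN weight_entries(4)] this[THEN weight_entries(5)] this[THEN weight_entries(6)]
      this[THEN weight_entries(7)] this[THEN weight_entries(8)] this[THEN weight_entries(9)]
      this[THEN weight_entries(10)] this[THEN weight_entries(11)] this[THEN weight_entries(12)]
      this[THEN weight_entries(13)] this[THEN weight_entries(14)] this[THEN weight_entries(15)]
      this[THEN weight_entries(16)]
    have "X' = m4 0 0 (X'$1$3) 0 0 0 0 (X'$2$4) 0 0 0 0 0 0 0 0" "Y' = m4 0 0 0 0 0 0 0 0 (Y'$3$1) 0 0 0 0 (Y'$4$2) 0 0"
      by (simp_all add: mat4_eq_iff)
    then obtain a b c d where e: "X' = m4 0 0 a 0 0 0 0 b 0 0 0 0 0 0 0 0" "Y' = m4 0 0 0 0 0 0 0 0 c 0 0 0 0 d 0 0" by blast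
    have "a = b" "c = d" "a * c = 0" "b * d = 0"
      using nf X'(2) Y'(2) XY' unfolding e nf3_def by (auto simp: cm_def m4_zero)
    with e X' Y' show False by (auto simp: m4_zero)
  next
    assume nf: "nf2 H' E' F'"
    have "cm (m4 2 0 0 0 0 0 0 0 0 0 (-2) 0 0 0 0 0) X' = 4 *\<^sub>R X'"
      "cm (m4 2 0 0 0 0 0 0 0 0 0 (-2) 0 0 0 0 0) Y' = (-4) *\<^sub>R Y'"
      using nf X' Y' unfolding nf2_def by simp_all
    from this[THEN weight_entries(1)] this[THEN weight_entries(2)] this[THEN weight_entries(3)]
      this[THEN weight_entries(4)] this[THEN weight_entries(5)] this[THEN weight_entries(6)]
      this[THEN weight_entries(7)] this[THEN weight_entries(8)] this[THEN weight_entries(9)]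
      this[THEN weight_entries(10)] this[THEN weight_entries(11)] this[THEN weight_entries(12)]
      this[THEN weight_entries(13)] this[THEN weight_entries(14)] this[THEN weight_entries(15)]
      this[THEN weight_entries(16)]
    have "X' = m4 0 0 (X'$1$3) 0 0 0 0 0 0 0 0 0 0 0 0 0" "Y' = m4 0 0 0 0 0 0 0 0 (Y'$3$1) 0 0 0 0 0 0 0"
      by (simp_all add: mat4_eq_iff)
    then obtain a c where e: "X' = m4 0 0 a 0 0 0 0 0 0 0 0 0 0 0 0 0" "Y' = m4 0 0 0 0 0 0 0 0 c 0 0 0 0 0 0 0" by blast
    have "a * c = 0"
      using XY' unfolding e by (simp add: cm_def m4_zero)
    with e X' Y' show False by (auto simp: m4_zero)
  next
    assume nf: "nf11 H' E' F'"
    have "cm (m4 1 0 0 0 0 (-1) 0 0 0 0 1 0 0 0 0 (-1)) X' = 4 *\<^sub>R X'"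
      using nf X' unfolding nf11_def by simp
    from weight_entries[OF this] X'(3) show False by (simp add: mat4_eq_iff)
  next
    assume nf: "nf1 H' E' F'"
    have "cm (m4 1 0 0 0 0 (-1) 0 0 0 0 0 0 0 0 0 0) X' = 4 *\<^sub>R X'"
      using nf X' unfolding nf1_def by simp
    from weight_entries[OF this] X'(3) show False by (simp add: mat4_eq_iff)
  qed
qed

text \<open>The equations say [h, x] = x, [h, g] = p g and [g, x] = 0 for 2x2 matrices, where h has
  rows (a, b) and (c, d). Being commutators up to a factor, x and g have trace zero, and a traceless
  matrix commuting with such an x \<noteq> 0 is a multiple of it. So g scales like x.\<close>

lemma scaled_pair_2x2:
  fixes a b c d x1 x2 x3 x4 g1 g2 g3 g4 p :: "'a::field_char_0"
  assumes x: "b * x3 - c * x2 = x1" "(a - d) * x2 + b * (x4 - x1) = x2" "c * (x1 - x4) + (d - a) * x3 = x3" "c * x2 - b * x3 = x4"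
    and g: "b * g3 - c * g2 = p * g1" "(a - d) * g2 + b * (g4 - g1) = p * g2" "c * (g1 - g4) + (d - a) * g3 = p * g3" "c * g2 - b * g3 = p * g4"
    and gx: "g2 * x3 = g3 * x2" "g1 * x2 + g2 * x4 = x1 * g2 + x2 * g4" "g3 * x1 + g4 * x3 = x3 * g1 + x4 * g3"
    and nz: "p \<noteq> 0" "\<not> (x1 = 0 \<and> x2 = 0 \<and> x3 = 0 \<and> x4 = 0)" "\<not> (g1 = 0 \<and> g2 = 0 \<and> g3 = 0 \<and> g4 = 0)"
  shows "p = 1" "g4 = - g1" "g1 * g1 + g2 * g3 = 0"
proof -
  have x4: "x4 = - x1" using x(1,4) by (metis minus_diff_eq)
  have "p * g4 = - (p * g1)" using g(1,4) by (metis minus_diff_eq)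
  then show g4: "g4 = - g1" using nz(1) by (metis mult_cancel_left mult_minus_right)
  have c: "x2 * g3 = g2 * x3" "x1 * g2 = g1 * x2" "x1 * g3 = g1 * x3"
  proof -
    show "x2 * g3 = g2 * x3" using gx(1) by (simp add: mult.commute)
    have "2 * (x1 * g2) = 2 * (g1 * x2)" using gx(2) unfolding x4 g4 by (simp add: algebra_simps)
    then show "x1 * g2 = g1 * x2" by simp
    have "2 * (x1 * g3) = 2 * (g1 * x3)" using gx(3) unfolding x4 g4 by (simp add: algebra_simps)
    then show "x1 * g3 = g1 * x3" by simp
  qed
  have "x1 \<noteq> 0 \<or> x2 \<noteq> 0 \<or> x3 \<noteq> 0" using nz(2) x4 by auto
  with c obtain k where k: "g1 = k * x1" "g2 = k * x2" "g3 = k * x3"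
    using parallel_triple[of x2 g3 g2 x3 x1 g1] by blast
  have "k \<noteq> 0" using k nz(3) g4 by auto
  have "b * g3 - c * g2 = k * (b * x3 - c * x2)" "(a - d) * g2 + b * (g4 - g1) = k * ((a - d) * x2 + b * (x4 - x1))"
    "c * (g1 - g4) + (d - a) * g3 = k * (c * (x1 - x4) + (d - a) * x3)"
    unfolding k g4 x4 by (simp_all add: algebra_simps)
  then have "b * g3 - c * g2 = k * x1" "(a - d) * g2 + b * (g4 - g1) = k * x2" "c * (g1 - g4) + (d - a) * g3 = k * x3"
    unfolding x by simp_all
  then have "p * (k * x1) = k * x1" "p * (k * x2) = k * x2" "p * (k * x3) = k * x3"
    using g k by simp_all
  then show "p = 1" using \<open>k \<noteq> 0\<close> \<open>x1 \<noteq> 0 \<or> x2 \<noteq> 0 \<or> x3 \<noteq> 0\<close> by auto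
  \<comment> \<open>The trace of x [h, x] vanishes, and [h, x] = x turns it into the trace of x^2:
    thus x is nilpotent, and so is its multiple g.\<close>
  have "2 * (x1 * x1 + x2 * x3) = 0"
  proof -
    have "2 * (x1 * x1 + x2 * x3) = 2 * x1 * (b * x3 - c * x2) + x3 * ((a - d) * x2 + b * (x4 - x1)) + x2 * (c * (x1 - x4) + (d - a) * x3)"
      unfolding x by (simp add: algebra_simps)
    also have "\<dots> = 0" unfolding x4 by (simp add: algebra_simps)
    finally show ?thesis .
  qed
  then have "x1 * x1 + x2 * x3 = 0" by (metis mult_eq_0_iff zero_neq_numeral)
  then have "k * k * (x1 * x1 + x2 * x3) = 0" by simp
  then show "g1 * g1 + g2 * g3 = 0" unfolding k by (simp add: algebra_simps)
qed

text \<open>On V_3 and V_2 + V_0 the commutant is commutative, which contradicts [h, g] = p g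
  \<noteq> 0. On V_1 + V_0 + V_0 the weight 2 vectors commute with the commutant, which contradicts
  [h, X] = X. There remains V_1 + V_1 with its 2x2 matrices; the last three equations characterize
  this module without reference to a basis.\<close>

lemma scaled_weight2:
  fixes H E F :: "'a::{real_normed_field,euclidean_space}^4^4"
  assumes sl2: "sl2_triple H E F"
    and X: "cm H X = 2 *\<^sub>R X" "X \<noteq> 0"
    and h: "cm H h = 0" "cm E h = 0" "cm F h = 0"
    and g: "cm H g = 0" "cm E g = 0" "cm F g = 0" "g \<noteq> 0"
    and br: "cm h X = X" "cm g X = 0" "cm h g = p *\<^sub>R g" "p \<noteq> 0"
  shows "p = 1" "g ** g = 0" "E ** E = 0" "F ** F = 0" "E ** F + F ** E = mat 1"
proof -
  have "E \<noteq> 0" using sl2_raising_nonzero[OF sl2 X] by simp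
  from sl2_normal_form[OF sl2 this] obtain P Q where PQ: "P ** Q = mat 1" "Q ** P = mat 1" and
    nf: "nf3 (cj P Q H) (cj P Q E) (cj P Q F) \<or> nf2 (cj P Q H) (cj P Q E) (cj P Q F) \<or>
     nf11 (cj P Q H) (cj P Q E) (cj P Q F) \<or> nf1 (cj P Q H) (cj P Q E) (cj P Q F)" by blast
  define H' E' F' X' h' g' where "H' = cj P Q H" and "E' = cj P Q E" and "F' = cj P Q F"
    and "X' = cj P Q X" and "h' = cj P Q h" and "g' = cj P Q g"
  note defs = this
  have X': "cm H' X' = 2 *\<^sub>R X'" "X' \<noteq> 0"
    and h': "cm H' h' = 0" "cm E' h' = 0" "cm F' h' = 0"
    and g': "cm H' g' = 0" "cm E' g' = 0" "cm F' g' = 0" "g' \<noteq> 0"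
    and br': "cm h' X' = X'" "cm g' X' = 0" "cm h' g' = p *\<^sub>R g'"
    using X h g br unfolding defs by (simp_all add: cj_simps cj_eq_zero[OF PQ(1)] flip: cj_cm[OF PQ(1)])
  have "nf11 H' E' F'"
  proof (rule ccontr)
    assume "\<not> nf11 H' E' F'"
    with nf[folded defs] consider "nf3 H' E' F'" | "nf2 H' E' F'" | "nf1 H' E' F'" by blast
    then show False
    proof cases
      case 1
      obtain x where g'e: "g' = m4 x 0 0 0 0 x 0 0 0 0 x 0 0 0 0 x"
        using nf3_commutant[OF 1 g'(1,2)] .
      obtain y where h'e: "h' = m4 y 0 0 0 0 y 0 0 0 0 y 0 0 0 0 y"
        using nf3_commutant[OF 1 h'(1,2)] .
      have "cm h' g' = 0" unfolding g'e h'e by (simp add: cm_def m4_zero)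
      with g' br br' show False by simp
    next
      case 2
      obtain x z where g'e: "g' = m4 x 0 0 0 0 x 0 0 0 0 x 0 0 0 0 z"
        using nf2_commutant[OF 2 g'(1-3)] .
      obtain y w where h'e: "h' = m4 y 0 0 0 0 y 0 0 0 0 y 0 0 0 0 w"
        using nf2_commutant[OF 2 h'(1-3)] .
      have "cm h' g' = 0" unfolding g'e h'e by (simp add: cm_def m4_zero)
      with g' br br' show False by simp
    next
      case 3
      obtain x where X'e: "X' = m4 0 x 0 0 0 0 0 0 0 0 0 0 0 0 0 0"
        using nf1_weight2[OF 3 X'(1)] .
      obtain r a b c d where h'e: "h' = m4 r 0 0 0 0 r 0 0 0 0 a b 0 0 c d"
        using nf1_commutant[OF 3 h'(1,2)] .
      have "cm h' X' = 0" unfolding X'e h'e by (simp add: cm_def m4_zero)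
      with X' br' show False by simp
    qed
  qed
  note nf = this
  obtain x1 x2 x3 x4 where X'e: "X' = m4 0 x1 0 x2 0 0 0 0 0 x3 0 x4 0 0 0 0"
    using nf11_weight2[OF nf X'(1)] .
  obtain a b c d where h'e: "h' = m4 a 0 b 0 0 a 0 b c 0 d 0 0 c 0 d"
    using nf11_commutant[OF nf h'(1,2)] .
  obtain g1 g2 g3 g4 where g'e: "g' = m4 g1 0 g2 0 0 g1 0 g2 g3 0 g4 0 0 g3 0 g4"
    using nf11_commutant[OF nf g'(1,2)] .
  have c1: "cm h' X' = m4 0 (b * x3 - c * x2) 0 ((a - d) * x2 + b * (x4 - x1)) 0 0 0 0
      0 (c * (x1 - x4) + (d - a) * x3) 0 (c * x2 - b * x3) 0 0 0 0"
    unfolding X'e h'e by (simp add: cm_def algebra_simps)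
  have x: "b * x3 - c * x2 = x1" "(a - d) * x2 + b * (x4 - x1) = x2"
    "c * (x1 - x4) + (d - a) * x3 = x3" "c * x2 - b * x3 = x4"
    using trans[OF c1[symmetric] br'(1)] unfolding X'e m4_eq_iff by blast+
  have c2: "cm h' g' = m4 (b * g3 - c * g2) 0 ((a - d) * g2 + b * (g4 - g1)) 0 0 (b * g3 - c * g2) 0 ((a - d) * g2 + b * (g4 - g1))
      (c * (g1 - g4) + (d - a) * g3) 0 (c * g2 - b * g3) 0 0 (c * (g1 - g4) + (d - a) * g3) 0 (c * g2 - b * g3)"
    unfolding g'e h'e by (simp add: cm_def algebra_simps)
  have g: "b * g3 - c * g2 = of_real p * g1" "(a - d) * g2 + b * (g4 - g1) = of_real p * g2"
    "c * (g1 - g4) + (d - a) * g3 = of_real p * g3" "c * g2 - b * g3 = of_real p * g4"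
    using trans[OF c2[symmetric] br'(3)] unfolding g'e m4_scaleR m4_eq_iff by blast+
  have c3: "cm g' X' = m4 0 (g2 * x3 - g3 * x2) 0 ((g1 * x2 + g2 * x4) - (x1 * g2 + x2 * g4)) 0 0 0 0
      0 ((g3 * x1 + g4 * x3) - (x3 * g1 + x4 * g3)) 0 (g3 * x2 - g2 * x3) 0 0 0 0"
    unfolding X'e g'e by (simp add: cm_def algebra_simps)
  have gx: "g2 * x3 = g3 * x2" "g1 * x2 + g2 * x4 = x1 * g2 + x2 * g4" "g3 * x1 + g4 * x3 = x3 * g1 + x4 * g3"
    using trans[OF c3[symmetric] br'(2)] unfolding m4_zero m4_eq_iff right_minus_eq by blast+
  have nz: "of_real p \<noteq> (0::'a)" "\<not> (x1 = 0 \<and> x2 = 0 \<and> x3 = 0 \<and> x4 = 0)" "\<not> (g1 = 0 \<and> g2 = 0 \<and> g3 = 0 \<and> g4 = 0)"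
    using br(4) X'(2) g'(4) unfolding X'e g'e by (auto simp: m4_zero)
  note sp = scaled_pair_2x2[OF x g gx nz]
  from sp(1) show "p = 1" by simp
  have "g' ** g' = 0" unfolding g'e using sp(2,3) by (simp add: m4_zero algebra_simps)
  then show "g ** g = 0" unfolding defs by (simp add: cj_eq_zero[OF PQ(1)] flip: cj_mult[OF PQ(1)])
  have "E' ** E' = 0" "F' ** F' = 0" using nf unfolding nf11_def by (simp_all add: m4_zero)
  then show "E ** E = 0" "F ** F = 0" unfolding defs by (simp_all add: cj_eq_zero[OF PQ(1)] flip: cj_mult[OF PQ(1)])
  have "E' ** F' + F' ** E' - mat 1 = 0" using nf unfolding nf11_def by (simp add: m4_zero m4_one)
  then have "cj P Q (E ** F + F ** E - mat 1) = 0"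
    unfolding defs by (simp add: cj_simps cj_one[OF PQ(2)] flip: cj_mult[OF PQ(1)])
  then show "E ** F + F ** E = mat 1" by (simp add: cj_eq_zero[OF PQ(1)])
qed

text \<open>Describes V_1 + V_0 + V_0 by relations independent of the basis. For so_3 the
  normalizing matrices are complex, whereas these relations can be split into real and imaginary
  parts.\<close>

lemma weight1_products:
  fixes H E F :: "'a::{real_normed_field,euclidean_space}^4^4"
  assumes sl2: "sl2_triple H E F" and X: "cm H X = X" "X \<noteq> 0"
  shows "E ** E = 0" "F ** F = 0" "E ** F ** E = E" "F ** E ** F = F" "E ** F + F ** E \<noteq> mat 1" "E \<noteq> 0"
proof -
  obtain P Q where PQ: "P ** Q = mat 1" "Q ** P = mat 1" and nf: "nf1 (cj P Q H) (cj P Q E) (cj P Q F)"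
    using weight1_normal_form[OF sl2 X] .
  have 1: "cj P Q (E ** E) = 0" "cj P Q (F ** F) = 0" "cj P Q (E ** F ** E - E) = 0" "cj P Q (F ** E ** F - F) = 0"
    "cj P Q (E ** F + F ** E - mat 1) \<noteq> 0" "cj P Q E \<noteq> 0"
    unfolding cj_simps cj_one[OF PQ(2)] cj_mult[OF PQ(1)]
    using nf by (simp_all add: nf1_def m4_zero m4_one)
  from 1 show "E ** E = 0" "F ** F = 0" "E ** F ** E = E" "F ** E ** F = F" "E ** F + F ** E \<noteq> mat 1" "E \<noteq> 0"
    unfolding cj_eq_zero[OF PQ(1)] by simp_all
qed

text \<open>A pair (u, v) annihilating (a, b) is a multiple of (b, -a); the dual pair (s, t) yields
  the factor without a case distinction on which of a, b is non-zero.\<close>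

lemma dual_pair_coordinates:
  fixes u v a b s t :: real
  assumes "s * a + t * b = 1" "u * a + v * b = 0"
  shows "u = (u * t - v * s) * b" "v = - (u * t - v * s) * a"
proof -
  have tb: "t * b = 1 - s * a" and vb: "v * b = - (u * a)" and sa: "s * a = 1 - t * b" and ua: "u * a = - (v * b)" using assms by simp_all
  have "(u * t - v * s) * b = u * (t * b) - s * (v * b)" by (simp add: algebra_simps)
  also have "\<dots> = u" unfolding tb vb by (simp add: algebra_simps)
  finally show "u = (u * t - v * s) * b" ..
  have "- (u * t - v * s) * a = v * (s * a) - t * (u * a)" by (simp add: algebra_simps)
  also have "\<dots> = v" unfolding sa ua by (simp add: algebra_simps)
  finally show "v = - (u * t - v * s) * a" ..
qed

text \<open>A vector and a covector pairing to 1 and killed by everything leave only V_1 + V_0.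
  There a vector of weight 1 is a pair (k, l), and the commutator of two of them is the determinant
  k l' - k' l, which is non-zero for independent pairs.\<close>

lemma doublets_commute_in_gl3:
  fixes H E F X1 X2 :: "real^4^4"
  assumes sl2: "sl2_triple H E F" and X: "cm H X1 = X1" "cm H X2 = X2" "cm X1 X2 = 0"
    and ind: "\<And>a b. a *\<^sub>R X1 + b *\<^sub>R X2 = 0 \<Longrightarrow> a = 0 \<and> b = 0"
    and z: "\<And>M. M \<in> {H, X1, X2} \<Longrightarrow> M *v axis 4 1 = 0 \<and> axis 4 1 v* M = 0"
  shows False
proof -
  have "X1 \<noteq> 0" using ind[of 1 0] by auto
  obtain P Q where PQ: "P ** Q = mat 1" "Q ** P = mat 1" and nf: "nf1 (cj P Q H) (cj P Q E) (cj P Q F)"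
    using weight1_normal_form[OF sl2 X(1) \<open>X1 \<noteq> 0\<close>] .
  define H' X1' X2' where "H' = cj P Q H" and "X1' = cj P Q X1" and "X2' = cj P Q X2"
  note defs = this
  \<comment> \<open>The fourth unit vector, as a column and as a row, in the new
    coordinates.\<close>
  define y :: "real^4" where "y = Q *v axis 4 1"
  define t :: "real^4" where "t = axis 4 1 v* P"
  have y: "H' *v y = 0" "X1' *v y = 0" "X2' *v y = 0" and t: "t v* H' = 0" "t v* X1' = 0" "t v* X2' = 0"
  proof -
    have "cj P Q M *v y = 0 \<and> t v* cj P Q M = 0" if "M \<in> {H, X1, X2}" for M
    proof
      have "cj P Q M *v y = Q *v (M *v ((P ** Q) *v axis 4 1))"
        by (simp add: cj_def y_def matrix_vector_mul_assoc matrix_mul_assoc)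
      then show "cj P Q M *v y = 0" using z[OF that] PQ by simp
      have "t v* cj P Q M = ((axis 4 1 v* (P ** Q)) v* M) v* P"
        by (simp add: cj_def t_def vector_matrix_mul_assoc matrix_mul_assoc)
      then show "t v* cj P Q M = 0" using z[OF that] PQ by simp
    qed
    then show "H' *v y = 0" "X1' *v y = 0" "X2' *v y = 0" "t v* H' = 0" "t v* X1' = 0" "t v* X2' = 0"
      unfolding defs by auto
  qed
  have X': "cm H' X1' = X1'" "cm H' X2' = X2'" "cm X1' X2' = 0"
    using X unfolding defs by (simp_all add: cj_simps flip: cj_cm[OF PQ(1)])
  have ind': "a = 0 \<and> b = 0" if "a *\<^sub>R X1' + b *\<^sub>R X2' = 0" for a b
  proof -
    have "cj P Q (a *\<^sub>R X1 + b *\<^sub>R X2) = 0" using that unfolding defs by (simp add: cj_simps)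
    then show ?thesis using ind cj_eq_zero[OF PQ(1)] by blast
  qed
  obtain u1 u2 w1 w2 where X1: "X1' = m4 0 0 u1 u2 0 0 0 0 0 w1 0 0 0 w2 0 0"
    using nf1_weight1[OF nf[folded defs] X'(1)] .
  obtain u1' u2' w1' w2' where X2: "X2' = m4 0 0 u1' u2' 0 0 0 0 0 w1' 0 0 0 w2' 0 0"
    using nf1_weight1[OF nf[folded defs] X'(2)] .
  have H: "H' = m4 1 0 0 0 0 (-1) 0 0 0 0 0 0 0 0 0 0" using nf unfolding nf1_def defs by blast
  have yt: "y$1 = 0" "y$2 = 0" "t$1 = 0" "t$2 = 0"
    using y(1) t(1) unfolding H by (simp_all add: vec_eq_iff forall_4 matrix_vector_mult_def vector_matrix_mult_def sum_4)
  have "t$1 * y$1 + t$2 * y$2 + t$3 * y$3 + t$4 * y$4 = (P ** Q) $ 4 $ 4"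
    by (simp add: t_def y_def matrix_vector_mult_def vector_matrix_mult_def matrix_matrix_mult_def sum_4 axis_def distinct_4)
  then have ty: "t$3 * y$3 + t$4 * y$4 = 1" using yt PQ by (simp add: mat_def)
  have e: "u1 * y$3 + u2 * y$4 = 0" "u1' * y$3 + u2' * y$4 = 0" "w1 * t$3 + w2 * t$4 = 0" "w1' * t$3 + w2' * t$4 = 0"
    using y(2,3) t(2,3) unfolding X1 X2
    by (simp_all add: vec_eq_iff forall_4 matrix_vector_mult_def vector_matrix_mult_def sum_4 yt mult.commute)
  have sym: "u1 * w1' + u2 * w2' = u1' * w1 + u2' * w2"
    using X'(3) unfolding X1 X2 by (simp add: cm_def m4_zero)
  define k l k' l' where "k = u1 * t$4 - u2 * t$3" and "l = w1 * y$4 - w2 * y$3"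
    and "k' = u1' * t$4 - u2' * t$3" and "l' = w1' * y$4 - w2' * y$3"
  have u: "u1 = k * y$4" "u2 = - k * y$3" "u1' = k' * y$4" "u2' = - k' * y$3"
    "w1 = l * t$4" "w2 = - l * t$3" "w1' = l' * t$4" "w2' = - l' * t$3"
    using dual_pair_coordinates[OF ty e(1)] dual_pair_coordinates[OF ty e(2)]
      dual_pair_coordinates[of "y$3" "t$3" "y$4" "t$4" w1 w2] dual_pair_coordinates[of "y$3" "t$3" "y$4" "t$4" w1' w2'] ty e(3,4)
    unfolding k_def l_def k'_def l'_def by (simp_all add: mult.commute)
  have kl: "k * l' = k' * l"
  proof -
    have "k * l' * (t$3 * y$3 + t$4 * y$4) = k' * l * (t$3 * y$3 + t$4 * y$4)"
      using sym unfolding u by (simp add: algebra_simps)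
    then show ?thesis unfolding ty by simp
  qed
  have "k' *\<^sub>R X1' + (- k) *\<^sub>R X2' = 0"
    unfolding X1 X2 m4_zero u using kl by (simp add: algebra_simps)
  from ind'[OF this] have "k = 0" "k' = 0" by auto
  then have "l' *\<^sub>R X1' + (- l) *\<^sub>R X2' = 0"
    unfolding X1 X2 m4_zero u by (simp add: algebra_simps)
  from ind'[OF this] have "l = 0" "l' = 0" by auto
  with \<open>k = 0\<close> have "X1' = 0" unfolding X1 m4_zero u by simp
  with ind'[of 1 0] show False by simp
qed

text \<open>Since c commutes with X, the pairing of the row u with the column w vanishes, so w is u
  turned by a right angle up to a factor. On the trivial part c is then 2 w u, of rank one, and g -
  r is killed by u from the left and by w on the right, hence proportional to w u.\<close>

lemma doublet_center_commutant:
  fixes H E F X Y c g :: "real^4^4"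
  assumes sl2: "sl2_triple H E F" and X: "cm H X = X" "cm F X = Y" and c: "cm X Y = c" "c \<noteq> 0" "cm c X = 0"
    and g: "cm H g = 0" "cm E g = 0" "cm g X = 0"
  obtains a b where "g = a *\<^sub>R mat 1 + b *\<^sub>R c"
proof -
  have "X \<noteq> 0" using c by auto
  obtain P Q where PQ: "P ** Q = mat 1" "Q ** P = mat 1" and nf: "nf1 (cj P Q H) (cj P Q E) (cj P Q F)"
    using weight1_normal_form[OF sl2 X(1) \<open>X \<noteq> 0\<close>] .
  define H' E' F' X' Y' c' g' where "H' = cj P Q H" and "E' = cj P Q E" and "F' = cj P Q F"
    and "X' = cj P Q X" and "Y' = cj P Q Y" and "c' = cj P Q c" and "g' = cj P Q g"
  note defs = this
  have X': "cm H' X' = X'" "cm F' X' = Y'" and c': "cm X' Y' = c'" "c' \<noteq> 0" "cm c' X' = 0"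
    and g': "cm H' g' = 0" "cm E' g' = 0" "cm g' X' = 0"
    using X c g unfolding defs by (simp_all add: cj_simps cj_eq_zero[OF PQ(1)] flip: cj_cm[OF PQ(1)])
  note nf' = nf[folded defs]
  obtain u1 u2 w1 w2 where Xe: "X' = m4 0 0 u1 u2 0 0 0 0 0 w1 0 0 0 w2 0 0"
    using nf1_weight1[OF nf' X'(1)] .
  have Ye: "Y' = m4 0 0 0 0 0 0 u1 u2 (- w1) 0 0 0 (- w2) 0 0 0"
    using X'(2) nf' unfolding Xe nf1_def by (auto simp: cm_def)
  define s where "s = u1 * w1 + u2 * w2"
  have ce: "c' = m4 (- s) 0 0 0 0 (- s) 0 0 0 0 (2 * w1 * u1) (2 * w1 * u2) 0 0 (2 * w2 * u1) (2 * w2 * u2)"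
    unfolding c'(1)[symmetric] Xe Ye s_def by (simp add: cm_def)
  \<comment> \<open>Entries of [c, X] = 0, which are multiples of 3 s u. If s were non-zero, u would
    vanish, and with it s.\<close>
  have su: "s * u1 = 0" "s * u2 = 0"
    using c'(3) unfolding ce Xe s_def by (simp_all add: cm_def m4_zero algebra_simps)
  then have s: "s = 0" using s_def by (metis add.right_neutral mult_eq_0_iff)
  have nz: "u1 \<noteq> 0 \<or> u2 \<noteq> 0" "w1 \<noteq> 0 \<or> w2 \<noteq> 0"
    using c'(2) unfolding ce s by (auto simp: m4_zero)
  obtain k where w: "w1 = - k * u2" "w2 = k * u1"
    using orthogonal_pair[of u1 w1 u2 w2] s nz(1) unfolding s_def by metis
  have "k \<noteq> 0" using w nz by auto
  obtain r g1 g2 g3 g4 where ge: "g' = m4 r 0 0 0 0 r 0 0 0 0 g1 g2 0 0 g3 g4"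
    using nf1_commutant[OF nf' g'(1,2)] .
  have ug: "u1 * (g1 - r) + u2 * g3 = 0" "u1 * g2 + u2 * (g4 - r) = 0" and gw: "(g1 - r) * w1 + g2 * w2 = 0" "g3 * w1 + (g4 - r) * w2 = 0"
  proof -
    have "cm g' X' = m4 0 0 (- (u1 * (g1 - r) + u2 * g3)) (- (u1 * g2 + u2 * (g4 - r))) 0 0 0 0
      0 ((g1 - r) * w1 + g2 * w2) 0 0 0 (g3 * w1 + (g4 - r) * w2) 0 0"
      unfolding ge Xe by (simp add: cm_def algebra_simps)
    from trans[OF this[symmetric] g'(3)]
    show "u1 * (g1 - r) + u2 * g3 = 0" "u1 * g2 + u2 * (g4 - r) = 0" "(g1 - r) * w1 + g2 * w2 = 0" "g3 * w1 + (g4 - r) * w2 = 0"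
      unfolding m4_zero m4_eq_iff by linarith+
  qed
  obtain m where m: "g1 - r = - m * u2" "g3 = m * u1"
    using orthogonal_pair[OF ug(1) nz(1)] .
  obtain n where n: "g2 = - n * u2" "g4 - r = n * u1"
    using orthogonal_pair[OF ug(2) nz(1)] .
  have "k * u2 * (m * u2 - n * u1) = 0" "k * u1 * (m * u2 - n * u1) = 0"
    using gw unfolding m n w by (auto simp: algebra_simps)
  then have "m * u2 - n * u1 = 0" using \<open>k \<noteq> 0\<close> nz(1) by (metis mult_eq_0_iff)
  then have "u1 * n + u2 * (- m) = 0" by (simp add: algebra_simps)
  then obtain b where b: "n = - b * u2" "- m = b * u1"
    using orthogonal_pair nz(1) by metis
  have gs: "g1 = r + b * u1 * u2" "g2 = b * u2 * u2" "g3 = - b * u1 * u1" "g4 = r - b * u1 * u2"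
  proof -
    have m': "m = - (b * u1)" using b(2) by simp
    show "g1 = r + b * u1 * u2" using m(1) unfolding m' by (simp add: algebra_simps)
    show "g2 = b * u2 * u2" using n(1) unfolding b(1) by simp
    show "g3 = - b * u1 * u1" using m(2) unfolding m' by simp
    show "g4 = r - b * u1 * u2" using n(2) unfolding b(1) by (simp add: algebra_simps)
  qed
  \<comment> \<open>On the trivial part \<open>c'\<close> is 2 k times the product of the column
    (-u2, u1) and the row (u1, u2), and \<open>g'\<close> minus the scalar is -b times that
    product.\<close>
  have "g' = r *\<^sub>R mat 1 + (- b / (2 * k)) *\<^sub>R c'"
    unfolding ge ce s gs w using \<open>k \<noteq> 0\<close> by (simp add: m4_one field_simps)
  then have "cj P Q (g - (r *\<^sub>R mat 1 + (- b / (2 * k)) *\<^sub>R c)) = 0"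
    unfolding defs by (simp add: cj_simps cj_one[OF PQ(2)])
  then have "g = r *\<^sub>R mat 1 + (- b / (2 * k)) *\<^sub>R c"
    unfolding cj_eq_zero[OF PQ(1)] by simp
  with that show ?thesis by blast
qed

text \<open>The commutant is a sum of scalars on V_1 and gl_2 on the trivial part, so commutators
  within it lie in sl_2. The bracket of sl_2 is a cross product up to coordinates; commuting
  elements are parallel.\<close>

lemma commuting_commutators_dependent:
  fixes H E F X h f f' g g' :: "real^4^4"
  assumes sl2: "sl2_triple H E F" and X: "cm H X = X" "X \<noteq> 0"
    and h: "cm H h = 0" "cm E h = 0" and f': "cm H f' = 0" "cm E f' = 0" and g': "cm H g' = 0" "cm E g' = 0"
    and fg: "f = cm h f'" "g = cm h g'" "cm f g = 0"
  obtains a b where "a *\<^sub>R f + b *\<^sub>R g = 0" "a \<noteq> 0 \<or> b \<noteq> 0"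
proof -
  obtain P Q where PQ: "P ** Q = mat 1" "Q ** P = mat 1" and nf: "nf1 (cj P Q H) (cj P Q E) (cj P Q F)"
    using weight1_normal_form[OF sl2 X] .
  have com: "\<exists>r a b c d. cj P Q x = m4 r 0 0 0 0 r 0 0 0 0 a b 0 0 c d" if "cm H x = 0" "cm E x = 0" for x
    using nf1_commutant[OF nf, of "cj P Q x"] that by (metis cj_cm[OF PQ(1)] cj_simps(5))
  obtain r1 h1 h2 h3 h4 where he: "cj P Q h = m4 r1 0 0 0 0 r1 0 0 0 0 h1 h2 0 0 h3 h4" using com[OF h] by blast
  obtain r2 f1 f2 f3 f4 where fe: "cj P Q f' = m4 r2 0 0 0 0 r2 0 0 0 0 f1 f2 0 0 f3 f4" using com[OF f'] by blast
  obtain r3 g1 g2 g3 g4 where ge: "cj P Q g' = m4 r3 0 0 0 0 r3 0 0 0 0 g1 g2 0 0 g3 g4" using com[OF g'] by blast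
  have "cj P Q f = m4 0 0 0 0 0 0 0 0 0 0 (h2 * f3 - f2 * h3) (h1 * f2 + h2 * f4 - f1 * h2 - f2 * h4)
      0 0 (h3 * f1 + h4 * f3 - f3 * h1 - f4 * h3) (- (h2 * f3 - f2 * h3))"
    unfolding fg(1) cj_cm[OF PQ(1)] he fe by (simp add: cm_def algebra_simps)
  then obtain x y z where f: "cj P Q f = m4 0 0 0 0 0 0 0 0 0 0 x y 0 0 z (- x)" by blast
  have "cj P Q g = m4 0 0 0 0 0 0 0 0 0 0 (h2 * g3 - g2 * h3) (h1 * g2 + h2 * g4 - g1 * h2 - g2 * h4)
      0 0 (h3 * g1 + h4 * g3 - g3 * h1 - g4 * h3) (- (h2 * g3 - g2 * h3))"
    unfolding fg(2) cj_cm[OF PQ(1)] he ge by (simp add: cm_def algebra_simps)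
  then obtain x' y' z' where g: "cj P Q g = m4 0 0 0 0 0 0 0 0 0 0 x' y' 0 0 z' (- x')" by blast
  have 0: "cm (cj P Q f) (cj P Q g) = 0" using fg(3) by (metis cj_cm[OF PQ(1)] cj_simps(5))
  have c: "cm (cj P Q f) (cj P Q g) = m4 0 0 0 0 0 0 0 0 0 0 (y * z' - y' * z) (2 * (x * y' - x' * y))
      0 0 (2 * (x' * z - x * z')) (y' * z - y * z')"
    unfolding f g by (simp add: cm_def algebra_simps)
  have p: "y * z' = y' * z" "x * y' = x' * y" "x * z' = x' * z"
    using trans[OF c[symmetric] 0] unfolding m4_zero m4_eq_iff mult_eq_0_iff right_minus_eq by (metis zero_neq_numeral)+
  have *: "\<exists>a b. a *\<^sub>R f + b *\<^sub>R g = 0 \<and> (a \<noteq> 0 \<or> b \<noteq> 0)"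
    if "cj P Q (a *\<^sub>R f + b *\<^sub>R g) = 0" "a \<noteq> 0 \<or> b \<noteq> 0" for a b
    using that unfolding cj_eq_zero[OF PQ(1)] by blast
  have "\<exists>a b. a *\<^sub>R f + b *\<^sub>R g = 0 \<and> (a \<noteq> 0 \<or> b \<noteq> 0)"
  proof (cases "x \<noteq> 0 \<or> y \<noteq> 0 \<or> z \<noteq> 0")
    case True
    then obtain k where "x' = k * x" "y' = k * y" "z' = k * z" using parallel_triple[OF p] by blast
    then show ?thesis by (intro *[of k "-1"]) (simp_all add: cj_simps f g m4_zero)
  next
    case False
    then have "cj P Q f = 0" using f by (simp add: m4_zero)
    then have "1 *\<^sub>R f + 0 *\<^sub>R g = 0" by (simp add: cj_eq_zero[OF PQ(1)])
    then show ?thesis by (metis zero_neq_one)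
  qed
  with that show ?thesis by blast
qed

text \<open>gl_2 contains no Heisenberg algebra: if f \<noteq> 0, the traceless parts of h and g
  would both be multiples of f, and h and g would commute.\<close>

lemma commuting_commutator_zero:
  fixes H E F X h f g :: "real^4^4"
  assumes sl2: "sl2_triple H E F" and X: "cm H X = X" "X \<noteq> 0"
    and h: "cm H h = 0" "cm E h = 0" and g: "cm H g = 0" "cm E g = 0"
    and f: "cm h g = f" "cm h f = 0" "cm g f = 0"
  shows "f = 0"
proof -
  obtain P Q where PQ: "P ** Q = mat 1" "Q ** P = mat 1" and nf: "nf1 (cj P Q H) (cj P Q E) (cj P Q F)"
    using weight1_normal_form[OF sl2 X] .
  have com: "\<exists>r a b c d. cj P Q x = m4 r 0 0 0 0 r 0 0 0 0 a b 0 0 c d" if "cm H x = 0" "cm E x = 0" for x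
    using nf1_commutant[OF nf, of "cj P Q x"] that by (metis cj_cm[OF PQ(1)] cj_simps(5))
  obtain r1 a b c d where he: "cj P Q h = m4 r1 0 0 0 0 r1 0 0 0 0 a b 0 0 c d" using com[OF h] by blast
  obtain r2 a' b' c' d' where ge: "cj P Q g = m4 r2 0 0 0 0 r2 0 0 0 0 a' b' 0 0 c' d'" using com[OF g] by blast
  define x y z where "x = b * c' - b' * c" and "y = (a - d) * b' - (a' - d') * b" and "z = c * (a' - d') - c' * (a - d)"
  have fe: "cj P Q f = m4 0 0 0 0 0 0 0 0 0 0 x y 0 0 z (- x)"
    unfolding f(1)[symmetric] cj_cm[OF PQ(1)] he ge x_def y_def z_def by (simp add: cm_def algebra_simps)
  have 0: "cm (cj P Q h) (cj P Q f) = 0" "cm (cj P Q g) (cj P Q f) = 0" using f(2,3) by (metis cj_cm[OF PQ(1)] cj_simps(5))+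
  have c: "cm (cj P Q h) (cj P Q f) = m4 0 0 0 0 0 0 0 0 0 0 (b * z - c * y) ((a - d) * y - 2 * b * x)
      0 0 (2 * c * x - (a - d) * z) (c * y - b * z)"
    "cm (cj P Q g) (cj P Q f) = m4 0 0 0 0 0 0 0 0 0 0 (b' * z - c' * y) ((a' - d') * y - 2 * b' * x)
      0 0 (2 * c' * x - (a' - d') * z) (c' * y - b' * z)"
    unfolding he ge fe by (simp_all add: cm_def algebra_simps)
  have p: "(a - d) * y = 2 * b * x" "(a - d) * z = 2 * c * x" "(a' - d') * y = 2 * b' * x" "(a' - d') * z = 2 * c' * x"
    using trans[OF c(1)[symmetric] 0(1)] trans[OF c(2)[symmetric] 0(2)] unfolding m4_zero m4_eq_iff by linarith+
  \<comment> \<open>Multiply \<open>b * c' - b' * c\<close> by 4 x^2; after substituting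
    \<open>p\<close>, both products equal (a - d) (a' - d') y z.\<close>
  have "4 * x * x * x = (2 * b * x) * (2 * c' * x) - (2 * b' * x) * (2 * c * x)"
    unfolding x_def by (simp add: algebra_simps)
  also have "\<dots> = 0" unfolding p[symmetric] by (simp add: algebra_simps)
  finally have x: "x = 0" by simp
  have "y * y = ((a - d) * y) * b' - ((a' - d') * y) * b" "z * z = c * ((a' - d') * z) - c' * ((a - d) * z)"
    unfolding y_def z_def by (simp_all add: algebra_simps)
  then have "y = 0" "z = 0" unfolding p x by simp_all
  with x fe have "cj P Q f = 0" by (simp add: m4_zero)
  then show ?thesis by (simp add: cj_eq_zero[OF PQ(1)])
qed

text \<open>With s the pairing of the row u and the column w of X, the doublet [c, X] has row -3 s u
  and column 3 s w. Its bracket with X is 6 s^2 E, so s = 0.\<close>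

lemma iterated_doublet_zero:
  fixes H E F X Y c X2 :: "real^4^4"
  assumes sl2: "sl2_triple H E F" and X: "cm H X = X" "cm F X = Y"
    and c: "cm X Y = c" "cm c X = X2" "cm X X2 = 0"
  shows "X2 = 0"
proof (cases "X = 0")
  case True
  then show ?thesis using c by simp
next
  case False
  obtain P Q where PQ: "P ** Q = mat 1" "Q ** P = mat 1" and nf: "nf1 (cj P Q H) (cj P Q E) (cj P Q F)"
    using weight1_normal_form[OF sl2 X(1) False] .
  define H' E' F' X' Y' c' Z' where "H' = cj P Q H" and "E' = cj P Q E" and "F' = cj P Q F"
    and "X' = cj P Q X" and "Y' = cj P Q Y" and "c' = cj P Q c" and "Z' = cj P Q X2"
  note defs = this
  have X': "cm H' X' = X'" "cm F' X' = Y'" and c': "cm X' Y' = c'" "cm c' X' = Z'" "cm X' Z' = 0"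
    using X c unfolding defs by (simp_all add: cj_simps flip: cj_cm[OF PQ(1)])
  note nf' = nf[folded defs]
  obtain u1 u2 w1 w2 where Xe: "X' = m4 0 0 u1 u2 0 0 0 0 0 w1 0 0 0 w2 0 0"
    using nf1_weight1[OF nf' X'(1)] .
  have Ye: "Y' = m4 0 0 0 0 0 0 u1 u2 (- w1) 0 0 0 (- w2) 0 0 0"
    using X'(2) nf' unfolding Xe nf1_def by (auto simp: cm_def)
  define s where "s = u1 * w1 + u2 * w2"
  have ce: "c' = m4 (- s) 0 0 0 0 (- s) 0 0 0 0 (2 * w1 * u1) (2 * w1 * u2) 0 0 (2 * w2 * u1) (2 * w2 * u2)"
    unfolding c'(1)[symmetric] Xe Ye s_def by (simp add: cm_def)
  have Ze: "Z' = m4 0 0 (- 3 * s * u1) (- 3 * s * u2) 0 0 0 0 0 (3 * s * w1) 0 0 0 (3 * s * w2) 0 0"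
    unfolding c'(2)[symmetric] Xe ce by (simp add: cm_def s_def algebra_simps)
  have "6 * s * s = 0" using c'(3) unfolding Xe Ze by (simp add: cm_def m4_zero s_def algebra_simps)
  then have "Z' = 0" unfolding Ze by (simp add: m4_zero)
  then show ?thesis unfolding defs by (simp add: cj_eq_zero[OF PQ(1)])
qed

text \<open>A doublet forces V_1 + V_0 + V_0, where weight 2 has multiplicity one and is taken by
  the Levi factor. So no V_2 is left for the radical.\<close>

lemma weight2_with_doublet:
  fixes H E F X Z :: "real^4^4"
  assumes sl2: "sl2_triple H E F" and X: "cm H X = X" "X \<noteq> 0" and Z: "cm H Z = 2 *\<^sub>R Z"
  obtains k where "Z = k *\<^sub>R E"
proof -
  obtain P Q where PQ: "P ** Q = mat 1" "Q ** P = mat 1" and nf: "nf1 (cj P Q H) (cj P Q E) (cj P Q F)"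
    using weight1_normal_form[OF sl2 X] .
  have "cm (cj P Q H) (cj P Q Z) = 2 *\<^sub>R cj P Q Z" using Z by (metis cj_cm[OF PQ(1)] cj_simps(4))
  then obtain k where "cj P Q Z = m4 0 k 0 0 0 0 0 0 0 0 0 0 0 0 0 0"
    by (rule nf1_weight2[OF nf])
  then have "cj P Q (Z - k *\<^sub>R E) = 0" using nf by (simp add: cj_simps nf1_def m4_zero)
  then have "Z = k *\<^sub>R E" by (simp add: cj_eq_zero[OF PQ(1)])
  with that show ?thesis by blast
qed

text \<open>The sign \<epsilon> = 1 enters through positivity. With rows u, a and columns w, b,
  equal central brackets give w u = b a, and [X1, Y2] = 0 gives w a = - b u; hence each entry
  satisfies (w u)^2 = - (w a)^2.\<close>

lemma definite_heisenberg_center_zero: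
  fixes H E F X1 Y1 X2 Y2 c :: "real^4^4"
  assumes sl2: "sl2_triple H E F" and X: "cm H X1 = X1" "cm F X1 = Y1" "cm H X2 = X2" "cm F X2 = Y2"
    and c: "cm X1 Y1 = c" "cm X2 Y2 = c" "cm X1 Y2 = 0" "cm c X1 = 0"
  shows "c = 0"
proof (cases "X1 = 0")
  case True
  then show ?thesis using c by simp
next
  case False
  obtain P Q where PQ: "P ** Q = mat 1" "Q ** P = mat 1" and nf: "nf1 (cj P Q H) (cj P Q E) (cj P Q F)"
    using weight1_normal_form[OF sl2 X(1) False] .
  define H' E' F' X' Y' Z' W' c' where "H' = cj P Q H" and "E' = cj P Q E" and "F' = cj P Q F"
    and "X' = cj P Q X1" and "Y' = cj P Q Y1" and "Z' = cj P Q X2" and "W' = cj P Q Y2" and "c' = cj P Q c"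
  note defs = this
  have X': "cm H' X' = X'" "cm F' X' = Y'" "cm H' Z' = Z'" "cm F' Z' = W'"
    and c': "cm X' Y' = c'" "cm Z' W' = c'" "cm X' W' = 0" "cm c' X' = 0"
    using X c unfolding defs by (simp_all add: cj_simps flip: cj_cm[OF PQ(1)])
  note nf' = nf[folded defs]
  obtain u1 u2 w1 w2 where Xe: "X' = m4 0 0 u1 u2 0 0 0 0 0 w1 0 0 0 w2 0 0"
    using nf1_weight1[OF nf' X'(1)] .
  obtain a1 a2 b1 b2 where Ze: "Z' = m4 0 0 a1 a2 0 0 0 0 0 b1 0 0 0 b2 0 0"
    using nf1_weight1[OF nf' X'(3)] .
  have Ye: "Y' = m4 0 0 0 0 0 0 u1 u2 (- w1) 0 0 0 (- w2) 0 0 0"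
    and We: "W' = m4 0 0 0 0 0 0 a1 a2 (- b1) 0 0 0 (- b2) 0 0 0"
    using X'(2,4) nf' unfolding Xe Ze nf1_def by (auto simp: cm_def)
  define s where "s = u1 * w1 + u2 * w2"
  have ce: "c' = m4 (- s) 0 0 0 0 (- s) 0 0 0 0 (2 * w1 * u1) (2 * w1 * u2) 0 0 (2 * w2 * u1) (2 * w2 * u2)"
    unfolding c'(1)[symmetric] Xe Ye s_def by (simp add: cm_def)
  have su: "s * u1 = 0" "s * u2 = 0"
    using c'(4) unfolding ce Xe s_def by (simp_all add: cm_def m4_zero algebra_simps)
  then have s: "s = 0" using s_def by (metis add.right_neutral mult_eq_0_iff)
  have 1: "b1 * a1 = w1 * u1" "b1 * a2 = w1 * u2" "b2 * a1 = w2 * u1" "b2 * a2 = w2 * u2"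
    using c'(2) unfolding Ze We ce by (simp_all add: cm_def mult.commute)
  have 2: "w1 * a1 + b1 * u1 = 0" "w1 * a2 + b1 * u2 = 0" "w2 * a1 + b2 * u1 = 0" "w2 * a2 + b2 * u2 = 0"
    using c'(3) unfolding Xe We by (simp_all add: cm_def m4_zero algebra_simps)
  have *: "w * u = 0" if "b * a = w * u" "w * a + b * u = 0" for a b u w :: real
  proof -
    have "(w * u) * (w * u) = (w * a) * (b * u)" using that(1) by (metis mult.commute mult.left_commute)
    also have "\<dots> = - ((w * a) * (w * a))" using that(2) by (simp add: add_eq_0_iff)
    finally have "(w * u) * (w * u) \<le> 0" by simp
    then show ?thesis by (metis mult_eq_0_iff not_square_less_zero order_le_less)
  qed
  have "w1 * u1 = 0" "w1 * u2 = 0" "w2 * u1 = 0" "w2 * u2 = 0"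
    using * 1 2 by blast+
  then have "c' = 0" unfolding ce s by (simp add: m4_zero)
  then show ?thesis unfolding defs by (simp add: cj_eq_zero[OF PQ(1)])
qed

text \<open>On vectors fixed by p the matrices I, J, K act as quaternion units. A relation between
  v, I v, J v, K v says that a quaternion kills v \<noteq> 0, so its norm is zero.\<close>

lemma quaternion_span:
  fixes I J K p :: "real^4^4"
  assumes sq: "I ** I = - p" "J ** J = - p" "K ** K = - p"
    and pr: "I ** J = K" "J ** I = - K" "J ** K = I" "K ** J = - I" "K ** I = J" "I ** K = - J"
    and v: "p *v v = v" "v \<noteq> 0"
  obtains a b c d where "w = a *s v + b *s (I *v v) + c *s (J *v v) + d *s (K *v v)"
proof -
  have neg: "(- A) *v x = - (A *v x)" for A :: "real^4^4" and x
    by (simp add: vec_eq_iff matrix_vector_mult_def sum_negf)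
  have act: "I *v (I *v v) = - v" "J *v (J *v v) = - v" "K *v (K *v v) = - v" "I *v (J *v v) = K *v v"
    "J *v (I *v v) = - (K *v v)" "J *v (K *v v) = I *v v" "K *v (J *v v) = - (I *v v)"
    "K *v (I *v v) = J *v v" "I *v (K *v v) = - (J *v v)"
    using sq pr v by (simp_all add: matrix_vector_mul_assoc neg)
  have ind: "a = 0 \<and> b = 0 \<and> c = 0 \<and> d = 0"
    if 0: "a *s v + b *s (I *v v) + c *s (J *v v) + d *s (K *v v) = 0" for a b c d
  proof -
    let ?s = "a *s v + b *s (I *v v) + c *s (J *v v) + d *s (K *v v)"
    have s: "I *v ?s = a *s (I *v v) + b *s (- v) + c *s (K *v v) + d *s (- (J *v v))"
      "J *v ?s = a *s (J *v v) + b *s (- (K *v v)) + c *s (- v) + d *s (I *v v)"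
      "K *v ?s = a *s (K *v v) + b *s (J *v v) + c *s (- (I *v v)) + d *s (- v)"
      unfolding matrix_vector_right_distrib matrix_vector_smult act by simp_all
    \<comment> \<open>Application of the conjugate quaternion.\<close>
    have "a *s ?s - b *s (I *v ?s) - c *s (J *v ?s) - d *s (K *v ?s) = (a*a + b*b + c*c + d*d) *s v"
      unfolding s by (simp add: vec_eq_iff algebra_simps)
    then have "(a*a + b*b + c*c + d*d) *s v = 0" unfolding 0 by simp
    then have "a*a + b*b + c*c + d*d = 0" using v(2) by (metis vec.scale_eq_0_iff)
    then show ?thesis
      by (smt (verit) mult_eq_0_iff not_square_less_zero)
  qed
  show ?thesis using col4_invertible[OF ind] that by metis
qed

section \<open>Faithful representations in coordinates\<close>

lemma mat_of_rows_list_carrier: "length xss = n \<Longrightarrow> mat_of_rows_list n xss \<in> carrier_mat n n"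
  by (simp add: mat_of_rows_list_def)

lemma mat_of_rows_list_eq_iff:
  assumes "length xss = n" "length yss = n" "list_all (\<lambda>r. length r = n) xss" "list_all (\<lambda>r. length r = n) yss"
  shows "mat_of_rows_list n xss = mat_of_rows_list n yss \<longleftrightarrow> xss = yss"
proof
  assume eq: "mat_of_rows_list n xss = mat_of_rows_list n yss"
  have "xss ! i ! j = yss ! i ! j" if "i < n" "j < n" for i j
    using arg_cong[OF eq, of "\<lambda>M. M $$ (i, j)"] that assms by (simp add: mat_of_rows_list_def)
  then show "xss = yss"
    using assms by (intro nth_equalityI) (auto simp: list_all_length intro!: nth_equalityI)
qed simp

lemma mat_of_rows_list_add:
  assumes "length xss = n" "length yss = n" "list_all (\<lambda>r. length r = n) xss" "list_all (\<lambda>r. length r = n) yss"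
  shows "mat_of_rows_list n xss + mat_of_rows_list n yss = mat_of_rows_list n (map2 (map2 (+)) xss yss)"
    "mat_of_rows_list n xss - mat_of_rows_list n yss = mat_of_rows_list n (map2 (map2 (-)) xss (yss :: 'a::ab_group_add list list))"
  using assms by (auto simp: mat_of_rows_list_def list_all_length intro!: eq_matI)

lemma mat_of_rows_list_smult:
  assumes "length xss = n" "list_all (\<lambda>r. length r = n) xss"
  shows "t \<cdot>\<^sub>m mat_of_rows_list n xss = mat_of_rows_list n (map (map ((*) t)) xss)"
  using assms by (auto simp: mat_of_rows_list_def list_all_length intro!: eq_matI)

lemma mat_of_rows_list_mult:
  assumes "length xss = n" "length yss = n" "list_all (\<lambda>r. length r = n) xss" "list_all (\<lambda>r. length r = n) yss"
  shows "mat_of_rows_list n xss * mat_of_rows_list n yss =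
    mat_of_rows_list n (map (\<lambda>r. map (\<lambda>j. sum_list (map2 (\<lambda>x s. x * s ! j) r yss)) [0..<n]) xss)"
proof (rule eq_matI)
  fix i j assume "i < dim_row (mat_of_rows_list n (map (\<lambda>r. map (\<lambda>j. sum_list (map2 (\<lambda>x s. x * s ! j) r yss)) [0..<n]) xss))"
    "j < dim_col (mat_of_rows_list n (map (\<lambda>r. map (\<lambda>j. sum_list (map2 (\<lambda>x s. x * s ! j) r yss)) [0..<n]) xss))"
  then have ij: "i < n" "j < n" using assms by (simp_all add: mat_of_rows_list_def)
  have "length (xss ! i) = n" using assms ij by (simp add: list_all_length)
  then show "(mat_of_rows_list n xss * mat_of_rows_list n yss) $$ (i, j) =
    mat_of_rows_list n (map (\<lambda>r. map (\<lambda>j. sum_list (map2 (\<lambda>x s. x * s ! j) r yss)) [0..<n]) xss) $$ (i, j)"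
    using ij assms by (simp add: mat_of_rows_list_def scalar_prod_def sum_list_sum_nth)
qed (use assms in \<open>simp_all add: mat_of_rows_list_def\<close>)

lemmas rows_simps = mat_of_rows_list_add mat_of_rows_list_smult mat_of_rows_list_mult mat_of_rows_list_eq_iff

lemmas linear_simps = rows_simps algebra_simps add_divide_distrib

lemma upt_small: "[0..<4] = [0, 1, 2, 3]" "[0..<5] = [0, 1, 2, 3, 4]" "[0..<6] = [0, 1, 2, 3, 4, 5]"
  by (simp_all add: upt_rec)

section \<open>Linear parametrizations by eight real numbers\<close>

definition lin8 :: "'v::real_vector \<Rightarrow> 'v \<Rightarrow> 'v \<Rightarrow> 'v \<Rightarrow> 'v \<Rightarrow> 'v \<Rightarrow> 'v \<Rightarrow> 'v \<Rightarrow>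
    real \<Rightarrow> real \<Rightarrow> real \<Rightarrow> real \<Rightarrow> real \<Rightarrow> real \<Rightarrow> real \<Rightarrow> real \<Rightarrow> 'v" where
  "lin8 A B C D E F G H a b c d e f g h =
     a *\<^sub>R A + b *\<^sub>R B + c *\<^sub>R C + d *\<^sub>R D + e *\<^sub>R E + f *\<^sub>R F + g *\<^sub>R G + h *\<^sub>R H"

text \<open>The last clause compares only with the zero parameters; together with linearity this is
  injectivity of the parametrization.\<close>

definition linear_param8 :: "(real \<Rightarrow> real \<Rightarrow> real \<Rightarrow> real \<Rightarrow> real \<Rightarrow> real \<Rightarrow> real \<Rightarrow> real \<Rightarrow> real mat) \<Rightarrow> bool" where
  "linear_param8 m \<longleftrightarrow>
    (\<forall>a b c d e f g h a' b' c' d' e' f' g' h'. m a b c d e f g h + m a' b' c' d' e' f' g' h' =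
       m (a + a') (b + b') (c + c') (d + d') (e + e') (f + f') (g + g') (h + h')) \<and>
    (\<forall>t a b c d e f g h. t \<cdot>\<^sub>m m a b c d e f g h = m (t * a) (t * b) (t * c) (t * d) (t * e) (t * f) (t * g) (t * h)) \<and>
    (\<forall>a b c d e f g h. m a b c d e f g h = m 0 0 0 0 0 0 0 0 \<longrightarrow>
       a = 0 \<and> b = 0 \<and> c = 0 \<and> d = 0 \<and> e = 0 \<and> f = 0 \<and> g = 0 \<and> h = 0)"

lemma linear_param8I:
  assumes "\<And>a b c d e f g h a' b' c' d' e' f' g' h'. m a b c d e f g h + m a' b' c' d' e' f' g' h' =
       m (a + a') (b + b') (c + c') (d + d') (e + e') (f + f') (g + g') (h + h')"
    and "\<And>t a b c d e f g h. t \<cdot>\<^sub>m m a b c d e f g h = m (t * a) (t * b) (t * c) (t * d) (t * e) (t * f) (t * g) (t * h)"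
    and "\<And>a b c d e f g h. m a b c d e f g h = m 0 0 0 0 0 0 0 0 \<Longrightarrow>
       a = 0 \<and> b = 0 \<and> c = 0 \<and> d = 0 \<and> e = 0 \<and> f = 0 \<and> g = 0 \<and> h = 0"
  shows "linear_param8 m"
  unfolding linear_param8_def using assms by simp

definition indep8 :: "'v::real_vector \<Rightarrow> 'v \<Rightarrow> 'v \<Rightarrow> 'v \<Rightarrow> 'v \<Rightarrow> 'v \<Rightarrow> 'v \<Rightarrow> 'v \<Rightarrow> bool" where
  "indep8 A B C D E F G H \<longleftrightarrow> (\<forall>a b c d e f g h. lin8 A B C D E F G H a b c d e f g h = 0 \<longrightarrow>
     a = 0 \<and> b = 0 \<and> c = 0 \<and> d = 0 \<and> e = 0 \<and> f = 0 \<and> g = 0 \<and> h = 0)"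

lemma indep8D:
  assumes "indep8 A B C D E F G H"
    "a *\<^sub>R A + b *\<^sub>R B + c *\<^sub>R C + d *\<^sub>R D + e *\<^sub>R E + f *\<^sub>R F + g *\<^sub>R G + h *\<^sub>R H = 0"
  shows "a = 0 \<and> b = 0 \<and> c = 0 \<and> d = 0 \<and> e = 0 \<and> f = 0 \<and> g = 0 \<and> h = 0"
  using assms unfolding indep8_def lin8_def by blast

text \<open>Transports structure constants: a bracket computed once in the defining matrices holds
  for the eight images in size four, which stay independent. The last conclusion is what padding
  remembers of N < 4, namely a zero last row and column.\<close>

lemma faithful_basis:
  fixes m :: "real \<Rightarrow> real \<Rightarrow> real \<Rightarrow> real \<Rightarrow> real \<Rightarrow> real \<Rightarrow> real \<Rightarrow> real \<Rightarrow> real mat"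
  assumes rep: "faithful_representation L N \<phi>" and N: "N \<le> 4"
    and L: "L = {m a b c d e f g h | a b c d e f g h. True}" and m: "linear_param8 m"
  obtains A B C D E F G H :: "real^4^4" where
    "indep8 A B C D E F G H"
    "\<And>a b c d e f g h a' b' c' d' e' f' g' h' k1 k2 k3 k4 k5 k6 k7 k8.
       commutator (m a b c d e f g h) (m a' b' c' d' e' f' g' h') = m k1 k2 k3 k4 k5 k6 k7 k8 \<Longrightarrow>
       cm (lin8 A B C D E F G H a b c d e f g h) (lin8 A B C D E F G H a' b' c' d' e' f' g' h') =
       lin8 A B C D E F G H k1 k2 k3 k4 k5 k6 k7 k8"
    "N < 4 \<longrightarrow> (\<forall>M\<in>{A, B, C, D, E, F, G, H}. M *v axis 4 1 = 0 \<and> axis 4 1 v* M = 0)"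
proof -
  have in_L: "m a b c d e f g h \<in> L" for a b c d e f g h using L by blast
  have car: "\<phi> x \<in> carrier_mat N N" if "x \<in> L" for x
    using rep that unfolding faithful_representation_def lie_representation_def by blast
  have add: "\<phi> (x + y) = \<phi> x + \<phi> y" and comm: "\<phi> (commutator x y) = commutator (\<phi> x) (\<phi> y)" if "x \<in> L" "y \<in> L" for x y
    using rep that unfolding faithful_representation_def lie_representation_def by blast+
  have smult: "\<phi> (t \<cdot>\<^sub>m x) = t \<cdot>\<^sub>m \<phi> x" if "x \<in> L" for x t
    using rep that unfolding faithful_representation_def lie_representation_def by blast
  have inj: "inj_on \<phi> L" using rep unfolding faithful_representation_def by blast
  define T where "T a b c d e f g h = pad N (\<phi> (m a b c d e f g h))" for a b c d e f g h
  have madd: "m a b c d e f g h + m a' b' c' d' e' f' g' h' =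
       m (a + a') (b + b') (c + c') (d + d') (e + e') (f + f') (g + g') (h + h')" for a b c d e f g h a' b' c' d' e' f' g' h'
    using m unfolding linear_param8_def by simp
  have msmult: "t \<cdot>\<^sub>m m a b c d e f g h = m (t * a) (t * b) (t * c) (t * d) (t * e) (t * f) (t * g) (t * h)"
    for t a b c d e f g h using m unfolding linear_param8_def by simp
  have Tadd: "T a b c d e f g h + T a' b' c' d' e' f' g' h' =
       T (a + a') (b + b') (c + c') (d + d') (e + e') (f + f') (g + g') (h + h')" for a b c d e f g h a' b' c' d' e' f' g' h'
    unfolding T_def madd[symmetric] add[OF in_L in_L] pad_linear(1)[OF car[OF in_L] car[OF in_L]] ..
  have Tsmult: "t *\<^sub>R T a b c d e f g h = T (t * a) (t * b) (t * c) (t * d) (t * e) (t * f) (t * g) (t * h)"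
    for t a b c d e f g h
    unfolding T_def msmult[symmetric] smult[OF in_L] pad_linear(3)[OF car[OF in_L] car[OF in_L]] ..
  define A B C D E F G H where "A = T 1 0 0 0 0 0 0 0" and "B = T 0 1 0 0 0 0 0 0" and "C = T 0 0 1 0 0 0 0 0"
    and "D = T 0 0 0 1 0 0 0 0" and "E = T 0 0 0 0 1 0 0 0" and "F = T 0 0 0 0 0 1 0 0" and "G = T 0 0 0 0 0 0 1 0"
    and "H = T 0 0 0 0 0 0 0 1"
  have lin: "lin8 A B C D E F G H a b c d e f g h = T a b c d e f g h" for a b c d e f g h
    by (simp add: lin8_def A_def B_def C_def D_def E_def F_def G_def H_def Tsmult Tadd)
  have Tcm: "cm (T a b c d e f g h) (T a' b' c' d' e' f' g' h') = pad N (\<phi> (commutator (m a b c d e f g h) (m a' b' c' d' e' f' g' h')))"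
    for a b c d e f g h a' b' c' d' e' f' g' h'
  proof -
    note c = car[OF in_L, of a b c d e f g h] car[OF in_L, of a' b' c' d' e' f' g' h']
    show ?thesis
      unfolding T_def comm[OF in_L in_L]
      unfolding commutator_def cm_def
      using c by (simp add: pad_linear(2)[of _ N] pad_mult[OF N])
  qed
  show ?thesis
  proof (rule that[of A B C D E F G H])
    show "indep8 A B C D E F G H"
      unfolding indep8_def
    proof (intro allI impI)
    fix a b c d e f g h assume "lin8 A B C D E F G H a b c d e f g h = 0"
    moreover have "T 0 0 0 0 0 0 0 0 = 0" unfolding lin[symmetric] by (simp add: lin8_def)
    ultimately have "T a b c d e f g h = T 0 0 0 0 0 0 0 0" unfolding lin by simp
    then have "m a b c d e f g h = m 0 0 0 0 0 0 0 0"
      unfolding T_def by (intro inj_onD[OF inj _ in_L in_L] pad_inj[OF N car[OF in_L] car[OF in_L]])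
    then show "a = 0 \<and> b = 0 \<and> c = 0 \<and> d = 0 \<and> e = 0 \<and> f = 0 \<and> g = 0 \<and> h = 0"
      using m unfolding linear_param8_def by blast
    qed
  next
    fix a b c d e f g h a' b' c' d' e' f' g' h' k1 k2 k3 k4 k5 k6 k7 k8
    assume k: "commutator (m a b c d e f g h) (m a' b' c' d' e' f' g' h') = m k1 k2 k3 k4 k5 k6 k7 k8"
    show "cm (lin8 A B C D E F G H a b c d e f g h) (lin8 A B C D E F G H a' b' c' d' e' f' g' h') =
       lin8 A B C D E F G H k1 k2 k3 k4 k5 k6 k7 k8"
      unfolding lin Tcm k unfolding T_def ..
  next
    show "N < 4 \<longrightarrow> (\<forall>M\<in>{A, B, C, D, E, F, G, H}. M *v axis 4 1 = 0 \<and> axis 4 1 v* M = 0)"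
    proof (intro impI ballI)
      fix M assume N3: "N < 4" and "M \<in> {A, B, C, D, E, F, G, H}"
      then obtain x where "M = pad N x" unfolding A_def B_def C_def D_def E_def F_def G_def H_def T_def by blast
      with N3 show "M *v axis 4 1 = 0 \<and> axis 4 1 v* M = 0"
        by (simp add: pad_def Let_def vec_eq_iff forall_4 matrix_vector_mult_def vector_matrix_mult_def sum_4 axis_def distinct_4)
    qed
  qed
qed

section \<open>Bounds for \<open>mu\<close>\<close>

lemma faithful_identity:
  assumes "L \<subseteq> carrier_mat n n"
  shows "faithful_representation L n (\<lambda>x. x)"
  using assms unfolding faithful_representation_def lie_representation_def by auto

text \<open>The first hypothesis ensures that the \<open>LEAST\<close> in \<open>mu\<close> is
  attained; only then does excluding all N \<le> 4 bound it.\<close>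

lemma mu_greaterI:
  assumes "faithful_representation L n \<phi>" "\<And>N \<phi>. N \<le> 4 \<Longrightarrow> faithful_representation L N \<phi> \<Longrightarrow> False"
  shows "mu L > 4"
proof -
  have "\<exists>\<phi>. faithful_representation L (mu L) \<phi>"
    unfolding mu_def by (rule LeastI[of _ n]) (use assms(1) in blast)
  then show ?thesis using assms(2) by (meson not_le)
qed

lemma mu_eqI:
  assumes "faithful_representation L 4 \<phi>" "\<And>N \<phi>. N < 4 \<Longrightarrow> faithful_representation L N \<phi> \<Longrightarrow> False"
  shows "mu L = 4"
  unfolding mu_def by (rule Least_equality) (use assms in \<open>auto simp: not_le[symmetric]\<close>)

section \<open>Complexification of real matrices\<close>

definition cpx :: "real^4^4 \<Rightarrow> real^4^4 \<Rightarrow> complex^4^4" where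
  "cpx A B = (\<chi> i j. Complex (A$i$j) (B$i$j))"

lemma cpx_simps:
  "cpx A B + cpx C D = cpx (A + C) (B + D)" "cpx A B - cpx C D = cpx (A - C) (B - D)" "- cpx A B = cpx (- A) (- B)"
  "r *\<^sub>R cpx A B = cpx (r *\<^sub>R A) (r *\<^sub>R B)" "cpx A B = cpx C D \<longleftrightarrow> A = C \<and> B = D" "cpx 0 0 = 0"
  "cpx A B = 0 \<longleftrightarrow> A = 0 \<and> B = 0" "cpx (mat 1) 0 = mat 1"
  by (auto simp: cpx_def vec_eq_iff complex_eq_iff mat_def)

lemma cpx_mult: "cpx A B ** cpx C D = cpx (A ** C - B ** D) (A ** D + B ** C)"
  by (simp add: cpx_def vec_eq_iff complex_eq_iff matrix_matrix_mult_def sum_4)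

lemma cpx_cm: "cm (cpx A B) (cpx C D) = cpx (cm A C - cm B D) (cm A D + cm B C)"
  by (simp add: cm_def cpx_mult cpx_simps)

text \<open>The ladder operators: bracketing with i C rotates the plane of A and B, with
  eigenvectors A + i B and -A + i B for the eigenvalues 1 and -1. The factor 2 gives the weights 2
  and -2.\<close>

lemma so3_sl2_triple:
  fixes A B C :: "real^4^4"
  assumes "cm A B = C" "cm B C = A" "cm C A = B"
  shows "sl2_triple (cpx 0 (2 *\<^sub>R C)) (cpx A B) (cpx (- A) B)"
proof -
  have "cm B A = - C" "cm C B = - A" "cm A C = - B" using assms unfolding cm_def by (metis minus_diff_eq)+
  with assms show ?thesis
    by (simp add: sl2_triple_def cpx_cm cpx_simps cm_scaleR cm_add) (simp add: vec_eq_iff)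
qed

section \<open>Brackets of the algebras\<close>

text \<open>As in the lemmas for the other algebras, only the brackets that enter the later
  contradiction are recorded, with the signs and factors of the given matrices.\<close>

lemma L8_1_basis:
  assumes "faithful_representation (L8_1 p) N \<phi>" "N \<le> 4" "p \<noteq> 0"
  obtains A B C D E F G H :: "real^4^4" where
    "indep8 A B C D E F G H"
    "cm A B = - C" "cm B C = - A" "cm C A = - B" "cm C D = - E" "cm C E = D" "cm A H = 0" "cm B H = 0"
    "cm C H = 0" "cm A G = 0" "cm B G = 0" "cm C G = 0" "cm H D = D" "cm H E = E" "cm G D = 0" "cm G E = 0"
    "cm H G = p *\<^sub>R G"
  apply (rule faithful_basis[OF assms(1,2) L8_1_def])
  subgoal premises
    apply (rule linear_param8I, simp add: linear_simps, simp add: linear_simps)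
    \<comment> \<open>The parameter \<open>g\<close> occurs only in the entry \<open>p * g\<close>,
      from which it is recovered for \<open>p \<noteq> 0\<close>.\<close>
    using assms(3) by (auto simp: rows_simps)
  subgoal premises prems for A B C D E F G H
  proof -
    let ?L = "lin8 A B C D E F G H"
    have "cm (?L 1 0 0 0 0 0 0 0) (?L 0 1 0 0 0 0 0 0) = ?L 0 0 (-1) 0 0 0 0 0"
      "cm (?L 0 1 0 0 0 0 0 0) (?L 0 0 1 0 0 0 0 0) = ?L (-1) 0 0 0 0 0 0 0"
      "cm (?L 0 0 1 0 0 0 0 0) (?L 1 0 0 0 0 0 0 0) = ?L 0 (-1) 0 0 0 0 0 0"
      "cm (?L 0 0 1 0 0 0 0 0) (?L 0 0 0 1 0 0 0 0) = ?L 0 0 0 0 (-1) 0 0 0"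
      "cm (?L 0 0 1 0 0 0 0 0) (?L 0 0 0 0 1 0 0 0) = ?L 0 0 0 1 0 0 0 0"
      "cm (?L 1 0 0 0 0 0 0 0) (?L 0 0 0 0 0 0 0 1) = ?L 0 0 0 0 0 0 0 0"
      "cm (?L 0 1 0 0 0 0 0 0) (?L 0 0 0 0 0 0 0 1) = ?L 0 0 0 0 0 0 0 0"
      "cm (?L 0 0 1 0 0 0 0 0) (?L 0 0 0 0 0 0 0 1) = ?L 0 0 0 0 0 0 0 0"
      "cm (?L 1 0 0 0 0 0 0 0) (?L 0 0 0 0 0 0 1 0) = ?L 0 0 0 0 0 0 0 0"
      "cm (?L 0 1 0 0 0 0 0 0) (?L 0 0 0 0 0 0 1 0) = ?L 0 0 0 0 0 0 0 0"
      "cm (?L 0 0 1 0 0 0 0 0) (?L 0 0 0 0 0 0 1 0) = ?L 0 0 0 0 0 0 0 0"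
      "cm (?L 0 0 0 0 0 0 0 1) (?L 0 0 0 1 0 0 0 0) = ?L 0 0 0 1 0 0 0 0"
      "cm (?L 0 0 0 0 0 0 0 1) (?L 0 0 0 0 1 0 0 0) = ?L 0 0 0 0 1 0 0 0"
      "cm (?L 0 0 0 0 0 0 1 0) (?L 0 0 0 1 0 0 0 0) = ?L 0 0 0 0 0 0 0 0"
      "cm (?L 0 0 0 0 0 0 1 0) (?L 0 0 0 0 1 0 0 0) = ?L 0 0 0 0 0 0 0 0"
      "cm (?L 0 0 0 0 0 0 0 1) (?L 0 0 0 0 0 0 1 0) = ?L 0 0 0 0 0 0 p 0"
      by (rule prems(3), simp add: commutator_def rows_simps upt_small)+
    then show thesis
      by (intro that[OF prems(2)]) (simp_all add: lin8_def)
  qed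
  done

lemma L8_2_basis:
  assumes "faithful_representation L8_2 N \<phi>" "N \<le> 4"
  obtains A B C D E F G H :: "real^4^4" where
    "indep8 A B C D E F G H"
    "cm A B = 2 *\<^sub>R C" "cm B C = 2 *\<^sub>R A" "cm C A = 2 *\<^sub>R B" "cm C D = - F" "cm C F = D"
  apply (rule faithful_basis[OF assms(1,2) L8_2_def])
  subgoal premises
    by (rule linear_param8I, simp add: linear_simps, simp add: linear_simps)
      (auto simp: rows_simps)
  subgoal premises prems for A B C D E F G H
  proof -
    let ?L = "lin8 A B C D E F G H"
    have "cm (?L 1 0 0 0 0 0 0 0) (?L 0 1 0 0 0 0 0 0) = ?L 0 0 2 0 0 0 0 0"
      "cm (?L 0 1 0 0 0 0 0 0) (?L 0 0 1 0 0 0 0 0) = ?L 2 0 0 0 0 0 0 0"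
      "cm (?L 0 0 1 0 0 0 0 0) (?L 1 0 0 0 0 0 0 0) = ?L 0 2 0 0 0 0 0 0"
      "cm (?L 0 0 1 0 0 0 0 0) (?L 0 0 0 1 0 0 0 0) = ?L 0 0 0 0 0 (-1) 0 0"
      "cm (?L 0 0 1 0 0 0 0 0) (?L 0 0 0 0 0 1 0 0) = ?L 0 0 0 1 0 0 0 0"
      by (rule prems(3), simp add: commutator_def rows_simps upt_small)+
    then show thesis
      by (intro that[OF prems(2)]) (simp_all add: lin8_def)
  qed
  done

lemma L8_3_basis:
  assumes "faithful_representation L8_3 N \<phi>" "N \<le> 4"
  obtains A B C D E F G H :: "real^4^4" where
    "indep8 A B C D E F G H"
    "cm A B = C" "cm B C = A" "cm C A = B" "cm C D = (1/2) *\<^sub>R F" "cm C F = (-1/2) *\<^sub>R D"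
  apply (rule faithful_basis[OF assms(1,2) L8_3_def])
  subgoal premises
    by (rule linear_param8I, simp add: linear_simps, simp add: linear_simps)
      (auto simp: rows_simps)
  subgoal premises prems for A B C D E F G H
  proof -
    let ?L = "lin8 A B C D E F G H"
    have "cm (?L 1 0 0 0 0 0 0 0) (?L 0 1 0 0 0 0 0 0) = ?L 0 0 1 0 0 0 0 0"
      "cm (?L 0 1 0 0 0 0 0 0) (?L 0 0 1 0 0 0 0 0) = ?L 1 0 0 0 0 0 0 0"
      "cm (?L 0 0 1 0 0 0 0 0) (?L 1 0 0 0 0 0 0 0) = ?L 0 1 0 0 0 0 0 0"
      "cm (?L 0 0 1 0 0 0 0 0) (?L 0 0 0 1 0 0 0 0) = ?L 0 0 0 0 0 (1/2) 0 0"
      "cm (?L 0 0 1 0 0 0 0 0) (?L 0 0 0 0 0 1 0 0) = ?L 0 0 0 (-1/2) 0 0 0 0"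
      by (rule prems(3), simp add: commutator_def rows_simps upt_small)+
    then show thesis
      by (intro that[OF prems(2)]) (simp_all add: lin8_def)
  qed
  done

lemma L8_4_basis:
  assumes "faithful_representation (L8_4 p) N \<phi>" "N \<le> 4"
  obtains A B C D E F G H :: "real^4^4" where
    "indep8 A B C D E F G H"
    "cm A B = (-2) *\<^sub>R C" "cm B C = (-2) *\<^sub>R A" "cm C A = (-2) *\<^sub>R B" "cm C D = - F"
    "cm C F = D"
  apply (rule faithful_basis[OF assms(1,2) L8_4_def])
  subgoal premises
    apply (rule linear_param8I, simp add: linear_simps, simp add: linear_simps)
    by (drule mat_of_rows_list_eq_iff[THEN iffD1, rotated 4], simp, simp, simp, simp, simp only: list.inject)
      (smt (verit))
  subgoal premises prems for A B C D E F G H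
  proof -
    let ?L = "lin8 A B C D E F G H"
    have "cm (?L 1 0 0 0 0 0 0 0) (?L 0 1 0 0 0 0 0 0) = ?L 0 0 (-2) 0 0 0 0 0"
      "cm (?L 0 1 0 0 0 0 0 0) (?L 0 0 1 0 0 0 0 0) = ?L (-2) 0 0 0 0 0 0 0"
      "cm (?L 0 0 1 0 0 0 0 0) (?L 1 0 0 0 0 0 0 0) = ?L 0 (-2) 0 0 0 0 0 0"
      "cm (?L 0 0 1 0 0 0 0 0) (?L 0 0 0 1 0 0 0 0) = ?L 0 0 0 0 0 (-1) 0 0"
      "cm (?L 0 0 1 0 0 0 0 0) (?L 0 0 0 0 0 1 0 0) = ?L 0 0 0 1 0 0 0 0"
      by (rule prems(3), simp add: commutator_def rows_simps upt_small)+
    then show thesis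
      by (intro that[OF prems(2)]) (simp_all add: lin8_def)
  qed
  done

lemma L8_5_basis:
  assumes "faithful_representation L8_5 N \<phi>" "N \<le> 4"
  obtains A B C D E F G H :: "real^4^4" where
    "indep8 A B C D E F G H"
    "cm A B = (-4) *\<^sub>R C" "cm B C = - A" "cm C A = - B" "cm C D = (-2) *\<^sub>R E"
    "cm C E = 2 *\<^sub>R D" "cm A D = - G" "cm A E = F" "cm B D = - F" "cm B E = - G" "cm D E = 0"
  apply (rule faithful_basis[OF assms(1,2) L8_5_def])
  subgoal premises
    by (rule linear_param8I, simp add: linear_simps, simp add: linear_simps)
      (auto simp: rows_simps)
  subgoal premises prems for A B C D E F G H
  proof -
    let ?L = "lin8 A B C D E F G H"
    have "cm (?L 1 0 0 0 0 0 0 0) (?L 0 1 0 0 0 0 0 0) = ?L 0 0 (-4) 0 0 0 0 0"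
      "cm (?L 0 1 0 0 0 0 0 0) (?L 0 0 1 0 0 0 0 0) = ?L (-1) 0 0 0 0 0 0 0"
      "cm (?L 0 0 1 0 0 0 0 0) (?L 1 0 0 0 0 0 0 0) = ?L 0 (-1) 0 0 0 0 0 0"
      "cm (?L 0 0 1 0 0 0 0 0) (?L 0 0 0 1 0 0 0 0) = ?L 0 0 0 0 (-2) 0 0 0"
      "cm (?L 0 0 1 0 0 0 0 0) (?L 0 0 0 0 1 0 0 0) = ?L 0 0 0 2 0 0 0 0"
      "cm (?L 1 0 0 0 0 0 0 0) (?L 0 0 0 1 0 0 0 0) = ?L 0 0 0 0 0 0 (-1) 0"
      "cm (?L 1 0 0 0 0 0 0 0) (?L 0 0 0 0 1 0 0 0) = ?L 0 0 0 0 0 1 0 0"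
      "cm (?L 0 1 0 0 0 0 0 0) (?L 0 0 0 1 0 0 0 0) = ?L 0 0 0 0 0 (-1) 0 0"
      "cm (?L 0 1 0 0 0 0 0 0) (?L 0 0 0 0 1 0 0 0) = ?L 0 0 0 0 0 0 (-1) 0"
      "cm (?L 0 0 0 1 0 0 0 0) (?L 0 0 0 0 1 0 0 0) = ?L 0 0 0 0 0 0 0 0"
      by (rule prems(3), simp add: commutator_def rows_simps upt_small)+
    then show thesis
      by (intro that[OF prems(2)]) (simp_all add: lin8_def)
  qed
  done

lemma L8_6_basis:
  assumes "faithful_representation L8_6 N \<phi>" "N \<le> 4"
  obtains A B C D E F G H :: "real^4^4" where
    "indep8 A B C D E F G H"
    "cm A B = 2 *\<^sub>R B" "cm A C = (-2) *\<^sub>R C" "cm B C = A" "cm A D = D" "cm C D = E"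
    "cm D E = (-2) *\<^sub>R H" "cm H D = 0" "cm A F = 0" "cm B F = 0" "cm F D = 0" "cm A G = 0" "cm B G = 0"
    "cm G D = 0" "cm F G = (-2) *\<^sub>R H"
  apply (rule faithful_basis[OF assms(1,2) L8_6_def])
  subgoal premises
    by (rule linear_param8I, simp add: linear_simps, simp add: linear_simps)
      (auto simp: rows_simps)
  subgoal premises prems for A B C D E F G H
  proof -
    let ?L = "lin8 A B C D E F G H"
    have "cm (?L 1 0 0 0 0 0 0 0) (?L 0 1 0 0 0 0 0 0) = ?L 0 2 0 0 0 0 0 0"
      "cm (?L 1 0 0 0 0 0 0 0) (?L 0 0 1 0 0 0 0 0) = ?L 0 0 (-2) 0 0 0 0 0"
      "cm (?L 0 1 0 0 0 0 0 0) (?L 0 0 1 0 0 0 0 0) = ?L 1 0 0 0 0 0 0 0"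
      "cm (?L 1 0 0 0 0 0 0 0) (?L 0 0 0 1 0 0 0 0) = ?L 0 0 0 1 0 0 0 0"
      "cm (?L 0 0 1 0 0 0 0 0) (?L 0 0 0 1 0 0 0 0) = ?L 0 0 0 0 1 0 0 0"
      "cm (?L 0 0 0 1 0 0 0 0) (?L 0 0 0 0 1 0 0 0) = ?L 0 0 0 0 0 0 0 (-2)"
      "cm (?L 0 0 0 0 0 0 0 1) (?L 0 0 0 1 0 0 0 0) = ?L 0 0 0 0 0 0 0 0"
      "cm (?L 1 0 0 0 0 0 0 0) (?L 0 0 0 0 0 1 0 0) = ?L 0 0 0 0 0 0 0 0"
      "cm (?L 0 1 0 0 0 0 0 0) (?L 0 0 0 0 0 1 0 0) = ?L 0 0 0 0 0 0 0 0"
      "cm (?L 0 0 0 0 0 1 0 0) (?L 0 0 0 1 0 0 0 0) = ?L 0 0 0 0 0 0 0 0"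
      "cm (?L 1 0 0 0 0 0 0 0) (?L 0 0 0 0 0 0 1 0) = ?L 0 0 0 0 0 0 0 0"
      "cm (?L 0 1 0 0 0 0 0 0) (?L 0 0 0 0 0 0 1 0) = ?L 0 0 0 0 0 0 0 0"
      "cm (?L 0 0 0 0 0 0 1 0) (?L 0 0 0 1 0 0 0 0) = ?L 0 0 0 0 0 0 0 0"
      "cm (?L 0 0 0 0 0 1 0 0) (?L 0 0 0 0 0 0 1 0) = ?L 0 0 0 0 0 0 0 (-2)"
      by (rule prems(3), simp add: commutator_def rows_simps upt_small)+
    then show thesis
      by (intro that[OF prems(2)]) (simp_all add: lin8_def)
  qed
  done

lemma L8_7_basis:
  assumes "faithful_representation (L8_7 p q) N \<phi>" "N \<le> 4"
  obtains A B C D E F G H :: "real^4^4" where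
    "indep8 A B C D E F G H"
    "cm A B = 2 *\<^sub>R B" "cm A C = (-2) *\<^sub>R C" "cm B C = A" "cm A D = D" "cm A H = 0" "cm B H = 0"
    "cm A F = 0" "cm B F = 0" "cm A G = 0" "cm B G = 0" "cm H F = p *\<^sub>R F" "cm H G = q *\<^sub>R G"
    "cm F G = 0"
  apply (rule faithful_basis[OF assms(1,2) L8_7_def])
  subgoal premises
    by (rule linear_param8I, simp add: linear_simps, simp add: linear_simps)
      (auto simp: rows_simps)
  subgoal premises prems for A B C D E F G H
  proof -
    let ?L = "lin8 A B C D E F G H"
    have "cm (?L 1 0 0 0 0 0 0 0) (?L 0 1 0 0 0 0 0 0) = ?L 0 2 0 0 0 0 0 0"
      "cm (?L 1 0 0 0 0 0 0 0) (?L 0 0 1 0 0 0 0 0) = ?L 0 0 (-2) 0 0 0 0 0"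
      "cm (?L 0 1 0 0 0 0 0 0) (?L 0 0 1 0 0 0 0 0) = ?L 1 0 0 0 0 0 0 0"
      "cm (?L 1 0 0 0 0 0 0 0) (?L 0 0 0 1 0 0 0 0) = ?L 0 0 0 1 0 0 0 0"
      "cm (?L 1 0 0 0 0 0 0 0) (?L 0 0 0 0 0 0 0 1) = ?L 0 0 0 0 0 0 0 0"
      "cm (?L 0 1 0 0 0 0 0 0) (?L 0 0 0 0 0 0 0 1) = ?L 0 0 0 0 0 0 0 0"
      "cm (?L 1 0 0 0 0 0 0 0) (?L 0 0 0 0 0 1 0 0) = ?L 0 0 0 0 0 0 0 0"
      "cm (?L 0 1 0 0 0 0 0 0) (?L 0 0 0 0 0 1 0 0) = ?L 0 0 0 0 0 0 0 0"
      "cm (?L 1 0 0 0 0 0 0 0) (?L 0 0 0 0 0 0 1 0) = ?L 0 0 0 0 0 0 0 0"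
      "cm (?L 0 1 0 0 0 0 0 0) (?L 0 0 0 0 0 0 1 0) = ?L 0 0 0 0 0 0 0 0"
      "cm (?L 0 0 0 0 0 0 0 1) (?L 0 0 0 0 0 1 0 0) = ?L 0 0 0 0 0 p 0 0"
      "cm (?L 0 0 0 0 0 0 0 1) (?L 0 0 0 0 0 0 1 0) = ?L 0 0 0 0 0 0 q 0"
      "cm (?L 0 0 0 0 0 1 0 0) (?L 0 0 0 0 0 0 1 0) = ?L 0 0 0 0 0 0 0 0"
      by (rule prems(3), simp add: commutator_def rows_simps upt_small)+
    then show thesis
      by (intro that[OF prems(2)]) (simp_all add: lin8_def)
  qed
  done

lemma L8_8_basis:
  assumes "faithful_representation (L8_8 p) N \<phi>" "N \<le> 4"
  obtains A B C D E F G H :: "real^4^4" where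
    "indep8 A B C D E F G H"
    "cm A B = 2 *\<^sub>R B" "cm A C = (-2) *\<^sub>R C" "cm B C = A" "cm A D = D" "cm A H = 0" "cm B H = 0"
    "cm A F = 0" "cm B F = 0" "cm A G = 0" "cm B G = 0" "cm H F = p *\<^sub>R F" "cm H G = F + p *\<^sub>R G"
    "cm F G = 0" "cm G F = 0"
  apply (rule faithful_basis[OF assms(1,2) L8_8_def])
  subgoal premises
    by (rule linear_param8I, simp add: linear_simps, simp add: linear_simps)
      (auto simp: rows_simps)
  subgoal premises prems for A B C D E F G H
  proof -
    let ?L = "lin8 A B C D E F G H"
    have "cm (?L 1 0 0 0 0 0 0 0) (?L 0 1 0 0 0 0 0 0) = ?L 0 2 0 0 0 0 0 0"
      "cm (?L 1 0 0 0 0 0 0 0) (?L 0 0 1 0 0 0 0 0) = ?L 0 0 (-2) 0 0 0 0 0"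
      "cm (?L 0 1 0 0 0 0 0 0) (?L 0 0 1 0 0 0 0 0) = ?L 1 0 0 0 0 0 0 0"
      "cm (?L 1 0 0 0 0 0 0 0) (?L 0 0 0 1 0 0 0 0) = ?L 0 0 0 1 0 0 0 0"
      "cm (?L 1 0 0 0 0 0 0 0) (?L 0 0 0 0 0 0 0 1) = ?L 0 0 0 0 0 0 0 0"
      "cm (?L 0 1 0 0 0 0 0 0) (?L 0 0 0 0 0 0 0 1) = ?L 0 0 0 0 0 0 0 0"
      "cm (?L 1 0 0 0 0 0 0 0) (?L 0 0 0 0 0 1 0 0) = ?L 0 0 0 0 0 0 0 0"
      "cm (?L 0 1 0 0 0 0 0 0) (?L 0 0 0 0 0 1 0 0) = ?L 0 0 0 0 0 0 0 0"
      "cm (?L 1 0 0 0 0 0 0 0) (?L 0 0 0 0 0 0 1 0) = ?L 0 0 0 0 0 0 0 0"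
      "cm (?L 0 1 0 0 0 0 0 0) (?L 0 0 0 0 0 0 1 0) = ?L 0 0 0 0 0 0 0 0"
      "cm (?L 0 0 0 0 0 0 0 1) (?L 0 0 0 0 0 1 0 0) = ?L 0 0 0 0 0 p 0 0"
      "cm (?L 0 0 0 0 0 0 0 1) (?L 0 0 0 0 0 0 1 0) = ?L 0 0 0 0 0 1 p 0"
      "cm (?L 0 0 0 0 0 1 0 0) (?L 0 0 0 0 0 0 1 0) = ?L 0 0 0 0 0 0 0 0"
      "cm (?L 0 0 0 0 0 0 1 0) (?L 0 0 0 0 0 1 0 0) = ?L 0 0 0 0 0 0 0 0"
      by (rule prems(3), simp add: commutator_def rows_simps upt_small)+
    then show thesis
      by (intro that[OF prems(2)]) (simp_all add: lin8_def)
  qed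
  done

lemma L8_9_basis:
  assumes "faithful_representation (L8_9 p q) N \<phi>" "N \<le> 4"
  obtains A B C D E F G H :: "real^4^4" where
    "indep8 A B C D E F G H"
    "cm A B = 2 *\<^sub>R B" "cm A C = (-2) *\<^sub>R C" "cm B C = A" "cm A D = D" "cm A H = 0" "cm B H = 0"
    "cm A F = 0" "cm B F = 0" "cm A G = 0" "cm B G = 0" "cm H F = p *\<^sub>R F + (-q) *\<^sub>R G"
    "cm H G = q *\<^sub>R F + p *\<^sub>R G" "cm F G = 0"
  apply (rule faithful_basis[OF assms(1,2) L8_9_def])
  subgoal premises
    by (rule linear_param8I, simp add: linear_simps, simp add: linear_simps)
      (auto simp: rows_simps)
  subgoal premises prems for A B C D E F G H
  proof -
    let ?L = "lin8 A B C D E F G H"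
    have "cm (?L 1 0 0 0 0 0 0 0) (?L 0 1 0 0 0 0 0 0) = ?L 0 2 0 0 0 0 0 0"
      "cm (?L 1 0 0 0 0 0 0 0) (?L 0 0 1 0 0 0 0 0) = ?L 0 0 (-2) 0 0 0 0 0"
      "cm (?L 0 1 0 0 0 0 0 0) (?L 0 0 1 0 0 0 0 0) = ?L 1 0 0 0 0 0 0 0"
      "cm (?L 1 0 0 0 0 0 0 0) (?L 0 0 0 1 0 0 0 0) = ?L 0 0 0 1 0 0 0 0"
      "cm (?L 1 0 0 0 0 0 0 0) (?L 0 0 0 0 0 0 0 1) = ?L 0 0 0 0 0 0 0 0"
      "cm (?L 0 1 0 0 0 0 0 0) (?L 0 0 0 0 0 0 0 1) = ?L 0 0 0 0 0 0 0 0"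
      "cm (?L 1 0 0 0 0 0 0 0) (?L 0 0 0 0 0 1 0 0) = ?L 0 0 0 0 0 0 0 0"
      "cm (?L 0 1 0 0 0 0 0 0) (?L 0 0 0 0 0 1 0 0) = ?L 0 0 0 0 0 0 0 0"
      "cm (?L 1 0 0 0 0 0 0 0) (?L 0 0 0 0 0 0 1 0) = ?L 0 0 0 0 0 0 0 0"
      "cm (?L 0 1 0 0 0 0 0 0) (?L 0 0 0 0 0 0 1 0) = ?L 0 0 0 0 0 0 0 0"
      "cm (?L 0 0 0 0 0 0 0 1) (?L 0 0 0 0 0 1 0 0) = ?L 0 0 0 0 0 p (-q) 0"
      "cm (?L 0 0 0 0 0 0 0 1) (?L 0 0 0 0 0 0 1 0) = ?L 0 0 0 0 0 q p 0"
      "cm (?L 0 0 0 0 0 1 0 0) (?L 0 0 0 0 0 0 1 0) = ?L 0 0 0 0 0 0 0 0"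
      by (rule prems(3), simp add: commutator_def rows_simps upt_small)+
    then show thesis
      by (intro that[OF prems(2)]) (simp_all add: lin8_def)
  qed
  done

lemma L8_10_basis:
  assumes "faithful_representation (L8_10 p) N \<phi>" "N \<le> 4" "p \<noteq> 0"
  obtains A B C D E F G H :: "real^4^4" where
    "indep8 A B C D E F G H"
    "cm A B = 2 *\<^sub>R B" "cm A C = (-2) *\<^sub>R C" "cm B C = A" "cm A D = D" "cm C D = E"
    "cm D E = 2 *\<^sub>R F" "cm F D = 0" "cm A G = 0" "cm B G = 0" "cm G D = 0" "cm H G = p *\<^sub>R G"
  apply (rule faithful_basis[OF assms(1,2) L8_10_def])
  subgoal premises
    apply (rule linear_param8I, simp add: linear_simps, simp add: linear_simps)
    using assms(3) by (auto simp: rows_simps)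
  subgoal premises prems for A B C D E F G H
  proof -
    let ?L = "lin8 A B C D E F G H"
    have "cm (?L 1 0 0 0 0 0 0 0) (?L 0 1 0 0 0 0 0 0) = ?L 0 2 0 0 0 0 0 0"
      "cm (?L 1 0 0 0 0 0 0 0) (?L 0 0 1 0 0 0 0 0) = ?L 0 0 (-2) 0 0 0 0 0"
      "cm (?L 0 1 0 0 0 0 0 0) (?L 0 0 1 0 0 0 0 0) = ?L 1 0 0 0 0 0 0 0"
      "cm (?L 1 0 0 0 0 0 0 0) (?L 0 0 0 1 0 0 0 0) = ?L 0 0 0 1 0 0 0 0"
      "cm (?L 0 0 1 0 0 0 0 0) (?L 0 0 0 1 0 0 0 0) = ?L 0 0 0 0 1 0 0 0"
      "cm (?L 0 0 0 1 0 0 0 0) (?L 0 0 0 0 1 0 0 0) = ?L 0 0 0 0 0 2 0 0"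
      "cm (?L 0 0 0 0 0 1 0 0) (?L 0 0 0 1 0 0 0 0) = ?L 0 0 0 0 0 0 0 0"
      "cm (?L 1 0 0 0 0 0 0 0) (?L 0 0 0 0 0 0 1 0) = ?L 0 0 0 0 0 0 0 0"
      "cm (?L 0 1 0 0 0 0 0 0) (?L 0 0 0 0 0 0 1 0) = ?L 0 0 0 0 0 0 0 0"
      "cm (?L 0 0 0 0 0 0 1 0) (?L 0 0 0 1 0 0 0 0) = ?L 0 0 0 0 0 0 0 0"
      "cm (?L 0 0 0 0 0 0 0 1) (?L 0 0 0 0 0 0 1 0) = ?L 0 0 0 0 0 0 p 0"
      by (rule prems(3), simp add: commutator_def rows_simps upt_small)+
    then show thesis
      by (intro that[OF prems(2)]) (simp_all add: lin8_def)
  qed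
  done

lemma L8_11_basis:
  assumes "faithful_representation L8_11 N \<phi>" "N \<le> 4"
  obtains A B C D E F G H :: "real^4^4" where
    "indep8 A B C D E F G H"
    "cm A B = 2 *\<^sub>R B" "cm A C = (-2) *\<^sub>R C" "cm B C = A" "cm A D = D" "cm C D = E"
    "cm D E = 2 *\<^sub>R F" "cm F D = 0" "cm A G = 0" "cm B G = 0" "cm G D = 0" "cm H G = F + 2 *\<^sub>R G"
  apply (rule faithful_basis[OF assms(1,2) L8_11_def])
  subgoal premises
    by (rule linear_param8I, simp add: linear_simps, simp add: linear_simps)
      (auto simp: rows_simps)
  subgoal premises prems for A B C D E F G H
  proof -
    let ?L = "lin8 A B C D E F G H"
    have "cm (?L 1 0 0 0 0 0 0 0) (?L 0 1 0 0 0 0 0 0) = ?L 0 2 0 0 0 0 0 0"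
      "cm (?L 1 0 0 0 0 0 0 0) (?L 0 0 1 0 0 0 0 0) = ?L 0 0 (-2) 0 0 0 0 0"
      "cm (?L 0 1 0 0 0 0 0 0) (?L 0 0 1 0 0 0 0 0) = ?L 1 0 0 0 0 0 0 0"
      "cm (?L 1 0 0 0 0 0 0 0) (?L 0 0 0 1 0 0 0 0) = ?L 0 0 0 1 0 0 0 0"
      "cm (?L 0 0 1 0 0 0 0 0) (?L 0 0 0 1 0 0 0 0) = ?L 0 0 0 0 1 0 0 0"
      "cm (?L 0 0 0 1 0 0 0 0) (?L 0 0 0 0 1 0 0 0) = ?L 0 0 0 0 0 2 0 0"
      "cm (?L 0 0 0 0 0 1 0 0) (?L 0 0 0 1 0 0 0 0) = ?L 0 0 0 0 0 0 0 0"
      "cm (?L 1 0 0 0 0 0 0 0) (?L 0 0 0 0 0 0 1 0) = ?L 0 0 0 0 0 0 0 0"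
      "cm (?L 0 1 0 0 0 0 0 0) (?L 0 0 0 0 0 0 1 0) = ?L 0 0 0 0 0 0 0 0"
      "cm (?L 0 0 0 0 0 0 1 0) (?L 0 0 0 1 0 0 0 0) = ?L 0 0 0 0 0 0 0 0"
      "cm (?L 0 0 0 0 0 0 0 1) (?L 0 0 0 0 0 0 1 0) = ?L 0 0 0 0 0 1 2 0"
      by (rule prems(3), simp add: commutator_def rows_simps upt_small)+
    then show thesis
      by (intro that[OF prems(2)]) (simp_all add: lin8_def)
  qed
  done

lemma L8_12_basis:
  assumes "faithful_representation (L8_12 p) N \<phi>" "N \<le> 4"
  obtains A B C D E F G H :: "real^4^4" where
    "indep8 A B C D E F G H"
    "cm A B = 2 *\<^sub>R B" "cm A C = (-2) *\<^sub>R C" "cm B C = A" "cm A D = 2 *\<^sub>R D" "cm A H = 0"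
    "cm B H = 0" "cm C H = 0" "cm A G = 0" "cm B G = 0" "cm C G = 0" "cm H D = D" "cm G D = 0"
    "cm H G = p *\<^sub>R G"
    "N < 4 \<longrightarrow> (\<forall>M\<in>{A, B, C, D, E, F, G, H}. M *v axis 4 1 = 0 \<and> axis 4 1 v* M = 0)"
  apply (rule faithful_basis[OF assms(1,2) L8_12_def])
  subgoal premises
    by (rule linear_param8I, simp add: linear_simps, simp add: linear_simps)
      (auto simp: rows_simps)
  subgoal premises prems for A B C D E F G H
  proof -
    let ?L = "lin8 A B C D E F G H"
    have "cm (?L 1 0 0 0 0 0 0 0) (?L 0 1 0 0 0 0 0 0) = ?L 0 2 0 0 0 0 0 0"
      "cm (?L 1 0 0 0 0 0 0 0) (?L 0 0 1 0 0 0 0 0) = ?L 0 0 (-2) 0 0 0 0 0"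
      "cm (?L 0 1 0 0 0 0 0 0) (?L 0 0 1 0 0 0 0 0) = ?L 1 0 0 0 0 0 0 0"
      "cm (?L 1 0 0 0 0 0 0 0) (?L 0 0 0 1 0 0 0 0) = ?L 0 0 0 2 0 0 0 0"
      "cm (?L 1 0 0 0 0 0 0 0) (?L 0 0 0 0 0 0 0 1) = ?L 0 0 0 0 0 0 0 0"
      "cm (?L 0 1 0 0 0 0 0 0) (?L 0 0 0 0 0 0 0 1) = ?L 0 0 0 0 0 0 0 0"
      "cm (?L 0 0 1 0 0 0 0 0) (?L 0 0 0 0 0 0 0 1) = ?L 0 0 0 0 0 0 0 0"
      "cm (?L 1 0 0 0 0 0 0 0) (?L 0 0 0 0 0 0 1 0) = ?L 0 0 0 0 0 0 0 0"
      "cm (?L 0 1 0 0 0 0 0 0) (?L 0 0 0 0 0 0 1 0) = ?L 0 0 0 0 0 0 0 0"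
      "cm (?L 0 0 1 0 0 0 0 0) (?L 0 0 0 0 0 0 1 0) = ?L 0 0 0 0 0 0 0 0"
      "cm (?L 0 0 0 0 0 0 0 1) (?L 0 0 0 1 0 0 0 0) = ?L 0 0 0 1 0 0 0 0"
      "cm (?L 0 0 0 0 0 0 1 0) (?L 0 0 0 1 0 0 0 0) = ?L 0 0 0 0 0 0 0 0"
      "cm (?L 0 0 0 0 0 0 0 1) (?L 0 0 0 0 0 0 1 0) = ?L 0 0 0 0 0 0 p 0"
      by (rule prems(3), simp add: commutator_def rows_simps upt_small)+
    then show thesis
      by (intro that[OF prems(2)]) (simp_all add: lin8_def prems(4))
  qed
  done

lemma L8_13_plus_basis:
  assumes "faithful_representation L8_13_plus N \<phi>" "N \<le> 4"
  obtains A B C D E F G H :: "real^4^4" where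
    "indep8 A B C D E F G H"
    "cm A B = 2 *\<^sub>R B" "cm A C = (-2) *\<^sub>R C" "cm B C = A" "cm A D = D" "cm C D = E" "cm A F = F"
    "cm C F = G" "cm D E = (-2) *\<^sub>R H" "cm F G = (-2) *\<^sub>R H" "cm D G = 0" "cm H D = 0"
  apply (rule faithful_basis[OF assms(1,2) L8_13_plus_def])
  subgoal premises
    by (rule linear_param8I, simp add: linear_simps, simp add: linear_simps)
      (auto simp: rows_simps)
  subgoal premises prems for A B C D E F G H
  proof -
    let ?L = "lin8 A B C D E F G H"
    have "cm (?L 1 0 0 0 0 0 0 0) (?L 0 1 0 0 0 0 0 0) = ?L 0 2 0 0 0 0 0 0"
      "cm (?L 1 0 0 0 0 0 0 0) (?L 0 0 1 0 0 0 0 0) = ?L 0 0 (-2) 0 0 0 0 0"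
      "cm (?L 0 1 0 0 0 0 0 0) (?L 0 0 1 0 0 0 0 0) = ?L 1 0 0 0 0 0 0 0"
      "cm (?L 1 0 0 0 0 0 0 0) (?L 0 0 0 1 0 0 0 0) = ?L 0 0 0 1 0 0 0 0"
      "cm (?L 0 0 1 0 0 0 0 0) (?L 0 0 0 1 0 0 0 0) = ?L 0 0 0 0 1 0 0 0"
      "cm (?L 1 0 0 0 0 0 0 0) (?L 0 0 0 0 0 1 0 0) = ?L 0 0 0 0 0 1 0 0"
      "cm (?L 0 0 1 0 0 0 0 0) (?L 0 0 0 0 0 1 0 0) = ?L 0 0 0 0 0 0 1 0"
      "cm (?L 0 0 0 1 0 0 0 0) (?L 0 0 0 0 1 0 0 0) = ?L 0 0 0 0 0 0 0 (-2)"
      "cm (?L 0 0 0 0 0 1 0 0) (?L 0 0 0 0 0 0 1 0) = ?L 0 0 0 0 0 0 0 (-2)"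
      "cm (?L 0 0 0 1 0 0 0 0) (?L 0 0 0 0 0 0 1 0) = ?L 0 0 0 0 0 0 0 0"
      "cm (?L 0 0 0 0 0 0 0 1) (?L 0 0 0 1 0 0 0 0) = ?L 0 0 0 0 0 0 0 0"
      by (rule prems(3), simp add: commutator_def rows_simps upt_small)+
    then show thesis
      by (intro that[OF prems(2)]) (simp_all add: lin8_def)
  qed
  done

lemma L8_13_minus_basis:
  assumes "faithful_representation L8_13_minus N \<phi>" "N \<le> 4"
  obtains A B C D E F G H :: "real^4^4" where
    "indep8 A B C D E F G H"
    "cm A B = 2 *\<^sub>R B" "cm A C = (-2) *\<^sub>R C" "cm B C = A" "cm A D = D" "cm A G = G" "cm D G = 0"
    "N < 4 \<longrightarrow> (\<forall>M\<in>{A, B, C, D, E, F, G, H}. M *v axis 4 1 = 0 \<and> axis 4 1 v* M = 0)"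
  apply (rule faithful_basis[OF assms(1,2) L8_13_minus_def])
  subgoal premises
    by (rule linear_param8I, simp add: linear_simps, simp add: linear_simps)
      (auto simp: rows_simps)
  subgoal premises prems for A B C D E F G H
  proof -
    let ?L = "lin8 A B C D E F G H"
    have "cm (?L 1 0 0 0 0 0 0 0) (?L 0 1 0 0 0 0 0 0) = ?L 0 2 0 0 0 0 0 0"
      "cm (?L 1 0 0 0 0 0 0 0) (?L 0 0 1 0 0 0 0 0) = ?L 0 0 (-2) 0 0 0 0 0"
      "cm (?L 0 1 0 0 0 0 0 0) (?L 0 0 1 0 0 0 0 0) = ?L 1 0 0 0 0 0 0 0"
      "cm (?L 1 0 0 0 0 0 0 0) (?L 0 0 0 1 0 0 0 0) = ?L 0 0 0 1 0 0 0 0"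
      "cm (?L 1 0 0 0 0 0 0 0) (?L 0 0 0 0 0 0 1 0) = ?L 0 0 0 0 0 0 1 0"
      "cm (?L 0 0 0 1 0 0 0 0) (?L 0 0 0 0 0 0 1 0) = ?L 0 0 0 0 0 0 0 0"
      by (rule prems(3), simp add: commutator_def rows_simps upt_small)+
    then show thesis
      by (intro that[OF prems(2)]) (simp_all add: lin8_def prems(4))
  qed
  done

lemma L8_14_basis:
  assumes "faithful_representation L8_14 N \<phi>" "N \<le> 4"
  obtains A B C D E F G H :: "real^4^4" where
    "indep8 A B C D E F G H"
    "cm A B = 2 *\<^sub>R B" "cm A C = (-2) *\<^sub>R C" "cm B C = A" "cm A D = D" "cm A F = F" "cm D F = 0"
    "N < 4 \<longrightarrow> (\<forall>M\<in>{A, B, C, D, E, F, G, H}. M *v axis 4 1 = 0 \<and> axis 4 1 v* M = 0)"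
  apply (rule faithful_basis[OF assms(1,2) L8_14_def])
  subgoal premises
    by (rule linear_param8I, simp add: linear_simps, simp add: linear_simps)
      (auto simp: rows_simps)
  subgoal premises prems for A B C D E F G H
  proof -
    let ?L = "lin8 A B C D E F G H"
    have "cm (?L 1 0 0 0 0 0 0 0) (?L 0 1 0 0 0 0 0 0) = ?L 0 2 0 0 0 0 0 0"
      "cm (?L 1 0 0 0 0 0 0 0) (?L 0 0 1 0 0 0 0 0) = ?L 0 0 (-2) 0 0 0 0 0"
      "cm (?L 0 1 0 0 0 0 0 0) (?L 0 0 1 0 0 0 0 0) = ?L 1 0 0 0 0 0 0 0"
      "cm (?L 1 0 0 0 0 0 0 0) (?L 0 0 0 1 0 0 0 0) = ?L 0 0 0 1 0 0 0 0"
      "cm (?L 1 0 0 0 0 0 0 0) (?L 0 0 0 0 0 1 0 0) = ?L 0 0 0 0 0 1 0 0"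
      "cm (?L 0 0 0 1 0 0 0 0) (?L 0 0 0 0 0 1 0 0) = ?L 0 0 0 0 0 0 0 0"
      by (rule prems(3), simp add: commutator_def rows_simps upt_small)+
    then show thesis
      by (intro that[OF prems(2)]) (simp_all add: lin8_def prems(4))
  qed
  done

lemma L8_15_basis:
  assumes "faithful_representation L8_15 N \<phi>" "N \<le> 4"
  obtains A B C D E F G H :: "real^4^4" where
    "indep8 A B C D E F G H"
    "cm A B = 2 *\<^sub>R B" "cm A C = (-2) *\<^sub>R C" "cm B C = A" "cm A D = D" "cm C D = F" "cm D F = - H"
    "cm H D = (-3) *\<^sub>R E" "cm D E = 0"
  apply (rule faithful_basis[OF assms(1,2) L8_15_def])
  subgoal premises
    by (rule linear_param8I, simp add: linear_simps, simp add: linear_simps)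
      (auto simp: rows_simps)
  subgoal premises prems for A B C D E F G H
  proof -
    let ?L = "lin8 A B C D E F G H"
    have "cm (?L 1 0 0 0 0 0 0 0) (?L 0 1 0 0 0 0 0 0) = ?L 0 2 0 0 0 0 0 0"
      "cm (?L 1 0 0 0 0 0 0 0) (?L 0 0 1 0 0 0 0 0) = ?L 0 0 (-2) 0 0 0 0 0"
      "cm (?L 0 1 0 0 0 0 0 0) (?L 0 0 1 0 0 0 0 0) = ?L 1 0 0 0 0 0 0 0"
      "cm (?L 1 0 0 0 0 0 0 0) (?L 0 0 0 1 0 0 0 0) = ?L 0 0 0 1 0 0 0 0"
      "cm (?L 0 0 1 0 0 0 0 0) (?L 0 0 0 1 0 0 0 0) = ?L 0 0 0 0 0 1 0 0"
      "cm (?L 0 0 0 1 0 0 0 0) (?L 0 0 0 0 0 1 0 0) = ?L 0 0 0 0 0 0 0 (-1)"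
      "cm (?L 0 0 0 0 0 0 0 1) (?L 0 0 0 1 0 0 0 0) = ?L 0 0 0 0 (-3) 0 0 0"
      "cm (?L 0 0 0 1 0 0 0 0) (?L 0 0 0 0 1 0 0 0) = ?L 0 0 0 0 0 0 0 0"
      by (rule prems(3), simp add: commutator_def rows_simps upt_small)+
    then show thesis
      by (intro that[OF prems(2)]) (simp_all add: lin8_def)
  qed
  done

lemma L8_16_basis:
  assumes "faithful_representation L8_16 N \<phi>" "N \<le> 4"
  obtains A B C D E F G H :: "real^4^4" where
    "indep8 A B C D E F G H"
    "cm A B = 2 *\<^sub>R B" "cm A C = (-2) *\<^sub>R C" "cm B C = A" "cm A D = D" "cm A E = E" "cm D E = 0"
    "N < 4 \<longrightarrow> (\<forall>M\<in>{A, B, C, D, E, F, G, H}. M *v axis 4 1 = 0 \<and> axis 4 1 v* M = 0)"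
  apply (rule faithful_basis[OF assms(1,2) L8_16_def])
  subgoal premises
    by (rule linear_param8I, simp add: linear_simps, simp add: linear_simps)
      (auto simp: rows_simps)
  subgoal premises prems for A B C D E F G H
  proof -
    let ?L = "lin8 A B C D E F G H"
    have "cm (?L 1 0 0 0 0 0 0 0) (?L 0 1 0 0 0 0 0 0) = ?L 0 2 0 0 0 0 0 0"
      "cm (?L 1 0 0 0 0 0 0 0) (?L 0 0 1 0 0 0 0 0) = ?L 0 0 (-2) 0 0 0 0 0"
      "cm (?L 0 1 0 0 0 0 0 0) (?L 0 0 1 0 0 0 0 0) = ?L 1 0 0 0 0 0 0 0"
      "cm (?L 1 0 0 0 0 0 0 0) (?L 0 0 0 1 0 0 0 0) = ?L 0 0 0 1 0 0 0 0"
      "cm (?L 1 0 0 0 0 0 0 0) (?L 0 0 0 0 1 0 0 0) = ?L 0 0 0 0 1 0 0 0"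
      "cm (?L 0 0 0 1 0 0 0 0) (?L 0 0 0 0 1 0 0 0) = ?L 0 0 0 0 0 0 0 0"
      by (rule prems(3), simp add: commutator_def rows_simps upt_small)+
    then show thesis
      by (intro that[OF prems(2)]) (simp_all add: lin8_def prems(4))
  qed
  done

lemma L8_17_basis:
  assumes "faithful_representation (L8_17 lam p) N \<phi>" "N \<le> 4"
  obtains A B C D E F G H :: "real^4^4" where
    "indep8 A B C D E F G H"
    "cm A B = 2 *\<^sub>R B" "cm A C = (-2) *\<^sub>R C" "cm B C = A" "cm A D = D" "cm A E = E" "cm D E = 0"
    "N < 4 \<longrightarrow> (\<forall>M\<in>{A, B, C, D, E, F, G, H}. M *v axis 4 1 = 0 \<and> axis 4 1 v* M = 0)"
  apply (rule faithful_basis[OF assms(1,2) L8_17_def])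
  subgoal premises
    apply (rule linear_param8I, simp add: linear_simps, simp add: linear_simps)
    by (simp add: rows_simps distrib_right)
  subgoal premises prems for A B C D E F G H
  proof -
    let ?L = "lin8 A B C D E F G H"
    have "cm (?L 1 0 0 0 0 0 0 0) (?L 0 1 0 0 0 0 0 0) = ?L 0 2 0 0 0 0 0 0"
      "cm (?L 1 0 0 0 0 0 0 0) (?L 0 0 1 0 0 0 0 0) = ?L 0 0 (-2) 0 0 0 0 0"
      "cm (?L 0 1 0 0 0 0 0 0) (?L 0 0 1 0 0 0 0 0) = ?L 1 0 0 0 0 0 0 0"
      "cm (?L 1 0 0 0 0 0 0 0) (?L 0 0 0 1 0 0 0 0) = ?L 0 0 0 1 0 0 0 0"
      "cm (?L 1 0 0 0 0 0 0 0) (?L 0 0 0 0 1 0 0 0) = ?L 0 0 0 0 1 0 0 0"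
      "cm (?L 0 0 0 1 0 0 0 0) (?L 0 0 0 0 1 0 0 0) = ?L 0 0 0 0 0 0 0 0"
      by (rule prems(3), simp add: commutator_def rows_simps upt_small)+
    then show thesis
      by (intro that[OF prems(2)]) (simp_all add: lin8_def prems(4))
  qed
  done

lemma L8_18_basis:
  assumes "faithful_representation (L8_18 lam nu) N \<phi>" "N \<le> 4"
  obtains A B C D E F G H :: "real^4^4" where
    "indep8 A B C D E F G H"
    "cm A B = 2 *\<^sub>R B" "cm A C = (-2) *\<^sub>R C" "cm B C = A" "cm A E = E" "cm A F = F" "cm E F = 0"
    "N < 4 \<longrightarrow> (\<forall>M\<in>{A, B, C, D, E, F, G, H}. M *v axis 4 1 = 0 \<and> axis 4 1 v* M = 0)"
  apply (rule faithful_basis[OF assms(1,2) L8_18_def])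
  subgoal premises
    by (rule linear_param8I, simp add: linear_simps, simp add: linear_simps)
      (auto simp: rows_simps)
  subgoal premises prems for A B C D E F G H
  proof -
    let ?L = "lin8 A B C D E F G H"
    have "cm (?L 1 0 0 0 0 0 0 0) (?L 0 1 0 0 0 0 0 0) = ?L 0 2 0 0 0 0 0 0"
      "cm (?L 1 0 0 0 0 0 0 0) (?L 0 0 1 0 0 0 0 0) = ?L 0 0 (-2) 0 0 0 0 0"
      "cm (?L 0 1 0 0 0 0 0 0) (?L 0 0 1 0 0 0 0 0) = ?L 1 0 0 0 0 0 0 0"
      "cm (?L 1 0 0 0 0 0 0 0) (?L 0 0 0 0 1 0 0 0) = ?L 0 0 0 0 1 0 0 0"
      "cm (?L 1 0 0 0 0 0 0 0) (?L 0 0 0 0 0 1 0 0) = ?L 0 0 0 0 0 1 0 0"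
      "cm (?L 0 0 0 0 1 0 0 0) (?L 0 0 0 0 0 1 0 0) = ?L 0 0 0 0 0 0 0 0"
      by (rule prems(3), simp add: commutator_def rows_simps upt_small)+
    then show thesis
      by (intro that[OF prems(2)]) (simp_all add: lin8_def prems(4))
  qed
  done

lemma L8_19_basis:
  assumes "faithful_representation L8_19 N \<phi>" "N \<le> 4"
  obtains A B C D E F G H :: "real^4^4" where
    "indep8 A B C D E F G H"
    "cm A B = 2 *\<^sub>R B" "cm A C = (-2) *\<^sub>R C" "cm B C = A" "cm A D = 3 *\<^sub>R D"
  apply (rule faithful_basis[OF assms(1,2) L8_19_def])
  subgoal premises
    by (rule linear_param8I, simp add: linear_simps, simp add: linear_simps)
      (auto simp: rows_simps)
  subgoal premises prems for A B C D E F G H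
  proof -
    let ?L = "lin8 A B C D E F G H"
    have "cm (?L 1 0 0 0 0 0 0 0) (?L 0 1 0 0 0 0 0 0) = ?L 0 2 0 0 0 0 0 0"
      "cm (?L 1 0 0 0 0 0 0 0) (?L 0 0 1 0 0 0 0 0) = ?L 0 0 (-2) 0 0 0 0 0"
      "cm (?L 0 1 0 0 0 0 0 0) (?L 0 0 1 0 0 0 0 0) = ?L 1 0 0 0 0 0 0 0"
      "cm (?L 1 0 0 0 0 0 0 0) (?L 0 0 0 1 0 0 0 0) = ?L 0 0 0 3 0 0 0 0"
      by (rule prems(3), simp add: commutator_def rows_simps upt_small)+
    then show thesis
      by (intro that[OF prems(2)]) (simp_all add: lin8_def)
  qed
  done

lemma L8_20_basis:
  assumes "faithful_representation L8_20 N \<phi>" "N \<le> 4"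
  obtains A B C D E F G H :: "real^4^4" where
    "indep8 A B C D E F G H"
    "cm A B = 2 *\<^sub>R B" "cm A C = (-2) *\<^sub>R C" "cm B C = A" "cm A D = 3 *\<^sub>R D"
  apply (rule faithful_basis[OF assms(1,2) L8_20_def])
  subgoal premises
    by (rule linear_param8I, simp add: linear_simps, simp add: linear_simps)
      (auto simp: rows_simps)
  subgoal premises prems for A B C D E F G H
  proof -
    let ?L = "lin8 A B C D E F G H"
    have "cm (?L 1 0 0 0 0 0 0 0) (?L 0 1 0 0 0 0 0 0) = ?L 0 2 0 0 0 0 0 0"
      "cm (?L 1 0 0 0 0 0 0 0) (?L 0 0 1 0 0 0 0 0) = ?L 0 0 (-2) 0 0 0 0 0"
      "cm (?L 0 1 0 0 0 0 0 0) (?L 0 0 1 0 0 0 0 0) = ?L 1 0 0 0 0 0 0 0"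
      "cm (?L 1 0 0 0 0 0 0 0) (?L 0 0 0 1 0 0 0 0) = ?L 0 0 0 3 0 0 0 0"
      by (rule prems(3), simp add: commutator_def rows_simps upt_small)+
    then show thesis
      by (intro that[OF prems(2)]) (simp_all add: lin8_def)
  qed
  done

lemma L8_21_basis:
  assumes "faithful_representation L8_21 N \<phi>" "N \<le> 4"
  obtains A B C D E F G H :: "real^4^4" where
    "indep8 A B C D E F G H"
    "cm A B = 2 *\<^sub>R B" "cm A C = (-2) *\<^sub>R C" "cm B C = A" "cm A D = 4 *\<^sub>R D" "cm B D = 0"
    "cm A H = (-4) *\<^sub>R H" "cm C H = 0" "cm D H = 0"
  apply (rule faithful_basis[OF assms(1,2) L8_21_def])
  subgoal premises
    by (rule linear_param8I, simp add: linear_simps, simp add: linear_simps)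
      (auto simp: rows_simps)
  subgoal premises prems for A B C D E F G H
  proof -
    let ?L = "lin8 A B C D E F G H"
    have "cm (?L 1 0 0 0 0 0 0 0) (?L 0 1 0 0 0 0 0 0) = ?L 0 2 0 0 0 0 0 0"
      "cm (?L 1 0 0 0 0 0 0 0) (?L 0 0 1 0 0 0 0 0) = ?L 0 0 (-2) 0 0 0 0 0"
      "cm (?L 0 1 0 0 0 0 0 0) (?L 0 0 1 0 0 0 0 0) = ?L 1 0 0 0 0 0 0 0"
      "cm (?L 1 0 0 0 0 0 0 0) (?L 0 0 0 1 0 0 0 0) = ?L 0 0 0 4 0 0 0 0"
      "cm (?L 0 1 0 0 0 0 0 0) (?L 0 0 0 1 0 0 0 0) = ?L 0 0 0 0 0 0 0 0"
      "cm (?L 1 0 0 0 0 0 0 0) (?L 0 0 0 0 0 0 0 1) = ?L 0 0 0 0 0 0 0 (-4)"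
      "cm (?L 0 0 1 0 0 0 0 0) (?L 0 0 0 0 0 0 0 1) = ?L 0 0 0 0 0 0 0 0"
      "cm (?L 0 0 0 1 0 0 0 0) (?L 0 0 0 0 0 0 0 1) = ?L 0 0 0 0 0 0 0 0"
      by (rule prems(3), simp add: commutator_def rows_simps upt_small)+
    then show thesis
      by (intro that[OF prems(2)]) (simp_all add: lin8_def)
  qed
  done

lemma L8_22_basis:
  assumes "faithful_representation L8_22 N \<phi>" "N \<le> 4"
  obtains A B C D E F G H :: "real^4^4" where
    "indep8 A B C D E F G H"
    "cm A B = 2 *\<^sub>R B" "cm A C = (-2) *\<^sub>R C" "cm B C = A" "cm A G = G" "cm A E = 2 *\<^sub>R E"
  apply (rule faithful_basis[OF assms(1,2) L8_22_def])
  subgoal premises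
    by (rule linear_param8I, simp add: linear_simps, simp add: linear_simps)
      (auto simp: rows_simps)
  subgoal premises prems for A B C D E F G H
  proof -
    let ?L = "lin8 A B C D E F G H"
    have "cm (?L 1 0 0 0 0 0 0 0) (?L 0 1 0 0 0 0 0 0) = ?L 0 2 0 0 0 0 0 0"
      "cm (?L 1 0 0 0 0 0 0 0) (?L 0 0 1 0 0 0 0 0) = ?L 0 0 (-2) 0 0 0 0 0"
      "cm (?L 0 1 0 0 0 0 0 0) (?L 0 0 1 0 0 0 0 0) = ?L 1 0 0 0 0 0 0 0"
      "cm (?L 1 0 0 0 0 0 0 0) (?L 0 0 0 0 0 0 1 0) = ?L 0 0 0 0 0 0 1 0"
      "cm (?L 1 0 0 0 0 0 0 0) (?L 0 0 0 0 1 0 0 0) = ?L 0 0 0 0 2 0 0 0"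
      by (rule prems(3), simp add: commutator_def rows_simps upt_small)+
    then show thesis
      by (intro that[OF prems(2)]) (simp_all add: lin8_def)
  qed
  done

section \<open>Dimensions of faithful representations\<close>

text \<open>Commutators have trace zero. This removes the scalar component that a centralizer leaves
  undetermined.\<close>

lemma scalar_not_sum_of_commutators:
  fixes X Y Z W :: "real^4^4"
  assumes "r *\<^sub>R mat 1 = cm X Y + cm Z W"
  shows "r = 0"
proof -
  have t: "trace (cm U V) = 0" for U V :: "real^4^4"
    by (simp only: cm_def trace_sub trace_mul_sym[of U V] diff_self)
  have "trace (r *\<^sub>R mat 1 :: real^4^4) = 0"
    unfolding assms trace_add t by simp
  then show ?thesis by (simp add: trace_def sum_4 mat_def)
qed

text \<open>For E = A + i B, the real and imaginary parts of E^2 = 0 say A^2 = B^2 and A B = - B A.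
  Then E F + F E is the real matrix p = -4 A^2, the cubic relations make p a unit for A and B, and 2
  A, 2 B, 2 C satisfy the quaternion relations with p as identity.\<close>

lemma so3_quaternion_span:
  fixes A B C :: "real^4^4"
  assumes so3: "cm A B = C" "cm B C = A" "cm C A = B"
    and sq: "cpx A B ** cpx A B = 0" "cpx (- A) B ** cpx (- A) B = 0"
    and proj: "cpx A B ** cpx (- A) B ** cpx A B = cpx A B" "cpx (- A) B ** cpx A B ** cpx (- A) B = cpx (- A) B"
  obtains p where "cpx A B ** cpx (- A) B + cpx (- A) B ** cpx A B = cpx p 0" "p ** A = A" "p ** B = B" "p ** C = C"
    "\<forall>v w. p *v v = v \<longrightarrow> v \<noteq> 0 \<longrightarrow> (\<exists>a b c d. w = a *s v + b *s (A *v v) + c *s (B *v v) + d *s (C *v v))"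
proof -
  define p where "p = (-4) *\<^sub>R (A ** A)"
  have AB: "A ** A = B ** B" "A ** B = - (B ** A)"
    using sq by (simp_all add: cpx_mult cpx_simps) (simp add: eq_neg_iff_add_eq_0)
  have C: "C = 2 *\<^sub>R (A ** B)"
    using so3(1) AB(2) by (simp add: cm_def vec_eq_iff)
  have EF: "cpx A B ** cpx (- A) B + cpx (- A) B ** cpx A B = cpx p 0"
    using AB by (simp add: cpx_mult cpx_simps matrix_mult_distribs p_def) (simp add: vec_eq_iff)
  let ?E = "cpx A B" and ?F = "cpx (- A) B"
  have "cpx p 0 ** ?E = ?E ** ?F ** ?E + ?F ** (?E ** ?E)"
    unfolding EF[symmetric] by (simp add: matrix_mult_distribs matrix_mul_assoc)
  then have pE: "cpx p 0 ** ?E = ?E" using proj(1) sq(1) by simp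
  have "?E ** cpx p 0 = ?E ** ?F ** ?E + ?E ** ?E ** ?F"
    unfolding EF[symmetric] by (simp add: matrix_mult_distribs matrix_mul_assoc add.commute)
  then have Ep: "?E ** cpx p 0 = ?E" using proj(1) sq(1) by simp
  have p: "p ** A = A" "p ** B = B" "A ** p = A" "B ** p = B"
    using pE Ep by (simp_all add: cpx_mult cpx_simps)
  have pC: "p ** C = C" unfolding C by (simp add: matrix_mult_scaleR matrix_mul_assoc p)
  define I J K where "I = 2 *\<^sub>R A" and "J = 2 *\<^sub>R B" and "K = 2 *\<^sub>R C"
  have II: "I ** I = - p" by (simp add: I_def p_def matrix_mult_scaleR vec_eq_iff)
  have JJ: "J ** J = - p" by (simp add: J_def p_def matrix_mult_scaleR AB(1) vec_eq_iff)
  have IJ: "I ** J = K" by (simp add: I_def J_def K_def matrix_mult_scaleR C vec_eq_iff)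
  have JI: "J ** I = - K" unfolding IJ[symmetric] using AB(2) by (simp add: I_def J_def matrix_mult_scaleR vec_eq_iff)
  have pI: "p ** I = I" "I ** p = I" "p ** J = J" "J ** p = J"
    using p by (simp_all add: I_def J_def matrix_mult_scaleR)
  have JK: "J ** K = I"
  proof -
    have "J ** K = (J ** I) ** J" unfolding IJ[symmetric] by (simp add: matrix_mul_assoc)
    also have "\<dots> = - (I ** (J ** J))" unfolding JI IJ[symmetric] by (simp add: matrix_mult_distribs matrix_mul_assoc)
    finally show ?thesis unfolding JJ by (simp add: matrix_mult_distribs pI)
  qed
  have KJ: "K ** J = - I"
  proof -
    have "K ** J = I ** (J ** J)" unfolding IJ[symmetric] by (simp add: matrix_mul_assoc)
    then show ?thesis unfolding JJ by (simp add: matrix_mult_distribs pI)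
  qed
  have IK: "I ** K = - J"
  proof -
    have "I ** K = (I ** I) ** J" unfolding IJ[symmetric] by (simp add: matrix_mul_assoc)
    then show ?thesis unfolding II by (simp add: matrix_mult_distribs pI)
  qed
  have KI: "K ** I = J"
  proof -
    have "K ** I = I ** (J ** I)" unfolding IJ[symmetric] by (simp add: matrix_mul_assoc)
    then show ?thesis unfolding JI by (simp add: matrix_mult_distribs IK)
  qed
  have KK: "K ** K = - p"
  proof -
    have "K ** K = I ** (J ** K)" unfolding IJ[symmetric] by (simp add: matrix_mul_assoc)
    then show ?thesis unfolding JK II .
  qed
  have "\<exists>a b c d. w = a *s v + b *s (A *v v) + c *s (B *v v) + d *s (C *v v)" if v: "p *v v = v" "v \<noteq> 0" for v w
  proof -
    obtain a b c d where w: "w = a *s v + b *s (I *v v) + c *s (J *v v) + d *s (K *v v)"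
      using quaternion_span[OF II JJ KK IJ JI JK KJ KI IK v] by blast
    have "w = a *s v + (2 * b) *s (A *v v) + (2 * c) *s (B *v v) + (2 * d) *s (C *v v)"
      unfolding w I_def J_def K_def matrix_scaleR_vector by (simp add: vec_eq_iff)
    then show ?thesis by blast
  qed
  with that EF p(1,2) pC show ?thesis by blast
qed

text \<open>X + i Y has weight 1, so p = E F + F E is a projection different from the identity. But
  for v in its image also A v, B v, C v lie there, and together these four span the whole
  space.\<close>

lemma so3_no_weight1:
  fixes A B C X Y :: "real^4^4"
  assumes so3: "cm A B = C" "cm B C = A" "cm C A = B"
    and X: "2 *\<^sub>R cm C X = Y" "2 *\<^sub>R cm C Y = - X"
  shows "X = 0"
proof (rule ccontr)
  assume "X \<noteq> 0"
  have sl2: "sl2_triple (cpx 0 (2 *\<^sub>R C)) (cpx A B) (cpx (- A) B)"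
    by (rule so3_sl2_triple[OF so3])
  have "cm (cpx 0 (2 *\<^sub>R C)) (cpx X Y) = cpx X Y"
    using X by (simp add: cpx_cm cpx_simps cm_scaleR)
  moreover have "cpx X Y \<noteq> 0" using \<open>X \<noteq> 0\<close> by (simp add: cpx_simps)
  ultimately have w: "cpx A B ** cpx A B = 0" "cpx (- A) B ** cpx (- A) B = 0"
    "cpx A B ** cpx (- A) B ** cpx A B = cpx A B" "cpx (- A) B ** cpx A B ** cpx (- A) B = cpx (- A) B"
    "cpx A B ** cpx (- A) B + cpx (- A) B ** cpx A B \<noteq> mat 1" "cpx A B \<noteq> 0"
    by (rule weight1_products[OF sl2])+
  obtain p where p: "cpx A B ** cpx (- A) B + cpx (- A) B ** cpx A B = cpx p 0" "p ** A = A" "p ** B = B" "p ** C = C"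
    and span: "\<forall>v w. p *v v = v \<longrightarrow> v \<noteq> 0 \<longrightarrow> (\<exists>a b c d. w = a *s v + b *s (A *v v) + c *s (B *v v) + d *s (C *v v))"
    by (rule so3_quaternion_span[OF so3 w(1-4)])
  obtain v where v: "p *v v = v" "v \<noteq> 0"
  proof -
    have "A \<noteq> 0 \<or> B \<noteq> 0" using w(6) by (simp add: cpx_simps)
    then obtain M x where "M \<in> {A, B}" "M *v x \<noteq> 0" by (metis insertCI matrix_eq matrix_vector_mult_0)
    moreover from this have "p *v (M *v x) = M *v x" using p by (auto simp: matrix_vector_mul_assoc)
    ultimately show ?thesis using that by blast
  qed
  have "p *v w = w" for w
  proof -
    obtain a b c d where w: "w = a *s v + b *s (A *v v) + c *s (B *v v) + d *s (C *v v)"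
      using span v by blast
    show ?thesis unfolding w matrix_vector_right_distrib matrix_vector_smult matrix_vector_mul_assoc p v(1) ..
  qed
  then have "p = mat 1" by (simp add: matrix_eq)
  with p(1) w(5) show False by (simp add: cpx_simps)
qed

section \<open>The algebras with Levi factor so_3\<close>

lemma no_faithful_L8_1:
  assumes "faithful_representation (L8_1 p) N \<phi>" "N \<le> 4" "p \<noteq> 0"
  shows False
proof -
  obtain A B C D E F G H :: "real^4^4" where ind: "indep8 A B C D E F G H"
    and so3: "cm A B = - C" "cm B C = - A" "cm C A = - B" and DE: "cm C D = - E" "cm C E = D"
    and com: "cm A H = 0" "cm B H = 0" "cm C H = 0" "cm A G = 0" "cm B G = 0" "cm C G = 0"
    and H: "cm H D = D" "cm H E = E" "cm G D = 0" "cm G E = 0" "cm H G = p *\<^sub>R G"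
    using L8_1_basis[OF assms] by metis
  have nz: "D \<noteq> 0" "G \<noteq> 0"
    using indep8D[OF ind, of 0 0 0 1 0 0 0 0]
      indep8D[OF ind, of 0 0 0 0 0 0 1 0] by auto
  \<comment> \<open>Negating all three generators removes the minus signs from the brackets.\<close>
  have so3': "cm (- A) (- B) = - C" "cm (- B) (- C) = - A" "cm (- C) (- A) = - B"
    using so3 by (simp_all add: cm_add)
  note sl2 = so3_sl2_triple[OF so3']
  have G0: "cpx G 0 \<noteq> 0" using nz by (simp add: cpx_simps)
  \<comment> \<open>D + i E has weight 2 for the complexified triple and is scaled by H, while G
    commutes with it. The value p = 1 remains possible at this point; what is used are the relations
    of V_1 + V_1.\<close>
  have sw: "cpx G 0 ** cpx G 0 = 0" "cpx (- A) (- B) ** cpx (- A) (- B) = 0" "cpx (- (- A)) (- B) ** cpx (- (- A)) (- B) = 0"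
    "cpx (- A) (- B) ** cpx (- (- A)) (- B) + cpx (- (- A)) (- B) ** cpx (- A) (- B) = mat 1"
    by (rule scaled_weight2[OF sl2 _ _ _ _ _ _ _ _ G0, of "cpx D E" "cpx H 0" p];
      use assms(3) nz DE com H in \<open>simp add: cpx_cm cpx_simps cm_scaleR cm_add\<close>; simp add: vec_eq_iff)+
  have proj: "cpx (- A) (- B) ** cpx (- (- A)) (- B) ** cpx (- A) (- B) = cpx (- A) (- B)"
    "cpx (- (- A)) (- B) ** cpx (- A) (- B) ** cpx (- (- A)) (- B) = cpx (- (- A)) (- B)"
  proof -
    let ?E = "cpx (- A) (- B)" and ?F = "cpx (- (- A)) (- B)"
    have "?E ** ?F ** ?E + ?F ** (?E ** ?E) = ?E" "?F ** ?E ** ?F + ?E ** (?F ** ?F) = ?F"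
      using arg_cong[OF sw(4), of "\<lambda>M. M ** ?E"] arg_cong[OF sw(4), of "\<lambda>M. M ** ?F"]
      by (simp_all add: matrix_mult_distribs matrix_mul_assoc add.commute)
    with sw show "?E ** ?F ** ?E = ?E" "?F ** ?E ** ?F = ?F" by simp_all
  qed
  obtain q where q: "cpx (- A) (- B) ** cpx (- (- A)) (- B) + cpx (- (- A)) (- B) ** cpx (- A) (- B) = cpx q 0"
    and "q ** (- A) = - A" "q ** (- B) = - B" "q ** (- C) = - C"
    and span: "\<forall>v w. q *v v = v \<longrightarrow> v \<noteq> 0 \<longrightarrow>
      (\<exists>a b c d. w = a *s v + b *s (- A *v v) + c *s (- B *v v) + d *s (- C *v v))"
    by (rule so3_quaternion_span[OF so3' sw(2,3) proj])
  have "cpx q 0 = cpx (mat 1) 0" using q sw(4) by (simp add: cpx_simps(8))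
  then have q1: "q = mat 1" by (simp add: cpx_simps(5))
  have GG: "G ** G = 0" using sw(1) by (simp add: cpx_mult cpx_simps)
  \<comment> \<open>G commutes with so_3, so its kernel is stable under A, B, C. As G^2 = 0, the
    kernel contains the non-zero vector G x and therefore its quaternionic span, the whole
    space.\<close>
  obtain x where x: "G *v x \<noteq> 0" using nz(2) by (metis matrix_eq matrix_vector_mult_0)
  let ?v = "G *v x"
  have v: "q *v ?v = ?v" "G *v ?v = 0" using q1 GG by (simp_all add: matrix_vector_mul_assoc)
  have GM: "G *v (M *v ?v) = 0" if "cm M G = 0" for M
  proof -
    have "G ** M = M ** G" using that by (simp add: cm_def)
    then have "G *v (M *v ?v) = M *v (G *v ?v)" by (metis matrix_vector_mul_assoc)
    then show ?thesis using v by simp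
  qed
  have "G *v w = 0" for w
  proof -
    obtain a b c d where w: "w = a *s ?v + b *s (- A *v ?v) + c *s (- B *v ?v) + d *s (- C *v ?v)"
      using span v(1) x by blast
    have "G *v (- A *v ?v) = 0" "G *v (- B *v ?v) = 0" "G *v (- C *v ?v) = 0"
      using com by (intro GM; simp add: cm_add)+
    then show ?thesis unfolding w matrix_vector_right_distrib matrix_vector_smult v(2) by simp
  qed
  with x show False by blast
qed

lemma no_faithful_L8_2:
  assumes "faithful_representation L8_2 N \<phi>" "N \<le> 4"
  shows False
proof -
  obtain A B C D E F G H :: "real^4^4" where ind: "indep8 A B C D E F G H"
    and so3: "cm A B = 2 *\<^sub>R C" "cm B C = 2 *\<^sub>R A" "cm C A = 2 *\<^sub>R B" and DF: "cm C D = - F" "cm C F = D"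
    by (rule L8_2_basis[OF assms])
  have "D \<noteq> 0" using indep8D[OF ind, of 0 0 0 1 0 0 0 0] by auto
  moreover have "D = 0"
    \<comment> \<open>Halving normalizes the brackets of so_3; the vector of weight 1 is D - i
      F.\<close>
    by (rule so3_no_weight1[of "(1/2) *\<^sub>R A" "(1/2) *\<^sub>R B" "(1/2) *\<^sub>R C" D "- F"])
      (simp_all add: cm_scaleR cm_add so3 DF)
  ultimately show False by blast
qed

lemma no_faithful_L8_3:
  assumes "faithful_representation L8_3 N \<phi>" "N \<le> 4"
  shows False
proof -
  obtain A B C D E F G H :: "real^4^4" where ind: "indep8 A B C D E F G H"
    and so3: "cm A B = C" "cm B C = A" "cm C A = B" and DF: "cm C D = (1/2) *\<^sub>R F" "cm C F = (-1/2) *\<^sub>R D"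
    by (rule L8_3_basis[OF assms])
  have "D \<noteq> 0" using indep8D[OF ind, of 0 0 0 1 0 0 0 0] by auto
  moreover have "D = 0"
    by (rule so3_no_weight1[OF so3, of D F]) (simp_all add: DF)
  ultimately show False by blast
qed

lemma no_faithful_L8_4:
  assumes "faithful_representation (L8_4 p) N \<phi>" "N \<le> 4"
  shows False
proof -
  obtain A B C D E F G H :: "real^4^4" where ind: "indep8 A B C D E F G H"
    and so3: "cm A B = (-2) *\<^sub>R C" "cm B C = (-2) *\<^sub>R A" "cm C A = (-2) *\<^sub>R B" and DF: "cm C D = - F" "cm C F = D"
    by (rule L8_4_basis[OF assms])
  have "D \<noteq> 0" using indep8D[OF ind, of 0 0 0 1 0 0 0 0] by auto
  moreover have "D = 0"
    by (rule so3_no_weight1[of "(-1/2) *\<^sub>R A" "(-1/2) *\<^sub>R B" "(-1/2) *\<^sub>R C" D F])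
      (simp_all add: cm_scaleR cm_add so3 DF)
  ultimately show False by blast
qed

lemma no_faithful_L8_5:
  assumes "faithful_representation L8_5 N \<phi>" "N \<le> 4"
  shows False
proof -
  obtain A B C D E F G H :: "real^4^4" where ind: "indep8 A B C D E F G H"
    and so3: "cm A B = (-4) *\<^sub>R C" "cm B C = - A" "cm C A = - B" and DE: "cm C D = (-2) *\<^sub>R E" "cm C E = 2 *\<^sub>R D"
      "cm A D = - G" "cm A E = F" "cm B D = - F" "cm B E = - G" "cm D E = 0"
    by (rule L8_5_basis[OF assms])
  have "D \<noteq> 0" using indep8D[OF ind, of 0 0 0 1 0 0 0 0] by auto
  \<comment> \<open>D + i E has weight 4 and its conjugate D - i E has weight -4; they commute
    because D and E do.\<close>
  then have nz: "cpx D E \<noteq> 0" "cpx D (- E) \<noteq> 0" by (simp_all add: cpx_simps)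
  have ED: "cm E D = 0" using DE(7) by (simp add: cm_def)
  \<comment> \<open>Since [A, B] = -4 C, the triple A/2, B/2, -C has the standard brackets.\<close>
  let ?A = "(1/2) *\<^sub>R A" and ?B = "(1/2) *\<^sub>R B"
  have sl2: "sl2_triple (cpx 0 (2 *\<^sub>R (- C))) (cpx ?A ?B) (cpx (- ?A) ?B)"
    by (rule so3_sl2_triple) (simp_all add: cm_scaleR cm_add so3)
  show False
    by (rule abelian_weight4_impossible[OF sl2 _ _ nz(1) _ _ nz(2)])
      (simp_all add: cpx_cm cpx_simps cm_scaleR cm_add DE ED)
qed

section \<open>The algebras with Levi factor sl_2\<close>

lemma no_faithful_L8_6:
  assumes "faithful_representation L8_6 N \<phi>" "N \<le> 4"
  shows False
proof -
  obtain A B C D E F G H :: "real^4^4" where ind: "indep8 A B C D E F G H"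
    and sl2: "cm A B = 2 *\<^sub>R B" "cm A C = (-2) *\<^sub>R C" "cm B C = A"
    and br: "cm A D = D" "cm C D = E" "cm D E = (-2) *\<^sub>R H" "cm H D = 0" "cm A F = 0" "cm B F = 0" "cm F D = 0"
      "cm A G = 0" "cm B G = 0" "cm G D = 0" "cm F G = (-2) *\<^sub>R H"
    by (rule L8_6_basis[OF assms])
  have nz: "H \<noteq> 0" using indep8D[OF ind, of 0 0 0 0 0 0 0 1] by auto
  have tr: "sl2_triple A B C" using sl2 by (simp add: sl2_triple_def)
  have c: "(-2) *\<^sub>R H \<noteq> 0" "cm ((-2) *\<^sub>R H) D = 0" using nz br by (simp_all add: cm_scaleR cm_add)
  \<comment> \<open>F and G both centralize the Levi factor and the doublet, so they lie in the
    commutative span of 1 and H, although their bracket is a non-zero multiple of H.\<close>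
  obtain a b where F: "F = a *\<^sub>R mat 1 + b *\<^sub>R ((-2) *\<^sub>R H)"
    using doublet_center_commutant[OF tr br(1,2,3) c br(5-7)] .
  obtain a' b' where G: "G = a' *\<^sub>R mat 1 + b' *\<^sub>R ((-2) *\<^sub>R H)"
    using doublet_center_commutant[OF tr br(1,2,3) c br(8-10)] .
  have one: "cm (mat 1) M = 0" "cm M (mat 1) = 0" for M :: "real^4^4" by (simp_all add: cm_def)
  have "cm F G = 0" unfolding F G by (simp add: cm_add cm_scaleR one)
  with br(11) nz show False by simp
qed

lemma no_faithful_L8_7:
  assumes "faithful_representation (L8_7 p q) N \<phi>" "N \<le> 4" "p * q \<noteq> 0"
  shows False
proof -
  obtain A B C D E F G H :: "real^4^4" where ind: "indep8 A B C D E F G H"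
    and sl2: "cm A B = 2 *\<^sub>R B" "cm A C = (-2) *\<^sub>R C" "cm B C = A"
    and br: "cm A D = D" "cm A H = 0" "cm B H = 0" "cm A F = 0" "cm B F = 0" "cm A G = 0" "cm B G = 0"
      "cm H F = p *\<^sub>R F" "cm H G = q *\<^sub>R G" "cm F G = 0"
    by (rule L8_7_basis[OF assms(1,2)])
  have nz: "D \<noteq> 0" using indep8D[OF ind, of 0 0 0 1 0 0 0 0] by auto
  have tr: "sl2_triple A B C" using sl2 by (simp add: sl2_triple_def)
  obtain a b where "a *\<^sub>R F + b *\<^sub>R G = 0" "a \<noteq> 0 \<or> b \<noteq> 0"
    using commuting_commutators_dependent[OF tr br(1) nz br(2,3), of "(1/p) *\<^sub>R F" "(1/q) *\<^sub>R G" F G]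
      br assms(3) by (auto simp: cm_scaleR)
  then show False
    using indep8D[OF ind, of 0 0 0 0 0 a b 0] by auto
qed

lemma no_faithful_L8_8:
  assumes "faithful_representation (L8_8 p) N \<phi>" "N \<le> 4"
  shows False
proof -
  obtain A B C D E F G H :: "real^4^4" where ind: "indep8 A B C D E F G H"
    and sl2: "cm A B = 2 *\<^sub>R B" "cm A C = (-2) *\<^sub>R C" "cm B C = A"
    and br: "cm A D = D" "cm A H = 0" "cm B H = 0" "cm A F = 0" "cm B F = 0" "cm A G = 0" "cm B G = 0"
      "cm H F = p *\<^sub>R F" "cm H G = F + p *\<^sub>R G" "cm F G = 0" "cm G F = 0"
    by (rule L8_8_basis[OF assms(1,2)])
  have nz: "D \<noteq> 0" "F \<noteq> 0"
    using indep8D[OF ind, of 0 0 0 1 0 0 0 0]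
      indep8D[OF ind, of 0 0 0 0 0 1 0 0] by auto
  have tr: "sl2_triple A B C" using sl2 by (simp add: sl2_triple_def)
  show False
  \<comment> \<open>For p = 0 the bracket with H is nilpotent on the span of F and G, so G need not
    be a commutator; instead H, G, F form a Heisenberg algebra in the commutant.\<close>
  proof (cases "p = 0")
    case True
    then have "F = 0"
      using commuting_commutator_zero[OF tr br(1) nz(1) br(2,3,6,7), of F] br by simp
    with nz show False by blast
  next
    case False
    \<comment> \<open>The coefficients come from inverting the Jordan block by which H acts on the
      span of F and G.\<close>
    have G: "cm H ((1/p) *\<^sub>R G - (1/p^2) *\<^sub>R F) = G"
      using False br by (simp add: cm_scaleR cm_add scaleR_add_right power2_eq_square)
    obtain a b where "a *\<^sub>R F + b *\<^sub>R G = 0" "a \<noteq> 0 \<or> b \<noteq> 0"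
      using commuting_commutators_dependent[OF tr br(1) nz(1) br(2,3), of "(1/p) *\<^sub>R F" "(1/p) *\<^sub>R G - (1/p^2) *\<^sub>R F" F G]
        br False G[symmetric] by (auto simp: cm_scaleR cm_add)
    then show False
      using indep8D[OF ind, of 0 0 0 0 0 a b 0] by auto
  qed
qed

lemma no_faithful_L8_9:
  assumes "faithful_representation (L8_9 p q) N \<phi>" "N \<le> 4" "q \<noteq> 0"
  shows False
proof -
  obtain A B C D E F G H :: "real^4^4" where ind: "indep8 A B C D E F G H"
    and sl2: "cm A B = 2 *\<^sub>R B" "cm A C = (-2) *\<^sub>R C" "cm B C = A"
    and br: "cm A D = D" "cm A H = 0" "cm B H = 0" "cm A F = 0" "cm B F = 0" "cm A G = 0" "cm B G = 0"
      "cm H F = p *\<^sub>R F + (-q) *\<^sub>R G" "cm H G = q *\<^sub>R F + p *\<^sub>R G" "cm F G = 0"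
    by (rule L8_9_basis[OF assms(1,2)])
  have nz: "D \<noteq> 0" using indep8D[OF ind, of 0 0 0 1 0 0 0 0] by auto
  have tr: "sl2_triple A B C" using sl2 by (simp add: sl2_triple_def)
  \<comment> \<open>The determinant of the bracket with H on the span of F and G; the coefficients
    below are those of the inverse matrix.\<close>
  define r where "r = p * p + q * q"
  have "r > 0" unfolding r_def using assms(3) by (simp add: sum_squares_gt_zero_iff)
  have FG: "cm H ((p/r) *\<^sub>R F + (q/r) *\<^sub>R G) = F" "cm H ((-q/r) *\<^sub>R F + (p/r) *\<^sub>R G) = G"
  proof -
    have "cm H ((p/r) *\<^sub>R F + (q/r) *\<^sub>R G) = ((p * p + q * q) / r) *\<^sub>R F"
      unfolding cm_add cm_scaleR br by (simp add: vec_eq_iff add_divide_distrib algebra_simps)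
    moreover have "cm H ((-q/r) *\<^sub>R F + (p/r) *\<^sub>R G) = ((p * p + q * q) / r) *\<^sub>R G"
      unfolding cm_add cm_scaleR br by (simp add: vec_eq_iff add_divide_distrib algebra_simps)
    ultimately show "cm H ((p/r) *\<^sub>R F + (q/r) *\<^sub>R G) = F" "cm H ((-q/r) *\<^sub>R F + (p/r) *\<^sub>R G) = G"
      using \<open>r > 0\<close> unfolding r_def[symmetric] by simp_all
  qed
  have com: "cm A (x *\<^sub>R F + y *\<^sub>R G) = 0" "cm B (x *\<^sub>R F + y *\<^sub>R G) = 0" for x y
    using br by (simp_all add: cm_add cm_scaleR)
  obtain a b where "a *\<^sub>R F + b *\<^sub>R G = 0" "a \<noteq> 0 \<or> b \<noteq> 0"
    by (rule commuting_commutators_dependent[OF tr br(1) nz br(2,3) com com FG(1)[symmetric] FG(2)[symmetric] br(10)])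
  then show False
    using indep8D[OF ind, of 0 0 0 0 0 a b 0] by auto
qed

lemma no_faithful_L8_10:
  assumes "faithful_representation (L8_10 p) N \<phi>" "N \<le> 4" "p \<noteq> 0"
  shows False
proof -
  obtain A B C D E F G H :: "real^4^4" where ind: "indep8 A B C D E F G H"
    and sl2: "cm A B = 2 *\<^sub>R B" "cm A C = (-2) *\<^sub>R C" "cm B C = A"
    and br: "cm A D = D" "cm C D = E" "cm D E = 2 *\<^sub>R F" "cm F D = 0"
      "cm A G = 0" "cm B G = 0" "cm G D = 0" "cm H G = p *\<^sub>R G"
    by (rule L8_10_basis[OF assms])
  have nz: "F \<noteq> 0" using indep8D[OF ind, of 0 0 0 0 0 1 0 0] by auto
  have tr: "sl2_triple A B C" using sl2 by (simp add: sl2_triple_def)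
  have c: "2 *\<^sub>R F \<noteq> 0" "cm (2 *\<^sub>R F) D = 0" using nz br by (simp_all add: cm_scaleR cm_add)
  obtain a b where G: "G = a *\<^sub>R mat 1 + b *\<^sub>R (2 *\<^sub>R F)"
    using doublet_center_commutant[OF tr br(1,2,3) c br(5-7)] .
  \<comment> \<open>Both G and F are commutators up to factors, so comparing traces kills the scalar
    part of G and makes it dependent on F.\<close>
  have "(p * a) *\<^sub>R mat 1 = p *\<^sub>R (G - b *\<^sub>R (2 *\<^sub>R F))" unfolding G by simp
  also have "\<dots> = cm H G + cm ((- (p * b)) *\<^sub>R D) E"
    unfolding cm_scaleR br by (simp add: scaleR_diff_right)
  finally have "p * a = 0" by (rule scalar_not_sum_of_commutators)
  then have "G = (2 * b) *\<^sub>R F" using G assms(3) by simp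
  then show False
    using indep8D[OF ind, of 0 0 0 0 0 "- (2 * b)" 1 0] by simp
qed

lemma no_faithful_L8_11:
  assumes "faithful_representation L8_11 N \<phi>" "N \<le> 4"
  shows False
proof -
  obtain A B C D E F G H :: "real^4^4" where ind: "indep8 A B C D E F G H"
    and sl2: "cm A B = 2 *\<^sub>R B" "cm A C = (-2) *\<^sub>R C" "cm B C = A"
    and br: "cm A D = D" "cm C D = E" "cm D E = 2 *\<^sub>R F" "cm F D = 0"
      "cm A G = 0" "cm B G = 0" "cm G D = 0" "cm H G = F + 2 *\<^sub>R G"
    by (rule L8_11_basis[OF assms])
  have nz: "F \<noteq> 0" using indep8D[OF ind, of 0 0 0 0 0 1 0 0] by auto
  have tr: "sl2_triple A B C" using sl2 by (simp add: sl2_triple_def)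
  have c: "2 *\<^sub>R F \<noteq> 0" "cm (2 *\<^sub>R F) D = 0" using nz br by (simp_all add: cm_scaleR cm_add)
  obtain a b where G: "G = a *\<^sub>R mat 1 + b *\<^sub>R (2 *\<^sub>R F)"
    using doublet_center_commutant[OF tr br(1,2,3) c br(5-7)] .
  \<comment> \<open>Here [H, G] contributes an additional F, which is half of [D, E]; this is the
    origin of the summand 1 / 2.\<close>
  have "(2 * a) *\<^sub>R mat 1 = 2 *\<^sub>R (G - b *\<^sub>R (2 *\<^sub>R F))" unfolding G by simp
  also have "\<dots> = cm H G + cm ((- (2 * b) - 1 / 2) *\<^sub>R D) E"
    unfolding cm_scaleR br by (simp add: vec_eq_iff algebra_simps)
  finally have "2 * a = 0" by (rule scalar_not_sum_of_commutators)
  then have "G = (2 * b) *\<^sub>R F" using G by simp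
  then show False
    using indep8D[OF ind, of 0 0 0 0 0 "- (2 * b)" 1 0] by simp
qed

text \<open>Both conclusions come from the module V_1 + V_1: its 2x2 matrices force p = 1, and
  \<open>B ** C + C ** B = mat 1\<close> excludes a vector killed by B and C, which padding would
  produce for N < 4.\<close>

lemma faithful_L8_12:
  assumes "faithful_representation (L8_12 p) N \<phi>" "N \<le> 4" "p \<noteq> 0"
  shows "p = 1 \<and> N = 4"
proof -
  obtain A B C D E F G H :: "real^4^4" where ind: "indep8 A B C D E F G H"
    and sl2: "cm A B = 2 *\<^sub>R B" "cm A C = (-2) *\<^sub>R C" "cm B C = A"
    and br: "cm A D = 2 *\<^sub>R D" "cm A H = 0" "cm B H = 0" "cm C H = 0" "cm A G = 0" "cm B G = 0" "cm C G = 0"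
      "cm H D = D" "cm G D = 0" "cm H G = p *\<^sub>R G"
    and z: "N < 4 \<longrightarrow> (\<forall>M\<in>{A, B, C, D, E, F, G, H}. M *v axis 4 1 = 0 \<and> axis 4 1 v* M = 0)"
    by (rule L8_12_basis[OF assms(1,2)])
  have nz: "D \<noteq> 0" "G \<noteq> 0"
    using indep8D[OF ind, of 0 0 0 1 0 0 0 0]
      indep8D[OF ind, of 0 0 0 0 0 0 1 0] by auto
  have tr: "sl2_triple A B C" using sl2 by (simp add: sl2_triple_def)
  note sw = scaled_weight2[OF tr br(1) nz(1) br(2-7) nz(2) br(8-10) assms(3)]
  have "N = 4"
  proof (rule ccontr)
    assume "N \<noteq> 4"
    then have "B *v axis 4 1 = 0" "C *v axis 4 1 = 0" using z assms(2) by auto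
    then have "(B ** C + C ** B) *v axis 4 1 = 0"
      unfolding matrix_vector_mult_add_rdistrib matrix_vector_mul_assoc[symmetric] by simp
    then have "axis 4 1 = (0 :: real^4)" using sw(5) by simp
    then show False by (simp add: axis_eq_0_iff)
  qed
  with sw(1) show ?thesis by simp
qed

lemma no_faithful_L8_13_plus:
  assumes "faithful_representation L8_13_plus N \<phi>" "N \<le> 4"
  shows False
proof -
  obtain A B C D E F G H :: "real^4^4" where ind: "indep8 A B C D E F G H"
    and sl2: "cm A B = 2 *\<^sub>R B" "cm A C = (-2) *\<^sub>R C" "cm B C = A"
    and br: "cm A D = D" "cm C D = E" "cm A F = F" "cm C F = G" "cm D E = (-2) *\<^sub>R H" "cm F G = (-2) *\<^sub>R H"
      "cm D G = 0" "cm H D = 0"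
    by (rule L8_13_plus_basis[OF assms])
  have tr: "sl2_triple A B C" using sl2 by (simp add: sl2_triple_def)
  have "cm ((-2) *\<^sub>R H) D = 0" using br by (simp add: cm_scaleR cm_add)
  then have "(-2) *\<^sub>R H = 0" by (rule definite_heisenberg_center_zero[OF tr br(1-7)])
  then show False
    using indep8D[OF ind, of 0 0 0 0 0 0 0 1] by auto
qed

lemma no_faithful_L8_15:
  assumes "faithful_representation L8_15 N \<phi>" "N \<le> 4"
  shows False
proof -
  obtain A B C D E F G H :: "real^4^4" where ind: "indep8 A B C D E F G H"
    and sl2: "cm A B = 2 *\<^sub>R B" "cm A C = (-2) *\<^sub>R C" "cm B C = A"
    and br: "cm A D = D" "cm C D = F" "cm D F = - H" "cm H D = (-3) *\<^sub>R E" "cm D E = 0"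
    by (rule L8_15_basis[OF assms])
  have tr: "sl2_triple A B C" using sl2 by (simp add: sl2_triple_def)
  have "3 *\<^sub>R E = 0"
    by (rule iterated_doublet_zero[OF tr br(1-3)]) (simp_all add: cm_add cm_scaleR br)
  then show False
    using indep8D[OF ind, of 0 0 0 0 1 0 0 0] by auto
qed

lemma no_faithful_weight3:
  fixes A B C D E F G H :: "real^4^4"
  assumes "indep8 A B C D E F G H" "cm A B = 2 *\<^sub>R B" "cm A C = (-2) *\<^sub>R C" "cm B C = A" "cm A D = 3 *\<^sub>R D"
  shows False
proof -
  have "D = 0" by (rule no_weight3[OF _ assms(5)]) (use assms in \<open>simp add: sl2_triple_def\<close>)
  then show False
    using indep8D[OF assms(1), of 0 0 0 1 0 0 0 0] by auto
qed

lemma no_faithful_L8_19: "faithful_representation L8_19 N \<phi> \<Longrightarrow> N \<le> 4 \<Longrightarrow> False"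
  by (erule (1) L8_19_basis) (rule no_faithful_weight3)

lemma no_faithful_L8_20: "faithful_representation L8_20 N \<phi> \<Longrightarrow> N \<le> 4 \<Longrightarrow> False"
  by (erule (1) L8_20_basis) (rule no_faithful_weight3)

lemma no_faithful_L8_21:
  assumes "faithful_representation L8_21 N \<phi>" "N \<le> 4"
  shows False
proof -
  obtain A B C D E F G H :: "real^4^4" where ind: "indep8 A B C D E F G H"
    and sl2: "cm A B = 2 *\<^sub>R B" "cm A C = (-2) *\<^sub>R C" "cm B C = A"
    and br: "cm A D = 4 *\<^sub>R D" "cm B D = 0" "cm A H = (-4) *\<^sub>R H" "cm C H = 0" "cm D H = 0"
    by (rule L8_21_basis[OF assms])
  have tr: "sl2_triple A B C" using sl2 by (simp add: sl2_triple_def)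
  have nz: "D \<noteq> 0" "H \<noteq> 0"
    using indep8D[OF ind, of 0 0 0 1 0 0 0 0]
      indep8D[OF ind, of 0 0 0 0 0 0 0 1] by auto
  show False
    by (rule abelian_weight4_impossible[OF tr br(1,2) nz(1) br(3,4) nz(2) br(5)])
qed

lemma no_faithful_L8_22:
  assumes "faithful_representation L8_22 N \<phi>" "N \<le> 4"
  shows False
proof -
  obtain A B C D E F G H :: "real^4^4" where ind: "indep8 A B C D E F G H"
    and sl2: "cm A B = 2 *\<^sub>R B" "cm A C = (-2) *\<^sub>R C" "cm B C = A" and br: "cm A G = G" "cm A E = 2 *\<^sub>R E"
    by (rule L8_22_basis[OF assms])
  have tr: "sl2_triple A B C" using sl2 by (simp add: sl2_triple_def)
  have nz: "G \<noteq> 0" using indep8D[OF ind, of 0 0 0 0 0 0 1 0] by auto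
  obtain k where "E = k *\<^sub>R B" using weight2_with_doublet[OF tr br(1) nz br(2)] .
  then show False
    using indep8D[OF ind, of 0 "- k" 0 0 1 0 0 0] by simp
qed

section \<open>Minimality for the algebras given by matrices of size four\<close>

lemma no_two_doublets_small:
  fixes H E F X1 X2 :: "real^4^4"
  assumes "N < 4" "cm H E = 2 *\<^sub>R E" "cm H F = (-2) *\<^sub>R F" "cm E F = H"
    and "cm H X1 = X1" "cm H X2 = X2" "cm X1 X2 = 0"
    and "\<And>a b. a *\<^sub>R X1 + b *\<^sub>R X2 = 0 \<Longrightarrow> a = 0 \<and> b = 0" "{H, X1, X2} \<subseteq> S"
    and "N < 4 \<longrightarrow> (\<forall>M\<in>S. M *v axis 4 1 = 0 \<and> axis 4 1 v* M = 0)"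
  shows False
  by (rule doublets_commute_in_gl3[of H E F X1 X2]) (use assms in \<open>auto simp: sl2_triple_def\<close>)

lemma no_small_faithful_L8_13_minus:
  assumes "faithful_representation L8_13_minus N \<phi>" "N < 4"
  shows False
proof -
  from assms(2) have "N \<le> 4" by simp
  obtain A B C D E F G H :: "real^4^4" where ind: "indep8 A B C D E F G H"
    and sl2: "cm A B = 2 *\<^sub>R B" "cm A C = (-2) *\<^sub>R C" "cm B C = A" and br: "cm A D = D" "cm A G = G" "cm D G = 0"
    and z: "N < 4 \<longrightarrow> (\<forall>M\<in>{A, B, C, D, E, F, G, H}. M *v axis 4 1 = 0 \<and> axis 4 1 v* M = 0)"
    by (rule L8_13_minus_basis[OF assms(1) \<open>N \<le> 4\<close>])
  show False
    by (rule no_two_doublets_small[OF assms(2) sl2 br _ _ z])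
      (use indep8D[OF ind, of 0 0 0 _ 0 0 _ 0] in auto)
qed

lemma no_small_faithful_L8_14:
  assumes "faithful_representation L8_14 N \<phi>" "N < 4"
  shows False
proof -
  from assms(2) have "N \<le> 4" by simp
  obtain A B C D E F G H :: "real^4^4" where ind: "indep8 A B C D E F G H"
    and sl2: "cm A B = 2 *\<^sub>R B" "cm A C = (-2) *\<^sub>R C" "cm B C = A" and br: "cm A D = D" "cm A F = F" "cm D F = 0"
    and z: "N < 4 \<longrightarrow> (\<forall>M\<in>{A, B, C, D, E, F, G, H}. M *v axis 4 1 = 0 \<and> axis 4 1 v* M = 0)"
    by (rule L8_14_basis[OF assms(1) \<open>N \<le> 4\<close>])
  show False
    by (rule no_two_doublets_small[OF assms(2) sl2 br _ _ z])
      (use indep8D[OF ind, of 0 0 0 _ 0 _ 0 0] in auto)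
qed

lemma no_small_faithful_L8_16:
  assumes "faithful_representation L8_16 N \<phi>" "N < 4"
  shows False
proof -
  from assms(2) have "N \<le> 4" by simp
  obtain A B C D E F G H :: "real^4^4" where ind: "indep8 A B C D E F G H"
    and sl2: "cm A B = 2 *\<^sub>R B" "cm A C = (-2) *\<^sub>R C" "cm B C = A" and br: "cm A D = D" "cm A E = E" "cm D E = 0"
    and z: "N < 4 \<longrightarrow> (\<forall>M\<in>{A, B, C, D, E, F, G, H}. M *v axis 4 1 = 0 \<and> axis 4 1 v* M = 0)"
    by (rule L8_16_basis[OF assms(1) \<open>N \<le> 4\<close>])
  show False
    by (rule no_two_doublets_small[OF assms(2) sl2 br _ _ z])
      (use indep8D[OF ind, of 0 0 0 _ _ 0 0 0] in auto)
qed

lemma no_small_faithful_L8_17: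
  assumes "faithful_representation (L8_17 lam p) N \<phi>" "N < 4"
  shows False
proof -
  from assms(2) have "N \<le> 4" by simp
  obtain A B C D E F G H :: "real^4^4" where ind: "indep8 A B C D E F G H"
    and sl2: "cm A B = 2 *\<^sub>R B" "cm A C = (-2) *\<^sub>R C" "cm B C = A" and br: "cm A D = D" "cm A E = E" "cm D E = 0"
    and z: "N < 4 \<longrightarrow> (\<forall>M\<in>{A, B, C, D, E, F, G, H}. M *v axis 4 1 = 0 \<and> axis 4 1 v* M = 0)"
    by (rule L8_17_basis[OF assms(1) \<open>N \<le> 4\<close>])
  show False
    by (rule no_two_doublets_small[OF assms(2) sl2 br _ _ z])
      (use indep8D[OF ind, of 0 0 0 _ _ 0 0 0] in auto)
qed

lemma no_small_faithful_L8_18: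
  assumes "faithful_representation (L8_18 lam nu) N \<phi>" "N < 4"
  shows False
proof -
  from assms(2) have "N \<le> 4" by simp
  obtain A B C D E F G H :: "real^4^4" where ind: "indep8 A B C D E F G H"
    and sl2: "cm A B = 2 *\<^sub>R B" "cm A C = (-2) *\<^sub>R C" "cm B C = A" and br: "cm A E = E" "cm A F = F" "cm E F = 0"
    and z: "N < 4 \<longrightarrow> (\<forall>M\<in>{A, B, C, D, E, F, G, H}. M *v axis 4 1 = 0 \<and> axis 4 1 v* M = 0)"
    by (rule L8_18_basis[OF assms(1) \<open>N \<le> 4\<close>])
  show False
    by (rule no_two_doublets_small[OF assms(2) sl2 br _ _ z])
      (use indep8D[OF ind, of 0 0 0 0 _ _ 0 0] in auto)
qed

text \<open>For \<open>p = 1\<close> the radical of \<open>L8_12 p\<close> is spanned by \<open>h\<close> and \<open>Hom(V\<^sub>1, V\<^sub>1) = V\<^sub>2 \<oplus> V\<^sub>0\<close>,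
  so the algebra acts on \<open>V\<^sub>1 \<oplus> V\<^sub>1\<close>.\<close>
lemma faithful_L8_12_1:
  "faithful_representation (L8_12 1) 4 (\<lambda>M.
     let a = (M $$ (0,0) - M $$ (1,1)) / 2; b = M $$ (1,2); c = M $$ (1,0); d = M $$ (0,4);
         e = M $$ (1,4); f = M $$ (2,4); g = M $$ (3,4); h = M $$ (1,1)
     in mat_of_rows_list 4
       [[h + a, b, e + g, - d],
        [c, h - a, f, g - e],
        [0, 0, a, b],
        [0, 0, c, - a]])" (is "faithful_representation _ _ ?\<phi>")
proof -
  let ?m = "\<lambda>a b c d e f g h :: real. mat_of_rows_list 5
    [[h + 2 * a, 2 * b, 0, 0, d], [c, h, b, 0, e], [0, 2 * c, h - 2 * a, 0, f], [0, 0, 0, 1 * h, g], [0, 0, 0, 0, 0]]"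
  \<comment> \<open>The upper right block is g times the identity plus the traceless matrix with
    rows (e, -d) and (f, -e). Since h acts on the first summand only, it scales the whole block by
    1, including g.\<close>
  let ?n = "\<lambda>a b c d e f g h :: real. mat_of_rows_list 4
    [[h + a, b, e + g, - d], [c, h - a, f, g - e], [0, 0, a, b], [0, 0, c, - a]]"
  have phi: "?\<phi> (?m a b c d e f g h) = ?n a b c d e f g h" for a b c d e f g h
    by (simp add: mat_of_rows_list_def)
  have add: "?m a b c d e f g h + ?m a' b' c' d' e' f' g' h' = ?m (a+a') (b+b') (c+c') (d+d') (e+e') (f+f') (g+g') (h+h')"
    "?n a b c d e f g h + ?n a' b' c' d' e' f' g' h' = ?n (a+a') (b+b') (c+c') (d+d') (e+e') (f+f') (g+g') (h+h')"
    for a b c d e f g h a' b' c' d' e' f' g' h'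
    by (simp_all add: rows_simps algebra_simps)
  have smult: "t \<cdot>\<^sub>m ?m a b c d e f g h = ?m (t*a) (t*b) (t*c) (t*d) (t*e) (t*f) (t*g) (t*h)"
    "t \<cdot>\<^sub>m ?n a b c d e f g h = ?n (t*a) (t*b) (t*c) (t*d) (t*e) (t*f) (t*g) (t*h)"
    for t a b c d e f g h
    by (simp_all add: rows_simps algebra_simps)
  \<comment> \<open>The bracket in coordinates, written once and inserted into both
    parametrizations: that the same coefficients serve \<open>?m\<close> and \<open>?n\<close> is
    the homomorphism property.\<close>
  let ?k = "\<lambda>M a b c d e f g h a' b' c' d' e' f' g' h' :: real. M (b*c' - c*b') (2*(a*b' - b*a')) (2*(c*a' - a*c'))
      (2*(a*d' - d*a') + 2*(b*e' - e*b') + h*d' - d*h') (c*d' - d*c' + b*f' - f*b' + h*e' - e*h')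
      (2*(c*e' - e*c') - 2*(a*f' - f*a') + h*f' - f*h') (h*g' - g*h') (0::real) :: real mat"
  have comm: "commutator (?m a b c d e f g h) (?m a' b' c' d' e' f' g' h') = ?k ?m a b c d e f g h a' b' c' d' e' f' g' h'"
    "commutator (?n a b c d e f g h) (?n a' b' c' d' e' f' g' h') = ?k ?n a b c d e f g h a' b' c' d' e' f' g' h'"
    for a b c d e f g h a' b' c' d' e' f' g' h'
    by (simp_all add: commutator_def rows_simps upt_small algebra_simps)
  have L: "x \<in> L8_12 1 \<longleftrightarrow> (\<exists>a b c d e f g h. x = ?m a b c d e f g h)" for x
    by (simp add: L8_12_def)
  have inj: "?m a b c d e f g h = ?m a' b' c' d' e' f' g' h'"
    if "?n a b c d e f g h = ?n a' b' c' d' e' f' g' h'" for a b c d e f g h a' b' c' d' e' f' g' h'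
  proof -
    have "a = a' \<and> b = b' \<and> c = c' \<and> d = d' \<and> e + g = e' + g' \<and> g - e = g' - e' \<and> f = f' \<and> h + a = h' + a'"
      using that by (simp add: rows_simps)
    then have "a = a'" "b = b'" "c = c'" "d = d'" "e = e'" "f = f'" "g = g'" "h = h'" by linarith+
    then show ?thesis by simp
  qed
  show ?thesis
    unfolding faithful_representation_def lie_representation_def
  proof (intro conjI ballI allI)
    show "?\<phi> \<in> L8_12 1 \<rightarrow> carrier_mat 4 4"
      by (rule funcsetI) (simp add: Let_def mat_of_rows_list_carrier)
    show "inj_on ?\<phi> (L8_12 1)"
    proof (rule inj_onI)
      fix x y assume "x \<in> L8_12 1" "y \<in> L8_12 1" and eq: "?\<phi> x = ?\<phi> y"
      then obtain a b c d e f g h a' b' c' d' e' f' g' h' where xy: "x = ?m a b c d e f g h" "y = ?m a' b' c' d' e' f' g' h'"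
        unfolding L by blast
      show "x = y" using eq unfolding xy phi by (rule inj)
    qed
  next
    fix x y assume "x \<in> L8_12 1" "y \<in> L8_12 1"
    then obtain a b c d e f g h a' b' c' d' e' f' g' h' where xy: "x = ?m a b c d e f g h" "y = ?m a' b' c' d' e' f' g' h'"
      unfolding L by blast
    show "?\<phi> (x + y) = ?\<phi> x + ?\<phi> y" unfolding xy add(1) phi add(2) ..
    show "?\<phi> (commutator x y) = commutator (?\<phi> x) (?\<phi> y)" unfolding xy comm(1) phi comm(2) ..
  next
    fix t x assume "x \<in> L8_12 1"
    then obtain a b c d e f g h where x: "x = ?m a b c d e f g h"
      unfolding L by blast
    show "?\<phi> (t \<cdot>\<^sub>m x) = t \<cdot>\<^sub>m ?\<phi> x" unfolding x smult(1) phi smult(2) ..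
  qed
qed

theorem mainTheorem2:
  shows
   "mu (L8_12 1) = 4 \<and>
    mu L8_13_minus = 4 \<and>
    mu L8_14 = 4 \<and>
    mu L8_16 = 4 \<and>
    (\<forall>lam p. mu (L8_17 lam p) = 4) \<and>
    (\<forall>lam nu. mu (L8_18 lam nu) = 4) \<and>
    (\<forall>p. p \<noteq> 0 \<longrightarrow> mu (L8_1 p) > 4) \<and>
    mu L8_2 > 4 \<and>
    mu L8_3 > 4 \<and>
    (\<forall>p. mu (L8_4 p) > 4) \<and>
    mu L8_5 > 4 \<and>
    mu L8_6 > 4 \<and>
    (\<forall>p q. p * q \<noteq> 0 \<longrightarrow> mu (L8_7 p q) > 4) \<and>
    (\<forall>p. mu (L8_8 p) > 4) \<and>
    (\<forall>p q. q \<noteq> 0 \<longrightarrow> mu (L8_9 p q) > 4) \<and>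
    (\<forall>p. p \<noteq> 0 \<longrightarrow> mu (L8_10 p) > 4) \<and>
    mu L8_11 > 4 \<and>
    (\<forall>p. p \<noteq> 0 \<and> p \<noteq> 1 \<longrightarrow> mu (L8_12 p) > 4) \<and>
    mu L8_13_plus > 4 \<and>
    mu L8_15 > 4 \<and>
    mu L8_19 > 4 \<and>
    mu L8_20 > 4 \<and>
    mu L8_21 > 4 \<and>
    mu L8_22 > 4"
proof (intro conjI allI impI)
  show "mu (L8_12 1) = 4"
    by (rule mu_eqI[OF faithful_L8_12_1]) (drule faithful_L8_12, simp_all)
  show "mu L8_13_minus = 4"
    by (rule mu_eqI, rule faithful_identity, force simp: L8_13_minus_def mat_of_rows_list_carrier)
      (rule no_small_faithful_L8_13_minus)
  show "mu L8_14 = 4"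
    by (rule mu_eqI, rule faithful_identity, force simp: L8_14_def mat_of_rows_list_carrier)
      (rule no_small_faithful_L8_14)
  show "mu L8_16 = 4"
    by (rule mu_eqI, rule faithful_identity, force simp: L8_16_def mat_of_rows_list_carrier)
      (rule no_small_faithful_L8_16)
  show "mu (L8_17 lam p) = 4" for lam p
    by (rule mu_eqI, rule faithful_identity, force simp: L8_17_def mat_of_rows_list_carrier)
      (rule no_small_faithful_L8_17)
  show "mu (L8_18 lam nu) = 4" for lam nu
    by (rule mu_eqI, rule faithful_identity, force simp: L8_18_def mat_of_rows_list_carrier)
      (rule no_small_faithful_L8_18)
  show "mu (L8_1 p) > 4" if "p \<noteq> 0" for p
    by (rule mu_greaterI, rule faithful_identity[of _ 5], force simp: L8_1_def mat_of_rows_list_carrier)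
      (erule no_faithful_L8_1, assumption, rule that)
  show "mu L8_2 > 4"
    by (rule mu_greaterI, rule faithful_identity[of _ 6], force simp: L8_2_def mat_of_rows_list_carrier)
      (erule no_faithful_L8_2, assumption)
  show "mu L8_3 > 4"
    by (rule mu_greaterI, rule faithful_identity[of _ 5], force simp: L8_3_def mat_of_rows_list_carrier)
      (erule no_faithful_L8_3, assumption)
  show "mu (L8_4 p) > 4" for p
    by (rule mu_greaterI, rule faithful_identity[of _ 5], force simp: L8_4_def mat_of_rows_list_carrier)
      (erule no_faithful_L8_4, assumption)
  show "mu L8_5 > 4"
    by (rule mu_greaterI, rule faithful_identity[of _ 6], force simp: L8_5_def mat_of_rows_list_carrier)
      (erule no_faithful_L8_5, assumption)
  show "mu L8_6 > 4"
    by (rule mu_greaterI, rule faithful_identity[of _ 6], force simp: L8_6_def mat_of_rows_list_carrier)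
      (erule no_faithful_L8_6, assumption)
  show "mu (L8_7 p q) > 4" if "p * q \<noteq> 0" for p q
    by (rule mu_greaterI, rule faithful_identity[of _ 5], force simp: L8_7_def mat_of_rows_list_carrier)
      (erule no_faithful_L8_7, assumption, rule that)
  show "mu (L8_8 p) > 4" for p
    by (rule mu_greaterI, rule faithful_identity[of _ 5], force simp: L8_8_def mat_of_rows_list_carrier)
      (erule no_faithful_L8_8, assumption)
  show "mu (L8_9 p q) > 4" if "q \<noteq> 0" for p q
    by (rule mu_greaterI, rule faithful_identity[of _ 5], force simp: L8_9_def mat_of_rows_list_carrier)
      (erule no_faithful_L8_9, assumption, rule that)
  show "mu (L8_10 p) > 4" if "p \<noteq> 0" for p
    by (rule mu_greaterI, rule faithful_identity[of _ 5], force simp: L8_10_def mat_of_rows_list_carrier)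
      (erule no_faithful_L8_10, assumption, rule that)
  show "mu L8_11 > 4"
    by (rule mu_greaterI, rule faithful_identity[of _ 5], force simp: L8_11_def mat_of_rows_list_carrier)
      (erule no_faithful_L8_11, assumption)
  show "mu (L8_12 p) > 4" if "p \<noteq> 0 \<and> p \<noteq> 1" for p
    by (rule mu_greaterI, rule faithful_identity[of _ 5], force simp: L8_12_def mat_of_rows_list_carrier)
      (drule faithful_L8_12, use that in auto)
  show "mu L8_13_plus > 4"
    by (rule mu_greaterI, rule faithful_identity[of _ 6], force simp: L8_13_plus_def mat_of_rows_list_carrier)
      (erule no_faithful_L8_13_plus, assumption)
  show "mu L8_15 > 4"
    by (rule mu_greaterI, rule faithful_identity[of _ 6], force simp: L8_15_def mat_of_rows_list_carrier)
      (erule no_faithful_L8_15, assumption)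
  show "mu L8_19 > 4"
    by (rule mu_greaterI, rule faithful_identity[of _ 6], force simp: L8_19_def mat_of_rows_list_carrier)
      (erule no_faithful_L8_19, assumption)
  show "mu L8_20 > 4"
    by (rule mu_greaterI, rule faithful_identity[of _ 5], force simp: L8_20_def mat_of_rows_list_carrier)
      (erule no_faithful_L8_20, assumption)
  show "mu L8_21 > 4"
    by (rule mu_greaterI, rule faithful_identity[of _ 6], force simp: L8_21_def mat_of_rows_list_carrier)
      (erule no_faithful_L8_21, assumption)
  show "mu L8_22 > 4"
    by (rule mu_greaterI, rule faithful_identity[of _ 5], force simp: L8_22_def mat_of_rows_list_carrier)
      (erule no_faithful_L8_22, assumption)
qed

end
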